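(* Let $n\ge 1$ and $1\le j\le \lfloor \frac{n}{2}\rfloor$ be integers, and let $G=C_n(1,\ldots,\widehat{j},\ldots,\lfloor\frac n2\rfloor)$. If $d=\gcd(j,n)$, then \[ \mathrm{reg}(I(G))=\begin{cases}2 & \text{if } n=2j \text{ or } n=3d,\\ 3 & \text{otherwise.}\end{cases} \]
   Context: For an integer $n\ge 1$ and a subset $S\subseteq\{1,\ldots,\lfloor\frac n2\rfloor\}$, the circulant graph $C_n(S)$ is the finite simple graph on the vertex set $\{x_1,\ldots,x_n\}$ such that $\{x_p,x_q\}$ is an edge if and only if $|p-q|\in S$ or $n-|p-q|\in S$. The notation $C_n(1,\ldots,\widehat{j},\ldots,\lfloor\frac n2\rfloor)$ means $C_n(S)$ with $S=\{1,\ldots,\lfloor\frac n2\rfloor\}\setminus\{j\}$. For a finite simple graph $G$ with vertices $x_1,\ldots,x_n$ and edge set $E(G)$, the edge ideal is $I(G)=\langle x_px_q\mid \{x_p,x_q\}\in E(G)\rangle\subseteq R=k[x_1,\ldots,x_n]$, where $k$ is any field. The Castelnuovo-Mumford regularity is $\mathrm{reg}(I(G))=\max\{b-a\mid\beta_{a,b}(I(G))\neq0\}$, where the graded Betti number $\beta_{a,b}(I(G))$ is the number of summands $R(-b)$ in homological position $a$ of the minimal graded free resolution of the ideal $I(G)$ (position $0$ corresponding to the minimal generators of $I(G)$).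
   Formalization: The formal theorem also assumes I(G) ≠ 0; this excludes only (n,j) = (2,1) and (3,1), where G has no edges, all Betti numbers vanish, and reg(I(G)) is a maximum over the empty set, hence undefined. *)

theory Defs
  imports Complex_Main "HOL-Library.Poly_Mapping"
begin

text \<open>
  Polynomials are finitely supported functions on exponent vectors, with the convolution product of
  Poly_Mapping. The type allows all variables \<open>x\<^sub>i\<close>, \<open>i :: nat\<close>; the ring \<open>k[x\<^sub>1,\<dots>,x\<^sub>n]\<close> is the
  carrier \<open>polys n\<close>.
\<close>

type_synonym 'k mpoly = "(nat \<Rightarrow>\<^sub>0 nat) \<Rightarrow>\<^sub>0 'k"

definition var :: "nat \<Rightarrow> 'k::field mpoly"
  where "var i = Poly_Mapping.single (Poly_Mapping.single i 1) 1"

definition polys :: "nat \<Rightarrow> 'k::field mpoly set"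
  where "polys n = {p. \<forall>m \<in> Poly_Mapping.keys p. Poly_Mapping.keys m \<subseteq> {1..n}}"

definition mon_degree :: "(nat \<Rightarrow>\<^sub>0 nat) \<Rightarrow> nat"
  where "mon_degree m = (\<Sum>i \<in> Poly_Mapping.keys m. Poly_Mapping.lookup m i)"

text \<open>The zero polynomial is homogeneous of every degree; it is the only one in negative degrees.\<close>

definition homogeneous :: "int \<Rightarrow> 'k::field mpoly \<Rightarrow> bool"
  where "homogeneous e p \<longleftrightarrow> (\<forall>m \<in> Poly_Mapping.keys p. int (mon_degree m) = e)"

definition ideal_gen :: "nat \<Rightarrow> 'k::field mpoly set \<Rightarrow> 'k mpoly set"
  where "ideal_gen n B =
    {\<Sum>b\<in>A. c b * b | A c. finite A \<and> A \<subseteq> B \<and> (\<forall>b\<in>A. c b \<in> polys n)}"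

definition irrelevant_ideal :: "nat \<Rightarrow> 'k::field mpoly set"
  where "irrelevant_ideal n = ideal_gen n (var ` {1..n})"


text \<open>
  Graphs on the vertices \<open>x\<^sub>1,\<dots>,x\<^sub>n\<close> are given by their sets of edges, a vertex being represented by
  its index.
\<close>

definition circulant_edges :: "nat \<Rightarrow> nat set \<Rightarrow> nat set set"
  where "circulant_edges n S =
    {{p, q} | p q. p \<in> {1..n} \<and> q \<in> {1..n} \<and> p \<noteq> q \<and>
       (nat \<bar>int p - int q\<bar> \<in> S \<or> n - nat \<bar>int p - int q\<bar> \<in> S)}"

definition edge_ideal :: "nat \<Rightarrow> nat set set \<Rightarrow> 'k::field mpoly set"
  where "edge_ideal n E = ideal_gen n {var p * var q | p q. {p, q} \<in> E}"


text \<open>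
  The data of a complex \<open>\<cdots> \<rightarrow> F\<^sub>1 \<rightarrow> F\<^sub>0 \<rightarrow> R\<close> of graded free modules of finite rank.
  Here \<open>F\<^sub>a\<close> is the direct sum of the modules \<open>R(-twist a i)\<close> for \<open>i < rk a\<close>, the map
  \<open>F\<^sub>0 \<rightarrow> R\<close> sends the \<open>i\<close>-th basis vector to \<open>aug i\<close>, and \<open>F\<^sub>a\<^sub>+\<^sub>1 \<rightarrow> F\<^sub>a\<close> sends the \<open>i\<close>-th basis
  vector to the vector with entries \<open>dmat a i l\<close>, \<open>l < rk a\<close>.
\<close>

record (overloaded) 'k free_complex =
  rk :: "nat \<Rightarrow> nat"
  twist :: "nat \<Rightarrow> nat \<Rightarrow> int"
  aug :: "nat \<Rightarrow> 'k mpoly"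
  dmat :: "nat \<Rightarrow> nat \<Rightarrow> nat \<Rightarrow> 'k mpoly"

definition free_mod :: "nat \<Rightarrow> nat \<Rightarrow> (nat \<Rightarrow> 'k::field mpoly) set"
  where "free_mod n r = {v. (\<forall>i<r. v i \<in> polys n) \<and> (\<forall>i\<ge>r. v i = 0)}"

definition aug_map :: "'k::field free_complex \<Rightarrow> (nat \<Rightarrow> 'k mpoly) \<Rightarrow> 'k mpoly"
  where "aug_map F v = (\<Sum>i<rk F 0. v i * aug F i)"

definition diff_map ::
    "'k::field free_complex \<Rightarrow> nat \<Rightarrow> (nat \<Rightarrow> 'k mpoly) \<Rightarrow> (nat \<Rightarrow> 'k mpoly)"
  where "diff_map F a v =
    (\<lambda>l. if l < rk F a then \<Sum>i<rk F (Suc a). v i * dmat F a i l else 0)"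

text \<open>The maps have entries in \<open>R\<close> and preserve degrees.\<close>

definition graded_complex :: "nat \<Rightarrow> 'k::field free_complex \<Rightarrow> bool"
  where "graded_complex n F \<longleftrightarrow>
    (\<forall>i<rk F 0. aug F i \<in> polys n \<and> homogeneous (twist F 0 i) (aug F i)) \<and>
    (\<forall>a. \<forall>i<rk F (Suc a). \<forall>l<rk F a.
       dmat F a i l \<in> polys n \<and> homogeneous (twist F (Suc a) i - twist F a l) (dmat F a i l))"

definition graded_free_resolution ::
    "nat \<Rightarrow> 'k::field mpoly set \<Rightarrow> 'k free_complex \<Rightarrow> bool"
  where "graded_free_resolution n I F \<longleftrightarrow>
    graded_complex n F \<and>
    aug_map F ` free_mod n (rk F 0) = I \<and>
    {v \<in> free_mod n (rk F 0). aug_map F v = 0} = diff_map F 0 ` free_mod n (rk F 1) \<and>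
    (\<forall>a. {v \<in> free_mod n (rk F (Suc a)). diff_map F a v = (\<lambda>_. 0)} =
         diff_map F (Suc a) ` free_mod n (rk F (Suc (Suc a))))"

text \<open>Minimality: the image of \<open>F\<^sub>a\<^sub>+\<^sub>1\<close> lies in \<open>\<mm> F\<^sub>a\<close>, where \<open>\<mm> = (x\<^sub>1,\<dots>,x\<^sub>n)\<close>.\<close>

definition minimal_graded_free_resolution ::
    "nat \<Rightarrow> 'k::field mpoly set \<Rightarrow> 'k free_complex \<Rightarrow> bool"
  where "minimal_graded_free_resolution n I F \<longleftrightarrow>
    graded_free_resolution n I F \<and>
    (\<forall>a. \<forall>i<rk F (Suc a). \<forall>l<rk F a. dmat F a i l \<in> irrelevant_ideal n)"

text \<open>
  The minimal graded free resolution of a homogeneous ideal exists and is unique up to isomorphism,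
  so the choice made here does not affect the number.
\<close>

definition graded_betti :: "nat \<Rightarrow> 'k::field mpoly set \<Rightarrow> nat \<Rightarrow> int \<Rightarrow> nat"
  where "graded_betti n I a b =
    (let F = (SOME F. minimal_graded_free_resolution n I F)
     in card {i. i < rk F a \<and> twist F a i = b})"

text \<open>Only meaningful for \<open>I \<noteq> 0\<close>: for \<open>I = 0\<close> the maximum is over the empty set.\<close>

definition regularity :: "nat \<Rightarrow> 'k::field mpoly set \<Rightarrow> int"
  where "regularity n I = Max {b - int a | a b. graded_betti n I a b \<noteq> 0}"

end

theory Submission
  imports Defs
begin

text \<open>
  The graded Betti numbers of \<open>I = I(G)\<close> are the dimensions of the Koszul homology of \<open>I\<close>: splitting a
  minimal resolution into short exact sequences shifts homology from one syzygy module to the next,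
  because the Koszul complex of a free module is exact. The same shift bounds the degrees of minimal
  generators of every syzygy module, so that a minimal resolution by modules of finite rank exists.
  In multidegree \<open>m\<close> the Koszul complex of \<open>I\<close> is a complex of faces of a simplex. A multiplicity
  \<open>m v \<ge> 2\<close> makes it a cone, and for squarefree \<open>m\<close> it computes the cohomology of the clique complex
  of the complement of \<open>G\<close> restricted to the support of \<open>m\<close>. The complement of the circulant graph is
  a disjoint union of \<open>d\<close> cycles of length \<open>n / d\<close>. Lengths 2 and 3 give disjoint simplices and hence
  regularity 2; otherwise the clique complex is a disjoint union of circles of length at least 4,
  which has first but no second cohomology, and the regularity is 3.
\<close>

section \<open>Boundary operators and cones\<close>

text \<open>Regularity only sees which Betti numbers are nonzero, so no homology groups or
  dimensions are formed: \<open>koszul_acyclic\<close> merely says that each cycle of given degrees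
  is a boundary. As this determines the twists of every minimal resolution, the \<open>SOME\<close>
  in \<open>graded_betti\<close> calls for existence but not for uniqueness. Existence is the
  obstacle, since all ranks must be finite. Finite generation of the syzygy modules is drawn from
  the Koszul side instead of Noetherianity: if H_0 of a graded submodule vanishes above some degree,
  finitely many graded pieces generate it. A bound on \<open>b - i\<close> passes to syzygies with a
  loss of one, so vanishing for the graph is needed before the resolution is available.

  Topology enters through explicit fillings only. On a squarefree multidegree W, a set \<sigma>
  stands for the vertex set W - \<sigma>, and belongs to the complex of I if W - \<sigma> contains
  an edge. Homological degree i and internal degree b then correspond to reduced cohomology in
  degree b - i - 2 of the clique complex of the complement, so that b - i = 2, 3, 4 are the degrees
  0, 1, 2.\<close>

definition ksign :: "nat \<Rightarrow> nat set \<Rightarrow> 'a::comm_ring_1"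
  where "ksign j \<tau> = (- 1) ^ card {l \<in> \<tau>. l < j}"

text \<open>A chain assigns to each set \<open>\<sigma>\<close> the coefficient of the basis element \<open>e\<^sub>\<sigma>\<close> of the exterior algebra;
  \<open>kbd V x\<close> is the Koszul differential for the sequence \<open>x j\<close>, \<open>j \<in> V\<close>.\<close>

definition kbd :: "nat set \<Rightarrow> (nat \<Rightarrow> 'a::comm_ring_1) \<Rightarrow> (nat set \<Rightarrow> 'a) \<Rightarrow> nat set \<Rightarrow> 'a"
  where "kbd V x c \<tau> = (\<Sum>j\<in>V - \<tau>. ksign j \<tau> * x j * c (insert j \<tau>))"

text \<open>Exterior multiplication by e_v from the left, in coefficients; the sign moves e_v past
  the smaller elements. With all \<open>x j = 1\<close> this is the contraction of the full simplex
  to the vertex v.\<close>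

definition kcone :: "nat \<Rightarrow> (nat set \<Rightarrow> 'a::comm_ring_1) \<Rightarrow> nat set \<Rightarrow> 'a"
  where "kcone v \<phi> \<sigma> = (if v \<in> \<sigma> then ksign v (\<sigma> - {v}) * \<phi> (\<sigma> - {v}) else 0)"

lemma ksign_square [simp]: "ksign j \<tau> * ksign j \<tau> = 1"
  by (simp add: ksign_def flip: power_mult_distrib)

lemma ksign_square_left [simp]: "ksign j \<tau> * (ksign j \<tau> * a) = a"
  by (simp flip: mult.assoc)

text \<open>Only elements below j are counted, so the counted set is finite whatever \<tau>
  is.\<close>

lemma ksign_insert:
  assumes "l \<notin> \<tau>"
  shows "ksign j (insert l \<tau>) = (if l < j then - ksign j \<tau> else ksign j \<tau>)"
proof (cases "l < j")
  case True
  then have "{k \<in> insert l \<tau>. k < j} = insert l {k \<in> \<tau>. k < j}"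
    by auto
  with True assms show ?thesis
    by (simp add: ksign_def)
next
  case False
  then have "{k \<in> insert l \<tau>. k < j} = {k \<in> \<tau>. k < j}"
    by auto
  with False show ?thesis
    by (simp add: ksign_def)
qed

text \<open>Anticommutativity of e_j and e_l: exactly one of the two indices lies below the other,
  so exactly one side picks up an extra sign.\<close>

lemma ksign_swap:
  assumes "j \<noteq> l" "j \<notin> \<tau>" "l \<notin> \<tau>"
  shows "ksign j \<tau> * ksign l (insert j \<tau>) = - (ksign l \<tau> * ksign j (insert l \<tau>))"
  using assms by (auto simp: ksign_insert mult.commute)

text \<open>The double sum runs over ordered pairs of distinct indices outside \<tau>, and swapping
  a pair flips the sign. Matching the pairs \<open>j < l\<close> with the pairs \<open>l < j\<close>
  gives cancellation in every characteristic.\<close>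

lemma kbd_kbd:
  assumes "finite V"
  shows "kbd V x (kbd V x c) \<tau> = 0"
proof -
  define T where "T = (\<lambda>(j, l). ksign j \<tau> * x j * (ksign l (insert j \<tau>) * x l * c (insert l (insert j \<tau>))))"
  define A where "A = {(j, l). j \<in> V - \<tau> \<and> l \<in> V - \<tau> \<and> j < l}"
  define B where "B = {(j, l). j \<in> V - \<tau> \<and> l \<in> V - \<tau> \<and> l < j}"
  have fin: "finite A" "finite B"
    by (rule finite_subset[of _ "V \<times> V"]; use assms in \<open>auto simp: A_def B_def\<close>)+
  have "kbd V x (kbd V x c) \<tau> = (\<Sum>j\<in>V - \<tau>. \<Sum>l\<in>V - insert j \<tau>. T (j, l))"
    by (simp add: kbd_def T_def sum_distrib_left)
  also have "\<dots> = sum T (SIGMA j:V - \<tau>. V - insert j \<tau>)"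
    using assms by (subst sum.Sigma) auto
  also have "(SIGMA j:V - \<tau>. V - insert j \<tau>) = A \<union> B"
    by (auto simp: A_def B_def)
  also have "sum T (A \<union> B) = sum T A + sum T B"
    using fin by (intro sum.union_disjoint) (auto simp: A_def B_def)
  also have "sum T B = (\<Sum>p\<in>A. T (prod.swap p))"
    by (intro sum.reindex_bij_witness[of _ prod.swap prod.swap]) (auto simp: A_def B_def)
  also have "\<dots> = (\<Sum>p\<in>A. - T p)"
  proof (rule sum.cong[OF refl])
    fix p assume "p \<in> A"
    then obtain j l where p: "p = (j, l)" "j \<noteq> l" "j \<notin> \<tau>" "l \<notin> \<tau>"
      by (auto simp: A_def)
    have "T (l, j) = (ksign l \<tau> * ksign j (insert l \<tau>)) * (x j * x l * c (insert l (insert j \<tau>)))"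
      by (simp add: T_def insert_commute algebra_simps)
    also have "\<dots> = - T (j, l)"
      using p by (subst ksign_swap) (auto simp: T_def algebra_simps)
    finally show "T (prod.swap p) = - T p"
      by (simp add: p)
  qed
  finally show ?thesis
    by (simp add: sum_negf)
qed

text \<open>The Leibniz rule for exterior multiplication by e_v. It makes the cone over a cycle a
  filling of it, and every filling in a single multidegree below is built from it.\<close>

lemma kcone_homotopy:
  assumes "finite V" "v \<in> V"
  shows "kbd V (\<lambda>_. 1) (kcone v \<phi>) \<tau> + kcone v (kbd V (\<lambda>_. 1) \<phi>) \<tau> = \<phi> \<tau>"
proof (cases "v \<in> \<tau>")
  case False
  have "kbd V (\<lambda>_. 1) (kcone v \<phi>) \<tau> = (\<Sum>j\<in>V - \<tau>. if j = v then \<phi> \<tau> else 0)"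
    unfolding kbd_def using False by (intro sum.cong) (auto simp: kcone_def)
  then show ?thesis
    using assms False by (simp add: kcone_def)
next
  case True
  define \<rho> where "\<rho> = \<tau> - {v}"
  have \<tau>: "\<tau> = insert v \<rho>" "v \<notin> \<rho>"
    using True by (auto simp: \<rho>_def)
  have V: "V - \<rho> = insert v (V - \<tau>)"
    using assms \<tau> by auto
  \<comment> \<open>The summand for v itself returns \<open>\<phi> \<tau>\<close>; the others cancel
    against the boundary of the cone.\<close>
  have "kcone v (kbd V (\<lambda>_. 1) \<phi>) \<tau> = \<phi> \<tau> + (\<Sum>j\<in>V - \<tau>. ksign v \<rho> * ksign j \<rho> * \<phi> (insert j \<rho>))"
  proof -
    have "kcone v (kbd V (\<lambda>_. 1) \<phi>) \<tau> = ksign v \<rho> * (\<Sum>j\<in>insert v (V - \<tau>). ksign j \<rho> * \<phi> (insert j \<rho>))"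
      unfolding kcone_def kbd_def V[symmetric] using True by (simp add: \<rho>_def)
    also have "\<dots> = ksign v \<rho> * (ksign v \<rho> * \<phi> \<tau> + (\<Sum>j\<in>V - \<tau>. ksign j \<rho> * \<phi> (insert j \<rho>)))"
      using assms True \<tau>(1) by simp
    finally show ?thesis
      by (simp add: distrib_left sum_distrib_left mult.assoc)
  qed
  moreover have "kbd V (\<lambda>_. 1) (kcone v \<phi>) \<tau> = (\<Sum>j\<in>V - \<tau>. - (ksign v \<rho> * ksign j \<rho> * \<phi> (insert j \<rho>)))"
    unfolding kbd_def
  proof (rule sum.cong[OF refl])
    fix j assume j: "j \<in> V - \<tau>"
    then have "insert j \<tau> - {v} = insert j \<rho>" "j \<notin> \<rho>" "j \<noteq> v"
      using \<tau> by auto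
    then show "ksign j \<tau> * 1 * kcone v \<phi> (insert j \<tau>) = - (ksign v \<rho> * ksign j \<rho> * \<phi> (insert j \<rho>))"
      using \<tau> by (auto simp: kcone_def ksign_insert)
  qed
  ultimately show ?thesis
    by (simp add: sum_negf)
qed

lemma kbd_diff: "kbd V x (\<lambda>\<sigma>. c \<sigma> - e \<sigma>) \<tau> = kbd V x c \<tau> - kbd V x e \<tau>"
  by (simp add: kbd_def right_diff_distrib sum_subtractf)

lemma kbd_mult_right: "kbd V x (\<lambda>\<sigma>. c \<sigma> * a) \<tau> = kbd V x c \<tau> * a"
  by (simp add: kbd_def sum_distrib_right mult.assoc)

lemma kbd_sum: "kbd V x (\<lambda>\<sigma>. \<Sum>i\<in>A. c i \<sigma>) \<tau> = (\<Sum>i\<in>A. kbd V x (c i) \<tau>)"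
  unfolding kbd_def by (simp add: sum_distrib_left) (rule sum.swap)

lemma kbd_zero [simp]: "kbd V x (\<lambda>_. 0) \<tau> = 0"
  by (simp add: kbd_def)

section \<open>Polynomials and monomials\<close>

abbreviation "keys \<equiv> Poly_Mapping.keys"
abbreviation "lookup \<equiv> Poly_Mapping.lookup"
abbreviation "single \<equiv> Poly_Mapping.single"

section \<open>Degrees and divisibility of monomials\<close>

lemma mon_degree_superset:
  assumes "finite A" "keys u \<subseteq> A"
  shows "mon_degree u = (\<Sum>i\<in>A. lookup u i)"
  unfolding mon_degree_def using assms
  by (intro sum.mono_neutral_left) (auto simp: in_keys_iff)

lemma mon_degree_add: "mon_degree (u + w) = mon_degree u + mon_degree w"
proof -
  have "keys (u + w) \<subseteq> keys u \<union> keys w"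
    by (rule keys_add)
  then show ?thesis
    by (simp add: mon_degree_superset[of "keys u \<union> keys w"] lookup_add sum.distrib)
qed

lemma mon_degree_single [simp]: "mon_degree (single i a) = a"
  by (simp add: mon_degree_def)

lemma mon_degree_0 [simp]: "mon_degree 0 = 0"
  by (simp add: mon_degree_def)

lemma mon_degree_eq_0_iff [simp]: "mon_degree u = 0 \<longleftrightarrow> u = 0"
  by (auto simp: mon_degree_def in_keys_iff intro!: poly_mapping_eqI)

lemma keys_add_nat: "keys (u + w) = keys u \<union> keys w" for u w :: "nat \<Rightarrow>\<^sub>0 nat"
  by (auto simp: in_keys_iff lookup_add)

text \<open>Subtraction of exponent vectors is truncated, so \<open>a + (u - a) = u\<close> is how
  divisibility of u by a is expressed.\<close>

lemma lookup_single_mult: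
  "lookup (single a c * p) u = (if a + (u - a) = u then c * lookup p (u - a) else 0)"
  for a u :: "nat \<Rightarrow>\<^sub>0 nat" and p :: "'k::field mpoly"
proof -
  have *: "u = a + q \<longleftrightarrow> q = u - a \<and> a + (u - a) = u" for q
    by auto
  have "lookup (single a c * p) u = (\<Sum>l. (c * (\<Sum>q. lookup p q when u = l + q)) when l = a)"
    unfolding lookup_mult by (rule Sum_any.cong) (auto simp: lookup_single when_def)
  also have "\<dots> = c * (\<Sum>q. lookup p q when u = a + q)"
    by simp
  also have "(\<Sum>q. lookup p q when u = a + q) = (\<Sum>q. (lookup p q when a + (u - a) = u) when q = u - a)"
    by (rule Sum_any.cong) (auto simp: when_def *)
  finally show ?thesis
    by simp
qed

lemma single_add_diff_iff: "single j 1 + (u - single j 1) = u \<longleftrightarrow> j \<in> keys u"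
  for u :: "nat \<Rightarrow>\<^sub>0 nat"
proof
  assume "single j 1 + (u - single j 1) = u"
  then have "keys u = keys (single j (1::nat)) \<union> keys (u - single j 1)"
    by (metis keys_add_nat)
  then show "j \<in> keys u" by simp
next
  assume "j \<in> keys u"
  then show "single j 1 + (u - single j 1) = u"
    by (intro poly_mapping_eqI) (auto simp: in_keys_iff lookup_add lookup_minus lookup_single when_def)
qed

lemma lookup_var_mult:
  "lookup (var j * p) u = (if j \<in> keys u then lookup p (u - single j 1) else 0)"
  unfolding var_def lookup_single_mult single_add_diff_iff by simp

lemma poly_mapping_sum_singles: "p = (\<Sum>u\<in>keys p. single u (lookup p u))"
proof (rule poly_mapping_eqI)
  fix k
  have "lookup (\<Sum>u\<in>keys p. single u (lookup p u)) k = (\<Sum>u\<in>keys p. if u = k then lookup p k else 0)"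
    by (auto simp: lookup_sum lookup_single when_def intro!: sum.cong)
  then show "lookup p k = lookup (\<Sum>u\<in>keys p. single u (lookup p u)) k"
    by (simp add: in_keys_iff)
qed

lemma keys_sum_subset: "keys (sum f A) \<subseteq> (\<Union>a\<in>A. keys (f a))"
proof
  fix x assume "x \<in> keys (sum f A)"
  then have "(\<Sum>a\<in>A. lookup (f a) x) \<noteq> 0"
    by (simp add: in_keys_iff lookup_sum)
  then obtain a where "a \<in> A" "lookup (f a) x \<noteq> 0"
    by (rule sum.not_neutral_contains_not_neutral)
  then show "x \<in> (\<Union>a\<in>A. keys (f a))"
    by (auto simp: in_keys_iff)
qed

lemma polys_0 [simp]: "0 \<in> polys n"
  by (simp add: polys_def)

lemma polys_add: "p \<in> polys n \<Longrightarrow> q \<in> polys n \<Longrightarrow> p + q \<in> polys n"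
  unfolding polys_def using keys_add[of p q] by blast

lemma polys_uminus: "p \<in> polys n \<Longrightarrow> - p \<in> polys n"
  unfolding polys_def by (simp add: in_keys_iff)

lemma polys_diff: "p \<in> polys n \<Longrightarrow> q \<in> polys n \<Longrightarrow> p - q \<in> polys n"
  using polys_add[of p n "- q"] polys_uminus[of q n] by simp

lemma polys_mult: "p \<in> polys n \<Longrightarrow> q \<in> polys n \<Longrightarrow> p * q \<in> polys n"
  unfolding polys_def using keys_mult[of p q] by (fastforce simp: keys_add_nat)

lemma polys_sum: "(\<And>i. i \<in> A \<Longrightarrow> f i \<in> polys n) \<Longrightarrow> sum f A \<in> polys n"
  by (induction A rule: infinite_finite_induct) (auto intro: polys_add)

lemma polys_single: "keys u \<subseteq> {1..n} \<Longrightarrow> single u c \<in> polys n"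
  by (simp add: polys_def)

lemma polys_var: "j \<in> {1..n} \<Longrightarrow> var j \<in> polys n"
  unfolding var_def by (rule polys_single) auto

lemma polys_ksign: "ksign j \<tau> \<in> polys n"
proof -
  have "(- 1) ^ k \<in> polys n" for k
    by (induction k) (auto intro: polys_mult polys_uminus simp: polys_def)
  then show ?thesis
    by (simp add: ksign_def)
qed

section \<open>Homogeneous polynomials and homogeneous components\<close>

lemma homogeneous_0 [simp]: "homogeneous e 0"
  by (simp add: homogeneous_def)

lemma homogeneous_add: "homogeneous e p \<Longrightarrow> homogeneous e q \<Longrightarrow> homogeneous e (p + q)"
  unfolding homogeneous_def using keys_add[of p q] by blast

lemma homogeneous_uminus: "homogeneous e p \<Longrightarrow> homogeneous e (- p)"
  unfolding homogeneous_def by (simp add: in_keys_iff)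

lemma homogeneous_diff: "homogeneous e p \<Longrightarrow> homogeneous e q \<Longrightarrow> homogeneous e (p - q)"
  using homogeneous_add[of e p "- q"] homogeneous_uminus[of e q] by simp

lemma homogeneous_sum: "(\<And>i. i \<in> A \<Longrightarrow> homogeneous e (f i)) \<Longrightarrow> homogeneous e (sum f A)"
  by (induction A rule: infinite_finite_induct) (auto intro: homogeneous_add)

lemma homogeneous_mult:
  assumes "homogeneous e p" "homogeneous f q"
  shows "homogeneous (e + f) (p * q)"
  unfolding homogeneous_def
proof
  fix m assume "m \<in> keys (p * q)"
  then obtain a b where "m = a + b" "a \<in> keys p" "b \<in> keys q"
    using keys_mult[of p q] by blast
  with assms show "int (mon_degree m) = e + f"
    by (simp add: homogeneous_def mon_degree_add)
qed

lemma homogeneous_mult':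
  "homogeneous e p \<Longrightarrow> homogeneous f q \<Longrightarrow> g = e + f \<Longrightarrow> homogeneous g (p * q)"
  by (simp add: homogeneous_mult)

lemma homogeneous_single: "int (mon_degree u) = e \<Longrightarrow> homogeneous e (single u c)"
  by (simp add: homogeneous_def)

lemma homogeneous_var: "homogeneous 1 (var j)"
  unfolding var_def by (rule homogeneous_single) simp

lemma homogeneous_ksign: "homogeneous 0 (ksign j \<tau>)"
proof -
  have "homogeneous 0 ((- 1) ^ k :: 'a mpoly)" for k
    by (induction k) (auto intro: homogeneous_uminus simp: homogeneous_def)
  then show ?thesis
    by (simp add: ksign_def)
qed

text \<open>The degree is an integer because it will have the form \<open>e - t i\<close> with a
  twist \<open>t i\<close>; in negative degrees the component is 0.\<close>

definition hcomp :: "int \<Rightarrow> 'k::field mpoly \<Rightarrow> 'k mpoly"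
  where "hcomp e p = (\<Sum>u | u \<in> keys p \<and> int (mon_degree u) = e. single u (lookup p u))"

lemma lookup_hcomp: "lookup (hcomp e p) u = (if int (mon_degree u) = e then lookup p u else 0)"
proof -
  have "lookup (hcomp e p) u =
      (\<Sum>w | w \<in> keys p \<and> int (mon_degree w) = e. if w = u then lookup p u else 0)"
    by (auto simp: hcomp_def lookup_sum lookup_single when_def intro!: sum.cong)
  then show ?thesis
    by (auto simp: in_keys_iff)
qed

lemma keys_hcomp: "keys (hcomp e p) = {u \<in> keys p. int (mon_degree u) = e}"
  by (auto simp: in_keys_iff lookup_hcomp split: if_splits)

lemma homogeneous_hcomp [simp]: "homogeneous e (hcomp e p)"
  by (simp add: homogeneous_def keys_hcomp)

lemma hcomp_polys: "p \<in> polys n \<Longrightarrow> hcomp e p \<in> polys n"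
  by (simp add: polys_def keys_hcomp)

lemma hcomp_homogeneous: "homogeneous e p \<Longrightarrow> hcomp e p = p"
  by (rule poly_mapping_eqI) (auto simp: lookup_hcomp homogeneous_def in_keys_iff)

lemma hcomp_add: "hcomp e (p + q) = hcomp e p + hcomp e q"
  by (rule poly_mapping_eqI) (simp add: lookup_hcomp lookup_add)

lemma hcomp_0 [simp]: "hcomp e 0 = 0"
  by (rule poly_mapping_eqI) (simp add: lookup_hcomp)

lemma hcomp_sum: "hcomp e (sum f A) = (\<Sum>i\<in>A. hcomp e (f i))"
  by (induction A rule: infinite_finite_induct) (auto simp: hcomp_add)

text \<open>What remains of p after removing its component of degree \<open>e - d\<close> cannot
  reach degree e when multiplied by a form of degree d.\<close>

lemma hcomp_mult_homogeneous:
  assumes "homogeneous d q"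
  shows "hcomp e (p * q) = hcomp (e - d) p * q"
proof -
  define r where "r = p - hcomp (e - d) p"
  have "hcomp e (hcomp (e - d) p * q) = hcomp (e - d) p * q"
    by (rule hcomp_homogeneous, rule homogeneous_mult'[OF homogeneous_hcomp assms]) simp
  moreover have "hcomp e (r * q) = 0"
  proof -
    have "int (mon_degree u) \<noteq> e" if "u \<in> keys (r * q)" for u
    proof -
      from that obtain a b where ab: "u = a + b" "a \<in> keys r" "b \<in> keys q"
        using keys_mult[of r q] by blast
      then have "int (mon_degree a) \<noteq> e - d"
        by (auto simp: r_def in_keys_iff lookup_minus lookup_hcomp split: if_splits)
      with ab assms show ?thesis
        by (auto simp: homogeneous_def mon_degree_add)
    qed
    then have "keys (hcomp e (r * q)) = {}"
      by (auto simp: keys_hcomp)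
    then show ?thesis
      by (simp add: keys_eq_empty)
  qed
  moreover have "p * q = hcomp (e - d) p * q + r * q"
    by (simp add: r_def algebra_simps)
  ultimately show ?thesis
    by (simp add: hcomp_add)
qed

text \<open>A monomial ideal is spanned by its monomials. For the converse, each monomial of p is
  assigned one generator dividing it; as \<open>ideal_gen\<close> takes one coefficient per
  generator, the cofactors sharing a generator are collected into \<open>c b\<close>.\<close>

lemma ideal_gen_monomials:
  fixes p :: "'k::field mpoly"
  assumes "\<And>u. u \<in> U \<Longrightarrow> keys u \<subseteq> {1..n}"
  shows "p \<in> ideal_gen n ((\<lambda>u. single u 1) ` U) \<longleftrightarrow>
    p \<in> polys n \<and> (\<forall>w\<in>keys p. \<exists>u\<in>U. \<exists>w'. w = u + w')"
proof
  assume "p \<in> ideal_gen n ((\<lambda>u. single u 1) ` U)"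
  then obtain A c where p: "p = (\<Sum>b\<in>A. c b * b)" "finite A" "A \<subseteq> (\<lambda>u. single u 1) ` U"
    "\<forall>b\<in>A. c b \<in> polys n"
    by (auto simp: ideal_gen_def)
  have "p \<in> polys n"
  proof -
    have "b \<in> polys n" if "b \<in> A" for b
      using that p(3) assms polys_single[of _ n 1] by blast
    then show ?thesis
      unfolding p(1) using p(4) by (intro polys_sum polys_mult) auto
  qed
  moreover have "\<exists>u\<in>U. \<exists>w'. w = u + w'" if "w \<in> keys p" for w
  proof -
    from that obtain b where b: "b \<in> A" "w \<in> keys (c b * b)"
      using keys_sum_subset[of "\<lambda>b. c b * b" A] unfolding p(1) by blast
    then obtain u where u: "u \<in> U" "b = single u 1"
      using p(3) by blast
    with b obtain a where "w = a + u"
      using keys_mult[of "c b" b] by auto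
    with u show ?thesis
      by (metis add.commute)
  qed
  ultimately show "p \<in> polys n \<and> (\<forall>w\<in>keys p. \<exists>u\<in>U. \<exists>w'. w = u + w')"
    by blast
next
  assume p: "p \<in> polys n \<and> (\<forall>w\<in>keys p. \<exists>u\<in>U. \<exists>w'. w = u + w')"
  then obtain f where f: "\<And>w. w \<in> keys p \<Longrightarrow> f w \<in> U \<and> (\<exists>w'. w = f w + w')"
    by metis
  then obtain g where g: "\<And>w. w \<in> keys p \<Longrightarrow> w = f w + g w"
    by metis
  define s where "s w = (single (f w) 1 :: 'k mpoly)" for w
  define c where "c b = (\<Sum>w | w \<in> keys p \<and> s w = b. single (g w) (lookup p w))" for b
  have "p = (\<Sum>w\<in>keys p. single w (lookup p w))"
    by (rule poly_mapping_sum_singles)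
  also have "\<dots> = (\<Sum>w\<in>keys p. single (g w) (lookup p w) * s w)"
    using g by (intro sum.cong) (auto simp: s_def mult_single add.commute)
  also have "\<dots> = (\<Sum>b\<in>s ` keys p. \<Sum>w | w \<in> keys p \<and> s w = b. single (g w) (lookup p w) * s w)"
    by (rule sum.image_gen) simp
  also have "\<dots> = (\<Sum>b\<in>s ` keys p. c b * b)"
    by (intro sum.cong) (auto simp: c_def sum_distrib_right)
  finally have *: "p = (\<Sum>b\<in>s ` keys p. c b * b)" .
  have "keys (g w) \<subseteq> {1..n}" if "w \<in> keys p" for w
  proof -
    have "keys w \<subseteq> {1..n}"
      using p that by (auto simp: polys_def)
    then show ?thesis
      using keys_add_nat[of "f w" "g w"] g[OF that] by auto
  qed
  then have "c b \<in> polys n" for b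
    unfolding c_def by (intro polys_sum polys_single) auto
  with * f show "p \<in> ideal_gen n ((\<lambda>u. single u 1) ` U)"
    unfolding ideal_gen_def by (auto simp: s_def intro!: exI[of _ "s ` keys p"] exI[of _ c])
qed

text \<open>Turns minimality into the vanishing of constant terms, the form in which it is used
  later.\<close>

lemma irrelevant_ideal_iff: "p \<in> irrelevant_ideal n \<longleftrightarrow> p \<in> polys n \<and> lookup p 0 = 0"
  for p :: "'k::field mpoly"
proof -
  define U where "U = (\<lambda>i. single i (1::nat)) ` {1..n}"
  have "var ` {1..n} = (\<lambda>u. single u (1::'k)) ` U"
    by (auto simp: var_def U_def image_image)
  moreover have U: "keys u \<subseteq> {1..n}" if "u \<in> U" for u
    using that by (auto simp: U_def)
  ultimately have "p \<in> irrelevant_ideal n \<longleftrightarrow> p \<in> polys n \<and> (\<forall>w\<in>keys p. \<exists>u\<in>U. \<exists>w'. w = u + w')"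
    unfolding irrelevant_ideal_def using ideal_gen_monomials[of U n p] by (simp only: )
  moreover have *: "(\<exists>u\<in>U. \<exists>w'. w = u + w') \<longleftrightarrow> w \<noteq> 0" if "keys w \<subseteq> {1..n}" for w
  proof
    assume "w \<noteq> 0"
    then obtain j where j: "j \<in> keys w"
      by (metis ex_in_conv keys_eq_empty)
    then have "w = single j 1 + (w - single j 1)"
      by (metis single_add_diff_iff)
    with j that show "\<exists>u\<in>U. \<exists>w'. w = u + w'"
      by (auto simp: U_def)
  next
    assume "\<exists>u\<in>U. \<exists>w'. w = u + w'"
    then show "w \<noteq> 0"
      by (auto simp: U_def keys_add_nat simp flip: keys_eq_empty)
  qed
  moreover have "(\<forall>w\<in>keys p. \<exists>u\<in>U. \<exists>w'. w = u + w') \<longleftrightarrow> (\<forall>w\<in>keys p. w \<noteq> 0)" if "p \<in> polys n"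
    using that * by (intro ball_cong refl) (simp add: polys_def)
  moreover have "lookup p 0 = 0 \<longleftrightarrow> (\<forall>w\<in>keys p. w \<noteq> 0)"
    by (metis in_keys_iff)
  ultimately show ?thesis
    by argo
qed

text \<open>The multidegree of the basis element e_\<sigma>, that is, the exponent vector of the
  squarefree monomial with support \<sigma>.\<close>

definition ind :: "nat set \<Rightarrow> nat \<Rightarrow>\<^sub>0 nat"
  where "ind \<sigma> = (\<Sum>i\<in>\<sigma>. single i 1)"

lemma lookup_ind: "finite \<sigma> \<Longrightarrow> lookup (ind \<sigma>) i = (if i \<in> \<sigma> then 1 else 0)"
  by (simp add: ind_def lookup_sum lookup_single when_def)

lemma keys_ind [simp]: "finite \<sigma> \<Longrightarrow> keys (ind \<sigma>) = \<sigma>"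
  by (auto simp: in_keys_iff lookup_ind split: if_splits)

lemma mon_degree_ind [simp]: "finite \<sigma> \<Longrightarrow> mon_degree (ind \<sigma>) = card \<sigma>"
  by (simp add: mon_degree_def lookup_ind)

lemma ind_insert: "finite \<sigma> \<Longrightarrow> j \<notin> \<sigma> \<Longrightarrow> ind (insert j \<sigma>) = single j 1 + ind \<sigma>"
  by (simp add: ind_def)

lemma ind_empty [simp]: "ind {} = 0"
  by (simp add: ind_def)

lemma diff_ind_add: "finite \<sigma> \<Longrightarrow> \<sigma> \<subseteq> keys m \<Longrightarrow> m - ind \<sigma> + ind \<sigma> = m"
  by (intro poly_mapping_eqI) (auto simp: lookup_add lookup_minus lookup_ind in_keys_iff Suc_le_eq)

section \<open>Exactness of the Koszul complex in positive degrees\<close>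

lemma lookup_ksign_mult: "lookup (ksign j \<tau> * p) u = ksign j \<tau> * lookup p u"
  by (cases "even (card {l \<in> \<tau>. l < j})") (simp_all add: ksign_def)

lemma lookup_kbd_var:
  fixes c :: "nat set \<Rightarrow> 'k::field mpoly"
  shows "lookup (kbd {1..n} var c \<tau>) u =
    (\<Sum>j\<in>({1..n} - \<tau>) \<inter> keys u. ksign j \<tau> * lookup (c (insert j \<tau>)) (u - single j 1))"
proof -
  have "lookup (kbd {1..n} var c \<tau>) u =
      (\<Sum>j\<in>{1..n} - \<tau>. if j \<in> keys u then ksign j \<tau> * lookup (c (insert j \<tau>)) (u - single j 1) else 0)"
    by (auto simp: kbd_def lookup_sum mult.assoc lookup_ksign_mult lookup_var_mult intro!: sum.cong)
  then show ?thesis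
    by (simp add: sum.inter_restrict del: One_nat_def)
qed

lemma kbd_cong:
  "(\<And>j. j \<in> V - \<tau> \<Longrightarrow> c (insert j \<tau>) = e (insert j \<tau>)) \<Longrightarrow> kbd V x c \<tau> = kbd V x e \<tau>"
  by (auto simp: kbd_def intro!: sum.cong)

text \<open>In multidegree \<open>m\<close>, the Koszul complex of \<open>k[x\<^sub>1,\<dots>,x\<^sub>n]\<close> is the chain complex of the full simplex
  on the support of \<open>m\<close>, the face \<open>\<sigma>\<close> carrying the monomial \<open>m - ind \<sigma>\<close>.\<close>

lemma kbd_multidegree:
  fixes c :: "nat set \<Rightarrow> 'k::field mpoly"
  assumes m: "keys m \<subseteq> {1..n}" and \<tau>: "\<tau> \<subseteq> keys m"
  shows "kbd (keys m) (\<lambda>_. 1) (\<lambda>\<sigma>. lookup (c \<sigma>) (m - ind \<sigma>)) \<tau> =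
    lookup (kbd {1..n} var c \<tau>) (m - ind \<tau>)"
proof -
  have fin: "finite \<tau>"
    using \<tau> by (rule finite_subset) simp
  have "lookup (m - ind \<tau>) i = (if i \<in> \<tau> then lookup m i - 1 else lookup m i)" for i
    using fin by (simp add: lookup_minus lookup_ind)
  then have "({1..n} - \<tau>) \<inter> keys (m - ind \<tau>) = keys m - \<tau>"
    using m by (auto simp: in_keys_iff split: if_splits)
  moreover have "m - ind \<tau> - single j 1 = m - ind (insert j \<tau>)" if "j \<in> keys m - \<tau>" for j
    using that fin by (simp add: ind_insert diff_diff_add add.commute)
  ultimately show ?thesis
    unfolding lookup_kbd_var by (simp add: kbd_def)
qed

text \<open>Koszul chains of homological degree i and internal degree b: e_\<sigma> itself has
  degree \<open>card \<sigma> = i\<close>, which leaves \<open>b - i\<close> for its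
  coefficient.\<close>

definition scalar_chain :: "nat \<Rightarrow> nat \<Rightarrow> int \<Rightarrow> (nat set \<Rightarrow> 'k::field mpoly) \<Rightarrow> bool"
  where "scalar_chain n i b c \<longleftrightarrow>
    (\<forall>\<sigma>. c \<sigma> \<in> polys n \<and> homogeneous (b - int i) (c \<sigma>) \<and>
      (c \<sigma> \<noteq> 0 \<longrightarrow> \<sigma> \<subseteq> {1..n} \<and> card \<sigma> = i))"

text \<open>The differential preserves multidegrees, so a cycle may be filled in each multidegree
  separately. The predicates \<open>U\<close> and \<open>U'\<close> restrict the monomials of the
  cycle and of the filling; taking membership in a monomial ideal for both gives the statement for
  that ideal.\<close>

lemma fill_by_multidegrees:
  fixes c :: "nat set \<Rightarrow> 'k::field mpoly"
  assumes c: "scalar_chain n i b c" "\<And>\<sigma> u. u \<in> keys (c \<sigma>) \<Longrightarrow> U u"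
    and cyc: "\<And>\<tau>. kbd {1..n} var c \<tau> = 0"
    and fill: "\<And>m \<phi> :: nat set \<Rightarrow> 'k. \<lbrakk>keys m \<subseteq> {1..n}; int (mon_degree m) = b;
        \<And>\<sigma>. \<phi> \<sigma> \<noteq> 0 \<Longrightarrow> \<sigma> \<subseteq> keys m \<and> card \<sigma> = i \<and> U (m - ind \<sigma>);
        \<And>\<tau>. \<tau> \<subseteq> keys m \<Longrightarrow> kbd (keys m) (\<lambda>_. 1) \<phi> \<tau> = 0\<rbrakk> \<Longrightarrow>
      \<exists>\<psi>. (\<forall>\<sigma>. \<psi> \<sigma> \<noteq> 0 \<longrightarrow> \<sigma> \<subseteq> keys m \<and> card \<sigma> = Suc i \<and> U' (m - ind \<sigma>)) \<and>
        (\<forall>\<tau>. \<tau> \<subseteq> keys m \<longrightarrow> kbd (keys m) (\<lambda>_. 1) \<psi> \<tau> = \<phi> \<tau>)"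
  obtains e where "scalar_chain n (Suc i) b e" "\<And>\<sigma> u. u \<in> keys (e \<sigma>) \<Longrightarrow> U' u"
    "\<And>\<tau>. kbd {1..n} var e \<tau> = c \<tau>"
proof -
  \<comment> \<open>Off the faces of m the truncated difference \<open>m - ind \<sigma>\<close>
    would pick up unrelated monomials, hence the cutoff.\<close>
  define \<phi> where "\<phi> m \<sigma> = (if \<sigma> \<subseteq> keys m then lookup (c \<sigma>) (m - ind \<sigma>) else 0)" for m \<sigma>
  \<comment> \<open>The multidegrees occurring in c. There are finitely many, so the fillings can be
    added up.\<close>
  define MM where "MM = (\<lambda>(\<sigma>, u). u + ind \<sigma>) ` (SIGMA \<sigma>:Pow {1..n}. keys (c \<sigma>))"
  have finMM: "finite MM"
    unfolding MM_def by (intro finite_imageI finite_SigmaI) auto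
  have sub: "\<sigma> \<subseteq> {1..n}" "card \<sigma> = i" "finite \<sigma>" "keys u \<subseteq> {1..n}"
      "int (mon_degree u) = b - int i" if "u \<in> keys (c \<sigma>)" for \<sigma> u
  proof -
    have "c \<sigma> \<noteq> 0"
      using that by auto
    with that c(1) show "\<sigma> \<subseteq> {1..n}" "card \<sigma> = i" "keys u \<subseteq> {1..n}" "int (mon_degree u) = b - int i"
      by (auto simp: scalar_chain_def polys_def homogeneous_def)
    then show "finite \<sigma>"
      using finite_subset[of \<sigma> "{1..n}"] by simp
  qed
  have MM: "keys m \<subseteq> {1..n}" "int (mon_degree m) = b" if "m \<in> MM" for m
  proof -
    from that obtain \<sigma> u where "m = u + ind \<sigma>" "u \<in> keys (c \<sigma>)"
      by (auto simp: MM_def)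
    with sub[of u \<sigma>] show "keys m \<subseteq> {1..n}" "int (mon_degree m) = b"
      by (simp_all add: keys_add_nat mon_degree_add)
  qed
  have "\<exists>\<psi>. (\<forall>\<sigma>. \<psi> \<sigma> \<noteq> 0 \<longrightarrow> \<sigma> \<subseteq> keys m \<and> card \<sigma> = Suc i \<and> U' (m - ind \<sigma>)) \<and>
        (\<forall>\<tau>. \<tau> \<subseteq> keys m \<longrightarrow> kbd (keys m) (\<lambda>_. 1) \<psi> \<tau> = \<phi> m \<tau>)" if m: "m \<in> MM" for m
  proof (rule fill[OF MM[OF m]])
    show "\<sigma> \<subseteq> keys m \<and> card \<sigma> = i \<and> U (m - ind \<sigma>)" if "\<phi> m \<sigma> \<noteq> 0" for \<sigma>
    proof -
      from that have *: "\<sigma> \<subseteq> keys m" "m - ind \<sigma> \<in> keys (c \<sigma>)"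
        by (auto simp: \<phi>_def in_keys_iff split: if_splits)
      then show ?thesis
        using sub(2)[OF *(2)] c(2)[OF *(2)] by simp
    qed
    show "kbd (keys m) (\<lambda>_. 1) (\<phi> m) \<tau> = 0" if "\<tau> \<subseteq> keys m" for \<tau>
    proof -
      have "kbd (keys m) (\<lambda>_. 1) (\<phi> m) \<tau> = kbd (keys m) (\<lambda>_. 1) (\<lambda>\<sigma>. lookup (c \<sigma>) (m - ind \<sigma>)) \<tau>"
        using that by (intro kbd_cong) (auto simp: \<phi>_def)
      then show ?thesis
        using kbd_multidegree[OF MM(1)[OF m] that, of c] cyc by simp
    qed
  qed
  then obtain \<psi> where \<psi>: "\<And>m \<sigma>. m \<in> MM \<Longrightarrow> \<psi> m \<sigma> \<noteq> 0 \<Longrightarrow> \<sigma> \<subseteq> keys m \<and> card \<sigma> = Suc i \<and> U' (m - ind \<sigma>)"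
      "\<And>m \<tau>. m \<in> MM \<Longrightarrow> \<tau> \<subseteq> keys m \<Longrightarrow> kbd (keys m) (\<lambda>_. 1) (\<psi> m) \<tau> = \<phi> m \<tau>"
    by metis
  \<comment> \<open>The scalar at \<sigma> becomes the coefficient of the monomial that completes
    e_\<sigma> to multidegree m.\<close>
  define e where "e \<sigma> = (\<Sum>m\<in>MM. single (m - ind \<sigma>) (\<psi> m \<sigma>))" for \<sigma>
  have lookup_e: "lookup (e \<sigma>) u = (if u + ind \<sigma> \<in> MM then \<psi> (u + ind \<sigma>) \<sigma> else 0)" if "finite \<sigma>" for \<sigma> u
  proof -
    have "lookup (e \<sigma>) u = (\<Sum>m\<in>MM. if m = u + ind \<sigma> then \<psi> (u + ind \<sigma>) \<sigma> else 0)"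
      unfolding e_def lookup_sum
    proof (rule sum.cong[OF refl])
      fix m assume m: "m \<in> MM"
      show "lookup (single (m - ind \<sigma>) (\<psi> m \<sigma>)) u = (if m = u + ind \<sigma> then \<psi> (u + ind \<sigma>) \<sigma> else 0)"
      proof (cases "\<psi> m \<sigma> = 0")
        case False
        then have "m - ind \<sigma> + ind \<sigma> = m"
          using \<psi>(1)[OF m] that by (intro diff_ind_add) auto
        then show ?thesis
          by (auto simp: lookup_single when_def)
      qed auto
    qed
    then show ?thesis
      using finMM by simp
  qed
  have keys_e: "\<exists>m\<in>MM. u = m - ind \<sigma> \<and> \<sigma> \<subseteq> keys m \<and> card \<sigma> = Suc i \<and> U' u" if "u \<in> keys (e \<sigma>)" for u \<sigma>
  proof -
    from that obtain m where m: "m \<in> MM" "u \<in> keys (single (m - ind \<sigma>) (\<psi> m \<sigma>))"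
      using keys_sum_subset[of "\<lambda>m. single (m - ind \<sigma>) (\<psi> m \<sigma>)" MM] unfolding e_def by blast
    then have "\<psi> m \<sigma> \<noteq> 0" "u = m - ind \<sigma>"
      by (auto split: if_splits)
    with m(1) \<psi>(1)[OF m(1), of \<sigma>] show ?thesis
      by blast
  qed
  show ?thesis
  proof (rule that)
    show "scalar_chain n (Suc i) b e"
      unfolding scalar_chain_def
    proof (intro allI conjI impI)
      fix \<sigma>
      have *: "keys u \<subseteq> {1..n} \<and> int (mon_degree u) = b - int (Suc i) \<and> \<sigma> \<subseteq> {1..n} \<and> card \<sigma> = Suc i"
        if u: "u \<in> keys (e \<sigma>)" for u
      proof -
        from keys_e[OF u] obtain m where m: "m \<in> MM" "u = m - ind \<sigma>" "\<sigma> \<subseteq> keys m" "card \<sigma> = Suc i"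
          by blast
        then have fin: "finite \<sigma>"
          by (simp add: card_ge_0_finite)
        then have mu: "m = u + ind \<sigma>"
          using m by (simp add: diff_ind_add)
        have "keys m = keys u \<union> \<sigma>" "mon_degree m = mon_degree u + Suc i"
          unfolding mu using m(4) fin by (simp_all add: keys_add_nat mon_degree_add)
        with MM[OF m(1)] m(4) show ?thesis
          by auto
      qed
      then show "e \<sigma> \<in> polys n" "homogeneous (b - int (Suc i)) (e \<sigma>)"
        by (auto simp: polys_def homogeneous_def)
      assume "e \<sigma> \<noteq> 0"
      then obtain u where "u \<in> keys (e \<sigma>)"
        by (metis ex_in_conv keys_eq_empty)
      with * show "\<sigma> \<subseteq> {1..n}" "card \<sigma> = Suc i"
        by blast+
    qed
    then have e0: "e \<sigma> = 0" if "\<not> \<sigma> \<subseteq> {1..n}" for \<sigma>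
      using that by (auto simp: scalar_chain_def)
    show "U' u" if "u \<in> keys (e \<sigma>)" for \<sigma> u
      using keys_e[OF that] by blast
    show "kbd {1..n} var e \<tau> = c \<tau>" for \<tau>
    proof (cases "\<tau> \<subseteq> {1..n}")
      case False
      then have "c \<tau> = 0"
        using c(1) by (auto simp: scalar_chain_def)
      moreover have "kbd {1..n} var e \<tau> = kbd {1..n} var (\<lambda>_. 0) \<tau>"
        using False by (intro kbd_cong e0) auto
      ultimately show ?thesis
        by simp
    next
      case True
      then have fin: "finite \<tau>"
        by (rule finite_subset) simp
      show ?thesis
      proof (rule poly_mapping_eqI)
        fix u
        define m where "m = u + ind \<tau>"
        have \<tau>m: "\<tau> \<subseteq> keys m" and u: "u = m - ind \<tau>"
          using fin by (auto simp: m_def keys_add_nat)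
        show "lookup (kbd {1..n} var e \<tau>) u = lookup (c \<tau>) u"
        proof (cases "keys m \<subseteq> {1..n}")
          case m: True
          have "lookup (kbd {1..n} var e \<tau>) u = kbd (keys m) (\<lambda>_. 1) (\<lambda>\<sigma>. lookup (e \<sigma>) (m - ind \<sigma>)) \<tau>"
            using kbd_multidegree[OF m \<tau>m, of e] u by simp
          also have "\<dots> = kbd (keys m) (\<lambda>_. 1) (\<lambda>\<sigma>. if m \<in> MM then \<psi> m \<sigma> else 0) \<tau>"
          proof (rule kbd_cong)
            fix j assume "j \<in> keys m - \<tau>"
            then have "m - ind (insert j \<tau>) + ind (insert j \<tau>) = m"
              using \<tau>m fin by (intro diff_ind_add) auto
            then show "lookup (e (insert j \<tau>)) (m - ind (insert j \<tau>)) = (if m \<in> MM then \<psi> m (insert j \<tau>) else 0)"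
              using fin by (simp add: lookup_e)
          qed
          also have "\<dots> = (if m \<in> MM then \<phi> m \<tau> else 0)"
            using \<psi>(2) \<tau>m by simp
          also have "\<dots> = lookup (c \<tau>) u"
          proof (cases "u \<in> keys (c \<tau>)")
            case uc: True
            then have "m \<in> MM"
              unfolding MM_def m_def using True by force
            then show ?thesis
              using \<tau>m u by (simp add: \<phi>_def)
          qed (use \<tau>m u in \<open>auto simp: \<phi>_def in_keys_iff\<close>)
          finally show ?thesis .
        next
          \<comment> \<open>Here u contains a variable outside the ring, so both sides have
            coefficient 0 at u.\<close>
          case False
          then have "\<not> keys u \<subseteq> {1..n}"
            using True fin by (auto simp: m_def keys_add_nat)
          moreover have "kbd {1..n} var e \<tau> \<in> polys n" "c \<tau> \<in> polys n"
            using \<open>scalar_chain n (Suc i) b e\<close> c(1)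
            by (auto simp: scalar_chain_def kbd_def intro!: polys_sum polys_mult polys_ksign polys_var)
          ultimately have "u \<notin> keys (kbd {1..n} var e \<tau>)" "u \<notin> keys (c \<tau>)"
            by (auto simp: polys_def)
          then show ?thesis
            by (simp add: in_keys_iff)
        qed
      qed
    qed
  qed
qed

text \<open>In a nonzero multidegree the complex is that of a nonempty simplex and a cone fills the
  cycle. Multidegree zero holds only the constants in homological degree 0, that is H_0 = k, and
  \<open>i0\<close> excludes exactly these.\<close>

lemma scalar_koszul_exact:
  fixes c :: "nat set \<Rightarrow> 'k::field mpoly"
  assumes c: "scalar_chain n i b c" and cyc: "\<And>\<tau>. kbd {1..n} var c \<tau> = 0"
    and i0: "i = 0 \<Longrightarrow> lookup (c {}) 0 = 0"
  obtains e where "scalar_chain n (Suc i) b e" "\<And>\<tau>. kbd {1..n} var e \<tau> = c \<tau>"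
proof (rule fill_by_multidegrees[OF c _ cyc, where U = "\<lambda>u. i = 0 \<longrightarrow> u \<noteq> 0" and U' = "\<lambda>_. True"])
  show "i = 0 \<longrightarrow> u \<noteq> 0" if u: "u \<in> keys (c \<sigma>)" for \<sigma> u
  proof
    assume i: "i = 0"
    have "c \<sigma> \<noteq> 0"
      using u by auto
    then have "\<sigma> = {}"
      using i c finite_subset[of \<sigma> "{1..n}"] by (auto simp: scalar_chain_def)
    with i0 i u show "u \<noteq> 0"
      by (auto simp: in_keys_iff)
  qed
next
  fix m :: "nat \<Rightarrow>\<^sub>0 nat" and \<phi> :: "nat set \<Rightarrow> 'k"
  assume m: "\<And>\<sigma>. \<phi> \<sigma> \<noteq> 0 \<Longrightarrow> \<sigma> \<subseteq> keys m \<and> card \<sigma> = i \<and> (i = 0 \<longrightarrow> m - ind \<sigma> \<noteq> 0)"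
    and cyc: "\<And>\<tau>. \<tau> \<subseteq> keys m \<Longrightarrow> kbd (keys m) (\<lambda>_. 1) \<phi> \<tau> = 0"
  show "\<exists>\<psi>. (\<forall>\<sigma>. \<psi> \<sigma> \<noteq> 0 \<longrightarrow> \<sigma> \<subseteq> keys m \<and> card \<sigma> = Suc i \<and> True) \<and>
      (\<forall>\<tau>. \<tau> \<subseteq> keys m \<longrightarrow> kbd (keys m) (\<lambda>_. 1) \<psi> \<tau> = \<phi> \<tau>)"
  proof (cases "keys m = {}")
    case True
    have "\<phi> \<sigma> = 0" for \<sigma>
    proof (rule ccontr)
      assume "\<phi> \<sigma> \<noteq> 0"
      with m[of \<sigma>] True show False
        by auto
    qed
    then show ?thesis
      by (intro exI[of _ "\<lambda>_. 0"]) auto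
  next
    case False
    then obtain v where v: "v \<in> keys m"
      by blast
    have "\<sigma> \<subseteq> keys m \<and> card \<sigma> = Suc i" if "kcone v \<phi> \<sigma> \<noteq> 0" for \<sigma>
    proof -
      from that have "v \<in> \<sigma>" "\<phi> (\<sigma> - {v}) \<noteq> 0"
        by (auto simp: kcone_def split: if_splits)
      moreover from this m have "\<sigma> - {v} \<subseteq> keys m" "card (\<sigma> - {v}) = i"
        by blast+
      moreover from this have "finite \<sigma>"
        using finite_subset[of "\<sigma> - {v}" "keys m"] by simp
      ultimately show ?thesis
        using v card_Suc_Diff1[of \<sigma> v] by auto
    qed
    moreover have "kbd (keys m) (\<lambda>_. 1) (kcone v \<phi>) \<tau> = \<phi> \<tau>" if "\<tau> \<subseteq> keys m" for \<tau>
    proof -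
      have "kcone v (kbd (keys m) (\<lambda>_. 1) \<phi>) \<tau> = 0"
        using cyc[of "\<tau> - {v}"] that by (auto simp: kcone_def)
      then show ?thesis
        using kcone_homotopy[OF _ v, of \<phi> \<tau>] by simp
    qed
    ultimately show ?thesis
      by (intro exI[of _ "kcone v \<phi>"]) simp
  qed
qed (rule that)

section \<open>Koszul homology of submodules and dimension shifting\<close>

definition kchain ::
    "nat \<Rightarrow> nat \<Rightarrow> (nat \<Rightarrow> int) \<Rightarrow> nat \<Rightarrow> int \<Rightarrow> (nat set \<Rightarrow> nat \<Rightarrow> 'k::field mpoly) \<Rightarrow> bool"
  where "kchain n r t i b c \<longleftrightarrow>
    (\<forall>l<r. scalar_chain n i (b - t l) (\<lambda>\<sigma>. c \<sigma> l)) \<and> (\<forall>l\<ge>r. \<forall>\<sigma>. c \<sigma> l = 0)"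

definition kdiff :: "nat \<Rightarrow> (nat set \<Rightarrow> nat \<Rightarrow> 'k::field mpoly) \<Rightarrow> nat set \<Rightarrow> nat \<Rightarrow> 'k mpoly"
  where "kdiff n c \<tau> l = kbd {1..n} var (\<lambda>\<sigma>. c \<sigma> l) \<tau>"

text \<open>For a submodule \<open>M\<close> of \<open>\<Oplus>\<^sub>l R(-t l)\<close>: the degree \<open>b\<close> part of the Koszul homology \<open>H\<^sub>i(x\<^sub>1,\<dots>,x\<^sub>n; M)\<close> vanishes.\<close>

definition koszul_acyclic ::
    "nat \<Rightarrow> nat \<Rightarrow> (nat \<Rightarrow> int) \<Rightarrow> nat \<Rightarrow> int \<Rightarrow> (nat \<Rightarrow> 'k::field mpoly) set \<Rightarrow> bool"
  where "koszul_acyclic n r t i b M \<longleftrightarrow>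
    (\<forall>c. kchain n r t i b c \<and> range c \<subseteq> M \<and> kdiff n c = (\<lambda>_ _. 0) \<longrightarrow>
      (\<exists>e. kchain n r t (Suc i) b e \<and> range e \<subseteq> M \<and> kdiff n e = c))"

text \<open>Common form of the augmentation and the differentials: row \<open>g i\<close> is the
  image of the i-th basis vector. Entries from r on are 0, so that equality of vectors is equality
  of functions.\<close>

definition cmap :: "nat \<Rightarrow> nat \<Rightarrow> (nat \<Rightarrow> nat \<Rightarrow> 'k::field mpoly) \<Rightarrow> (nat \<Rightarrow> 'k mpoly) \<Rightarrow> nat \<Rightarrow> 'k mpoly"
  where "cmap r s g v = (\<lambda>l. if l < r then \<Sum>i<s. v i * g i l else 0)"

definition graded_map ::
    "nat \<Rightarrow> nat \<Rightarrow> (nat \<Rightarrow> int) \<Rightarrow> nat \<Rightarrow> (nat \<Rightarrow> int) \<Rightarrow> (nat \<Rightarrow> nat \<Rightarrow> 'k::field mpoly) \<Rightarrow> bool"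
  where "graded_map n r t s t' g \<longleftrightarrow>
    (\<forall>i<s. \<forall>l<r. g i l \<in> polys n \<and> homogeneous (t' i - t l) (g i l))"

definition cker :: "nat \<Rightarrow> nat \<Rightarrow> nat \<Rightarrow> (nat \<Rightarrow> nat \<Rightarrow> 'k::field mpoly) \<Rightarrow> (nat \<Rightarrow> 'k mpoly) set"
  where "cker n r s g = {v \<in> free_mod n s. cmap r s g v = (\<lambda>_. 0)}"

definition fhom :: "nat \<Rightarrow> (nat \<Rightarrow> int) \<Rightarrow> int \<Rightarrow> (nat \<Rightarrow> 'k::field mpoly) \<Rightarrow> bool"
  where "fhom r t e v \<longleftrightarrow> (\<forall>i<r. homogeneous (e - t i) (v i))"

section \<open>Chains with coefficients in twisted free modules, and graded maps between
  them\<close>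

lemma scalar_chain_0 [simp]: "scalar_chain n i b (\<lambda>_. 0)"
  by (simp add: scalar_chain_def)

lemma scalar_chain_kbd:
  assumes "scalar_chain n (Suc i) b c"
  shows "scalar_chain n i b (kbd {1..n} var c)"
  unfolding scalar_chain_def
proof (intro allI conjI impI)
  fix \<sigma>
  show "kbd {1..n} var c \<sigma> \<in> polys n"
    using assms unfolding kbd_def scalar_chain_def
    by (intro polys_sum polys_mult polys_ksign polys_var) auto
  have "homogeneous (b - int i) (ksign j \<sigma> * var j * c (insert j \<sigma>))" for j
  proof (rule homogeneous_mult')
    show "homogeneous 1 (ksign j \<sigma> * var j)"
      by (rule homogeneous_mult'[OF homogeneous_ksign homogeneous_var]) simp
    show "homogeneous (b - int (Suc i)) (c (insert j \<sigma>))"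
      using assms by (simp add: scalar_chain_def)
  qed simp
  then show "homogeneous (b - int i) (kbd {1..n} var c \<sigma>)"
    unfolding kbd_def by (intro homogeneous_sum)
  assume "kbd {1..n} var c \<sigma> \<noteq> 0"
  then obtain j where j: "j \<in> {1..n} - \<sigma>" "ksign j \<sigma> * var j * c (insert j \<sigma>) \<noteq> 0"
    unfolding kbd_def by (rule sum.not_neutral_contains_not_neutral)
  then have "c (insert j \<sigma>) \<noteq> 0"
    by auto
  with assms have *: "insert j \<sigma> \<subseteq> {1..n}" "card (insert j \<sigma>) = Suc i"
    unfolding scalar_chain_def by blast+
  then have "finite \<sigma>"
    using finite_subset[of \<sigma> "{1..n}"] by simp
  with * j show "\<sigma> \<subseteq> {1..n}" "card \<sigma> = i"
    by simp_all
qed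

lemma scalar_chain_diff:
  assumes "scalar_chain n i b c" "scalar_chain n i b e"
  shows "scalar_chain n i b (\<lambda>\<sigma>. c \<sigma> - e \<sigma>)"
  unfolding scalar_chain_def
proof (intro allI conjI impI)
  fix \<sigma>
  show "c \<sigma> - e \<sigma> \<in> polys n" "homogeneous (b - int i) (c \<sigma> - e \<sigma>)"
    using assms by (auto simp: scalar_chain_def intro: polys_diff homogeneous_diff)
  assume "c \<sigma> - e \<sigma> \<noteq> 0"
  then have "c \<sigma> \<noteq> 0 \<or> e \<sigma> \<noteq> 0"
    by auto
  then show "\<sigma> \<subseteq> {1..n}" "card \<sigma> = i"
    using assms unfolding scalar_chain_def by blast+
qed

lemma kchain_kdiff: "kchain n r t (Suc i) b c \<Longrightarrow> kchain n r t i b (kdiff n c)"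
  by (simp add: kchain_def kdiff_def scalar_chain_kbd del: One_nat_def)

lemma kchain_diff:
  "kchain n r t i b c \<Longrightarrow> kchain n r t i b e \<Longrightarrow> kchain n r t i b (\<lambda>\<sigma> l. c \<sigma> l - e \<sigma> l)"
  by (simp add: kchain_def scalar_chain_diff)

lemma kdiff_kdiff: "kdiff n (kdiff n c) = (\<lambda>_ _. 0)"
  by (simp add: kdiff_def kbd_kbd fun_eq_iff)

lemma kdiff_diff: "kdiff n (\<lambda>\<sigma> l. c \<sigma> l - e \<sigma> l) = (\<lambda>\<tau> l. kdiff n c \<tau> l - kdiff n e \<tau> l)"
  by (simp add: kdiff_def kbd_diff fun_eq_iff)

lemma kchain_free_mod: "kchain n r t i b c \<Longrightarrow> c \<sigma> \<in> free_mod n r"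
  by (simp add: kchain_def free_mod_def scalar_chain_def)

lemma cmap_diff: "cmap r s g (\<lambda>i. v i - w i) = (\<lambda>l. cmap r s g v l - cmap r s g w l)"
  by (auto simp: cmap_def fun_eq_iff sum_subtractf left_diff_distrib)

lemma kdiff_cmap: "kdiff n (\<lambda>\<sigma>. cmap r s g (c \<sigma>)) = (\<lambda>\<tau>. cmap r s g (kdiff n c \<tau>))"
  by (auto simp: kdiff_def cmap_def kbd_sum kbd_mult_right fun_eq_iff)

lemma cmap_0 [simp]: "cmap r s g (\<lambda>_. 0) = (\<lambda>_. 0)"
  by (simp add: cmap_def fun_eq_iff)

lemma kchain_cmap:
  assumes g: "graded_map n r t s t' g" and c: "kchain n s t' i b c"
  shows "kchain n r t i b (\<lambda>\<sigma>. cmap r s g (c \<sigma>))"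
  unfolding kchain_def
proof (intro conjI allI impI)
  fix l assume l: "l < r"
  show "scalar_chain n i (b - t l) (\<lambda>\<sigma>. cmap r s g (c \<sigma>) l)"
    unfolding scalar_chain_def
  proof (intro allI conjI impI)
    fix \<sigma>
    have cm: "cmap r s g (c \<sigma>) l = (\<Sum>k<s. c \<sigma> k * g k l)"
      using l by (simp add: cmap_def)
    show "cmap r s g (c \<sigma>) l \<in> polys n"
      unfolding cm using g c l
      by (auto simp: graded_map_def kchain_def scalar_chain_def intro!: polys_sum polys_mult)
    have "homogeneous (b - t l - int i) (c \<sigma> k * g k l)" if k: "k < s" for k
    proof (rule homogeneous_mult')
      show "homogeneous (b - t' k - int i) (c \<sigma> k)" "homogeneous (t' k - t l) (g k l)"
        using g c l k by (auto simp: graded_map_def kchain_def scalar_chain_def)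
    qed simp
    then show "homogeneous (b - t l - int i) (cmap r s g (c \<sigma>) l)"
      unfolding cm by (intro homogeneous_sum) simp
    assume "cmap r s g (c \<sigma>) l \<noteq> 0"
    then obtain k where "k \<in> {..<s}" "c \<sigma> k * g k l \<noteq> 0"
      unfolding cm by (rule sum.not_neutral_contains_not_neutral)
    then have "k < s" "c \<sigma> k \<noteq> 0"
      by auto
    with c show "\<sigma> \<subseteq> {1..n}" "card \<sigma> = i"
      unfolding kchain_def scalar_chain_def by blast+
  qed
qed (simp add: cmap_def)

lemma cmap_hcomp:
  assumes g: "graded_map n r t s t' g"
  shows "cmap r s g (\<lambda>i. hcomp (e - t' i) (v i)) = (\<lambda>l. hcomp (e - t l) (cmap r s g v l))"
proof
  fix l
  show "cmap r s g (\<lambda>i. hcomp (e - t' i) (v i)) l = hcomp (e - t l) (cmap r s g v l)"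
  proof (cases "l < r")
    case True
    then have "homogeneous (t' i - t l) (g i l)" if "i < s" for i
      using that g by (simp add: graded_map_def)
    then have "hcomp (e - t l) (v i * g i l) = hcomp (e - t' i) (v i) * g i l" if "i < s" for i
      using hcomp_mult_homogeneous[of "t' i - t l" "g i l" "e - t l" "v i"] that by simp
    with True show ?thesis
      by (simp add: cmap_def hcomp_sum)
  qed (simp add: cmap_def)
qed

text \<open>A graded map commutes with taking components, so the component of degree e of any
  preimage is again a preimage.\<close>

lemma cmap_homogeneous_preimage:
  assumes g: "graded_map n r t s t' g" and v: "v \<in> free_mod n s" and w: "fhom r t e (cmap r s g v)"
  obtains v' where "v' \<in> free_mod n s" "fhom s t' e v'" "cmap r s g v' = cmap r s g v"
proof
  show "(\<lambda>i. hcomp (e - t' i) (v i)) \<in> free_mod n s" "fhom s t' e (\<lambda>i. hcomp (e - t' i) (v i))"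
    using v by (auto simp: free_mod_def fhom_def hcomp_polys)
  have "hcomp (e - t l) (cmap r s g v l) = cmap r s g v l" for l
    using w by (cases "l < r") (simp_all add: fhom_def hcomp_homogeneous cmap_def)
  then show "cmap r s g (\<lambda>i. hcomp (e - t' i) (v i)) = cmap r s g v"
    by (simp add: cmap_hcomp[OF g])
qed

text \<open>The definition reads a chain by components of the free module; this form reads it by
  faces, which suits lifting along a map.\<close>

lemma kchain_iff:
  "kchain n r t i b c \<longleftrightarrow>
    (\<forall>\<sigma>. c \<sigma> \<in> free_mod n r \<and> fhom r t (b - int i) (c \<sigma>) \<and>
      (c \<sigma> \<noteq> (\<lambda>_. 0) \<longrightarrow> \<sigma> \<subseteq> {1..n} \<and> card \<sigma> = i))"
  (is "?L \<longleftrightarrow> ?R")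
proof
  have eq: "b - int i - t l = b - t l - int i" for l
    by simp
  {
    assume L: ?L
    show ?R
    proof (intro allI conjI impI)
      fix \<sigma>
      show "c \<sigma> \<in> free_mod n r" "fhom r t (b - int i) (c \<sigma>)"
        using L by (auto simp: kchain_def free_mod_def scalar_chain_def fhom_def eq)
      assume "c \<sigma> \<noteq> (\<lambda>_. 0)"
      then obtain l where l: "c \<sigma> l \<noteq> 0"
        by blast
      then have "l < r"
        using L unfolding kchain_def by (meson not_le)
      with L l show "\<sigma> \<subseteq> {1..n}" "card \<sigma> = i"
        by (auto simp: kchain_def scalar_chain_def)
    qed
  next
    assume R: ?R
    have supp: "\<sigma> \<subseteq> {1..n} \<and> card \<sigma> = i" if "c \<sigma> l \<noteq> 0" for \<sigma> l
    proof -
      have "c \<sigma> \<noteq> (\<lambda>_. 0)"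
        using that by auto
      with R show ?thesis
        by blast
    qed
    with R show ?L
      by (simp add: kchain_def free_mod_def scalar_chain_def fhom_def eq)
  }
qed

text \<open>Each coefficient is lifted homogeneously on its own. Zero is lifted to zero, since
  otherwise the condition on the supporting faces could fail.\<close>

lemma kchain_lift:
  assumes g: "graded_map n r t s t' g" and c: "kchain n r t i b c"
    and im: "range c \<subseteq> cmap r s g ` free_mod n s"
  obtains e where "kchain n s t' i b e" "(\<lambda>\<sigma>. cmap r s g (e \<sigma>)) = c"
proof -
  have "\<exists>v. v \<in> free_mod n s \<and> fhom s t' (b - int i) v \<and> cmap r s g v = c \<sigma> \<and>
      (c \<sigma> = (\<lambda>_. 0) \<longrightarrow> v = (\<lambda>_. 0))" for \<sigma>
  proof (cases "c \<sigma> = (\<lambda>_. 0)")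
    case True
    then show ?thesis
      by (intro exI[of _ "\<lambda>_. 0"]) (simp add: free_mod_def fhom_def)
  next
    case False
    obtain v where v: "v \<in> free_mod n s" "c \<sigma> = cmap r s g v"
      using im by blast
    have "fhom r t (b - int i) (cmap r s g v)"
      using c v(2)[symmetric] by (simp add: kchain_iff)
    with False v show ?thesis
      by (metis cmap_homogeneous_preimage[OF g v(1)])
  qed
  then obtain e where e: "\<And>\<sigma>. e \<sigma> \<in> free_mod n s \<and> fhom s t' (b - int i) (e \<sigma>) \<and>
      cmap r s g (e \<sigma>) = c \<sigma> \<and> (c \<sigma> = (\<lambda>_. 0) \<longrightarrow> e \<sigma> = (\<lambda>_. 0))"
    by metis
  show ?thesis
  proof
    show "kchain n s t' i b e"
      using e c unfolding kchain_iff by blast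
    show "(\<lambda>\<sigma>. cmap r s g (e \<sigma>)) = c"
      using e by blast
  qed
qed

lemma free_koszul_exact:
  assumes c: "kchain n r t i b c" and cyc: "kdiff n c = (\<lambda>_ _. 0)"
    and i0: "\<And>l. i = 0 \<Longrightarrow> lookup (c {} l) 0 = 0"
  obtains e where "kchain n r t (Suc i) b e" "kdiff n e = c"
proof -
  have "\<exists>e. scalar_chain n (Suc i) (b - t l) e \<and> (\<forall>\<tau>. kbd {1..n} var e \<tau> = c \<tau> l)" if l: "l < r" for l
  proof -
    have "scalar_chain n i (b - t l) (\<lambda>\<sigma>. c \<sigma> l)"
      using c l by (simp add: kchain_def)
    moreover have "kbd {1..n} var (\<lambda>\<sigma>. c \<sigma> l) \<tau> = 0" for \<tau>
      using fun_cong[OF fun_cong[OF cyc, of \<tau>], of l] by (simp add: kdiff_def)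
    ultimately show ?thesis
      using scalar_koszul_exact[of n i "b - t l" "\<lambda>\<sigma>. c \<sigma> l"] i0 by metis
  qed
  then obtain e where e: "\<And>l. l < r \<Longrightarrow> scalar_chain n (Suc i) (b - t l) (e l)"
    "\<And>l \<tau>. l < r \<Longrightarrow> kbd {1..n} var (e l) \<tau> = c \<tau> l"
    by metis
  define e' where "e' \<sigma> l = (if l < r then e l \<sigma> else 0)" for \<sigma> l
  show ?thesis
  proof
    show "kchain n r t (Suc i) b e'"
      using e(1) by (simp add: kchain_def e'_def)
    show "kdiff n e' = c"
    proof (intro ext)
      fix \<tau> l
      show "kdiff n e' \<tau> l = c \<tau> l"
        using e(2) c by (cases "l < r") (simp_all add: kdiff_def e'_def kchain_def)
    qed
  qed
qed

lemma lookup_kbd_var_0: "lookup (kbd {1..n} var c \<tau>) 0 = 0"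
  unfolding lookup_kbd_var by simp

lemma kdiff_zero_chain:
  assumes "kchain n r t 0 b c"
  shows "kdiff n c = (\<lambda>_ _. 0)"
proof (intro ext)
  fix \<tau> l
  have "c (insert j \<tau>) = (\<lambda>_. 0)" if "j \<in> {1..n}" for j
  proof (rule ccontr)
    assume "c (insert j \<tau>) \<noteq> (\<lambda>_. 0)"
    then have "insert j \<tau> \<subseteq> {1..n}" "card (insert j \<tau>) = 0"
      using assms by (auto simp: kchain_iff)
    then show False
      using finite_subset[of "insert j \<tau>" "{1..n}"] by auto
  qed
  then show "kdiff n c \<tau> l = 0"
    unfolding kdiff_def kbd_def by (intro sum.neutral) simp
qed

text \<open>The connecting isomorphism from H_(i+1) of N to H_i of K for the sequence 0 -> K -> F ->
  N -> 0 with F free, on the level of vanishing. The complex of F is exact in positive degrees; in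
  degree 0 the absence of constant terms in K makes H_0(K) -> H_0(F) zero.\<close>

lemma koszul_acyclic_image_iff_kernel:
  fixes g :: "nat \<Rightarrow> nat \<Rightarrow> 'k::field mpoly"
  assumes g: "graded_map n r t s t' g"
    and min: "\<forall>v\<in>cker n r s g. \<forall>i. lookup (v i) 0 = 0"
  shows "koszul_acyclic n r t (Suc i) b (cmap r s g ` free_mod n s) \<longleftrightarrow>
    koszul_acyclic n s t' i b (cker n r s g)"
proof
  assume N: "koszul_acyclic n r t (Suc i) b (cmap r s g ` free_mod n s)"
  show "koszul_acyclic n s t' i b (cker n r s g)"
    unfolding koszul_acyclic_def
  proof (intro allI impI, elim conjE)
    fix c :: "nat set \<Rightarrow> nat \<Rightarrow> 'k mpoly"
    assume c: "kchain n s t' i b c" "range c \<subseteq> cker n r s g" "kdiff n c = (\<lambda>_ _. 0)"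
    \<comment> \<open>The cycle bounds in the free module; for i = 0 this uses the absence of
      constant terms.\<close>
    obtain e where e: "kchain n s t' (Suc i) b e" "kdiff n e = c"
      using free_koszul_exact[OF c(1,3)] min c(2) by blast
    define ge where "ge = (\<lambda>\<sigma>. cmap r s g (e \<sigma>))"
    have "kchain n r t (Suc i) b ge"
      unfolding ge_def by (rule kchain_cmap[OF g e(1)])
    moreover have "range ge \<subseteq> cmap r s g ` free_mod n s"
      using kchain_free_mod[OF e(1)] by (auto simp: ge_def)
    moreover have "kdiff n ge = (\<lambda>_ _. 0)"
      unfolding ge_def kdiff_cmap e(2) using c(2) by (auto simp: cker_def fun_eq_iff)
    ultimately obtain f' where f': "kchain n r t (Suc (Suc i)) b f'"
        "range f' \<subseteq> cmap r s g ` free_mod n s" "kdiff n f' = ge"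
      using N unfolding koszul_acyclic_def by blast
    obtain f where f: "kchain n s t' (Suc (Suc i)) b f" "(\<lambda>\<sigma>. cmap r s g (f \<sigma>)) = f'"
      using kchain_lift[OF g f'(1,2)] by blast
    \<comment> \<open>Subtracting the boundary of the lift moves e into the kernel and leaves its
      boundary unchanged.\<close>
    define h where "h = (\<lambda>\<sigma> l. e \<sigma> l - kdiff n f \<sigma> l)"
    have h: "kchain n s t' (Suc i) b h"
      unfolding h_def by (intro kchain_diff e kchain_kdiff f)
    moreover have "h \<sigma> \<in> cker n r s g" for \<sigma>
    proof -
      have "cmap r s g (kdiff n f \<sigma>) = ge \<sigma>"
        using fun_cong[OF kdiff_cmap[of n r s g f], of \<sigma>] f(2) f'(3) by simp
      then have "cmap r s g (h \<sigma>) = (\<lambda>_. 0)"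
        unfolding h_def cmap_diff by (simp add: ge_def)
      with kchain_free_mod[OF h] show ?thesis
        by (simp add: cker_def)
    qed
    moreover have "kdiff n h = c"
      unfolding h_def kdiff_diff by (simp add: kdiff_kdiff e(2))
    ultimately show "\<exists>e. kchain n s t' (Suc i) b e \<and> range e \<subseteq> cker n r s g \<and> kdiff n e = c"
      by blast
  qed
next
  assume K: "koszul_acyclic n s t' i b (cker n r s g)"
  show "koszul_acyclic n r t (Suc i) b (cmap r s g ` free_mod n s)"
    unfolding koszul_acyclic_def
  proof (intro allI impI, elim conjE)
    fix c :: "nat set \<Rightarrow> nat \<Rightarrow> 'k mpoly"
    assume c: "kchain n r t (Suc i) b c" "range c \<subseteq> cmap r s g ` free_mod n s" "kdiff n c = (\<lambda>_ _. 0)"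
    obtain e where e: "kchain n s t' (Suc i) b e" "(\<lambda>\<sigma>. cmap r s g (e \<sigma>)) = c"
      using kchain_lift[OF g c(1,2)] by blast
    have de: "kchain n s t' i b (kdiff n e)"
      by (rule kchain_kdiff[OF e(1)])
    moreover have "kdiff n e \<sigma> \<in> cker n r s g" for \<sigma>
      using fun_cong[OF kdiff_cmap[of n r s g e], of \<sigma>] e(2) c(3) kchain_free_mod[OF de]
      by (simp add: cker_def)
    ultimately obtain f where f: "kchain n s t' (Suc i) b f" "range f \<subseteq> cker n r s g" "kdiff n f = kdiff n e"
      using K kdiff_kdiff[of n e] unfolding koszul_acyclic_def by blast
    have "kchain n s t' (Suc i) b (\<lambda>\<sigma> l. e \<sigma> l - f \<sigma> l)"
      by (intro kchain_diff e f)
    moreover have "kdiff n (\<lambda>\<sigma> l. e \<sigma> l - f \<sigma> l) = (\<lambda>_ _. 0)"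
      by (simp add: kdiff_diff f(3))
    \<comment> \<open>The cycle has positive homological degree, so no condition on constant terms
      arises.\<close>
    ultimately obtain h where h: "kchain n s t' (Suc (Suc i)) b h" "kdiff n h = (\<lambda>\<sigma> l. e \<sigma> l - f \<sigma> l)"
      by (rule free_koszul_exact) auto
    show "\<exists>e. kchain n r t (Suc (Suc i)) b e \<and> range e \<subseteq> cmap r s g ` free_mod n s \<and> kdiff n e = c"
    proof (intro exI[of _ "\<lambda>\<sigma>. cmap r s g (h \<sigma>)"] conjI)
      show "kchain n r t (Suc (Suc i)) b (\<lambda>\<sigma>. cmap r s g (h \<sigma>))"
        by (rule kchain_cmap[OF g h(1)])
      show "range (\<lambda>\<sigma>. cmap r s g (h \<sigma>)) \<subseteq> cmap r s g ` free_mod n s"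
        using kchain_free_mod[OF h(1)] by auto
      have "cmap r s g (f \<sigma>) = (\<lambda>_. 0)" for \<sigma>
        using f(2) by (auto simp: cker_def)
      then show "kdiff n (\<lambda>\<sigma>. cmap r s g (h \<sigma>)) = c"
        unfolding kdiff_cmap h(2) cmap_diff using e(2) by (auto simp: fun_eq_iff)
    qed
  qed
qed

text \<open>H_0(N) is N modulo the irrelevant ideal times N. As the kernel has no constant terms,
  this agrees with the same quotient of F, which has one basis element in degree \<open>t' l\<close>
  for each l.\<close>

lemma koszul_acyclic_0_image_iff:
  fixes g :: "nat \<Rightarrow> nat \<Rightarrow> 'k::field mpoly"
  assumes g: "graded_map n r t s t' g"
    and min: "\<forall>v\<in>cker n r s g. \<forall>i. lookup (v i) 0 = 0"
  shows "koszul_acyclic n r t 0 b (cmap r s g ` free_mod n s) \<longleftrightarrow> (\<forall>l<s. t' l \<noteq> b)"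
proof
  assume N: "koszul_acyclic n r t 0 b (cmap r s g ` free_mod n s)"
  show "\<forall>l<s. t' l \<noteq> b"
  proof (intro allI impI notI)
    fix l assume l: "l < s" "t' l = b"
    \<comment> \<open>The l-th basis vector as a 0-chain. If its image is a boundary, subtracting a
      lift of that boundary leaves a kernel element with constant term 1.\<close>
    define d where "d \<sigma> i = (if \<sigma> = {} \<and> i = l then 1 else 0 :: 'k mpoly)" for \<sigma> :: "nat set" and i
    have d: "kchain n s t' 0 b d"
      using l by (auto simp: kchain_iff d_def free_mod_def fhom_def homogeneous_def polys_def fun_eq_iff)
    define c where "c \<sigma> = cmap r s g (d \<sigma>)" for \<sigma>
    have c: "kchain n r t 0 b c"
      unfolding c_def by (rule kchain_cmap[OF g d])
    moreover have "range c \<subseteq> cmap r s g ` free_mod n s"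
      using kchain_free_mod[OF d] by (auto simp: c_def)
    ultimately obtain e where e: "kchain n r t (Suc 0) b e" "range e \<subseteq> cmap r s g ` free_mod n s" "kdiff n e = c"
      using N kdiff_zero_chain[OF c] unfolding koszul_acyclic_def by blast
    obtain f where f: "kchain n s t' (Suc 0) b f" "(\<lambda>\<sigma>. cmap r s g (f \<sigma>)) = e"
      using kchain_lift[OF g e(1,2)] by blast
    define v where "v = (\<lambda>i. d {} i - kdiff n f {} i)"
    have "kchain n s t' 0 b (\<lambda>\<sigma> i. d \<sigma> i - kdiff n f \<sigma> i)"
      by (intro kchain_diff d kchain_kdiff f)
    then have "v \<in> free_mod n s"
      unfolding v_def by (rule kchain_free_mod)
    moreover have "cmap r s g (kdiff n f {}) = c {}"
      using fun_cong[OF kdiff_cmap[of n r s g f], of "{}"] f(2) e(3) by simp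
    then have "cmap r s g v = (\<lambda>_. 0)"
      unfolding v_def cmap_diff by (simp add: c_def)
    ultimately have "lookup (v l) 0 = 0"
      using min by (simp add: cker_def)
    then show False
      using lookup_kbd_var_0[of n "\<lambda>\<sigma>. f \<sigma> l" "{}"] by (simp add: v_def d_def lookup_minus kdiff_def)
  qed
next
  assume b: "\<forall>l<s. t' l \<noteq> b"
  show "koszul_acyclic n r t 0 b (cmap r s g ` free_mod n s)"
    unfolding koszul_acyclic_def
  proof (intro allI impI, elim conjE)
    fix c :: "nat set \<Rightarrow> nat \<Rightarrow> 'k mpoly"
    assume c: "kchain n r t 0 b c" "range c \<subseteq> cmap r s g ` free_mod n s"
    obtain f where f: "kchain n s t' 0 b f" "(\<lambda>\<sigma>. cmap r s g (f \<sigma>)) = c"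
      using kchain_lift[OF g c] by blast
    have "lookup (f {} l) 0 = 0" for l
    proof (cases "l < s")
      case True
      then have "homogeneous (b - t' l) (f {} l)" "b \<noteq> t' l"
        using f(1) b by (auto simp: kchain_iff fhom_def)
      then show ?thesis
        by (metis homogeneous_def in_keys_iff mon_degree_0 of_nat_0 eq_iff_diff_eq_0)
    next
      case False
      then show ?thesis
        using f(1) by (simp add: kchain_def)
    qed
    then obtain h where h: "kchain n s t' (Suc 0) b h" "kdiff n h = f"
      using free_koszul_exact[OF f(1) kdiff_zero_chain[OF f(1)]] by blast
    show "\<exists>e. kchain n r t (Suc 0) b e \<and> range e \<subseteq> cmap r s g ` free_mod n s \<and> kdiff n e = c"
    proof (intro exI[of _ "\<lambda>\<sigma>. cmap r s g (h \<sigma>)"] conjI)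
      show "kchain n r t (Suc 0) b (\<lambda>\<sigma>. cmap r s g (h \<sigma>))"
        by (rule kchain_cmap[OF g h(1)])
      show "range (\<lambda>\<sigma>. cmap r s g (h \<sigma>)) \<subseteq> cmap r s g ` free_mod n s"
        using kchain_free_mod[OF h(1)] by auto
      show "kdiff n (\<lambda>\<sigma>. cmap r s g (h \<sigma>)) = c"
        unfolding kdiff_cmap h(2) using f(2) .
    qed
  qed
qed

section \<open>Twists of minimal resolutions and finite generation\<close>

lemma lookup_mult_0_right: "lookup q 0 = 0 \<Longrightarrow> lookup (p * q) 0 = 0"
  for p q :: "'k::field mpoly"
proof (rule ccontr)
  assume q: "lookup q 0 = 0" and "lookup (p * q) 0 \<noteq> 0"
  then have "0 \<in> keys (p * q)"
    by (simp add: in_keys_iff)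
  then obtain a b where ab: "0 = a + b" "b \<in> keys q"
    using keys_mult[of p q] by blast
  have "mon_degree a + mon_degree b = 0"
    unfolding mon_degree_add[symmetric] ab(1)[symmetric] by simp
  then have "b = 0"
    by simp
  with ab(2) q show False
    by (simp add: in_keys_iff)
qed

text \<open>Iterated dimension shifting: each step replaces the image of \<open>gg a\<close> by its
  kernel, which is the image of \<open>gg (Suc a)\<close>, and lowers i until H_0 detects the
  generators. The source of \<open>gg a\<close> sits at position \<open>Suc a\<close>, hence
  \<open>Suc (a + i)\<close>.\<close>

lemma koszul_acyclic_iff_twists:
  fixes gg :: "nat \<Rightarrow> nat \<Rightarrow> nat \<Rightarrow> 'k::field mpoly"
  assumes gm: "\<And>a. graded_map n (rr a) (tt a) (rr (Suc a)) (tt (Suc a)) (gg a)"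
    and exact: "\<And>a. cker n (rr a) (rr (Suc a)) (gg a) =
      cmap (rr (Suc a)) (rr (Suc (Suc a))) (gg (Suc a)) ` free_mod n (rr (Suc (Suc a)))"
    and min: "\<And>a i l. i < rr (Suc (Suc a)) \<Longrightarrow> l < rr (Suc a) \<Longrightarrow> lookup (gg (Suc a) i l) 0 = 0"
  shows "koszul_acyclic n (rr a) (tt a) i b (cmap (rr a) (rr (Suc a)) (gg a) ` free_mod n (rr (Suc a))) \<longleftrightarrow>
    (\<forall>l<rr (Suc (a + i)). tt (Suc (a + i)) l \<noteq> b)"
proof (induction i arbitrary: a)
  have ker: "\<forall>v\<in>cker n (rr a) (rr (Suc a)) (gg a). \<forall>i. lookup (v i) 0 = 0" for a
  proof (intro ballI allI)
    fix v i
    assume v: "v \<in> cker n (rr a) (rr (Suc a)) (gg a)"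
    obtain w where "v = cmap (rr (Suc a)) (rr (Suc (Suc a))) (gg (Suc a)) w"
      using v unfolding exact[of a] by (rule imageE)
    then show "lookup (v i) 0 = 0"
      using min by (auto simp: cmap_def lookup_sum intro!: sum.neutral lookup_mult_0_right)
  qed
  {
    case 0
    show ?case
      using koszul_acyclic_0_image_iff[OF gm[of a] ker[of a]] by simp
  next
    case (Suc i)
    show ?case
      unfolding koszul_acyclic_image_iff_kernel[OF gm[of a] ker[of a]] exact Suc.IH by simp
  }
qed

section \<open>Graded submodules and their generators\<close>

definition gsubmod :: "nat \<Rightarrow> nat \<Rightarrow> (nat \<Rightarrow> int) \<Rightarrow> (nat \<Rightarrow> 'k::field mpoly) set \<Rightarrow> bool"
  where "gsubmod n r t N \<longleftrightarrow> N \<subseteq> free_mod n r \<and> (\<lambda>_. 0) \<in> N \<and>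
    (\<forall>v\<in>N. \<forall>w\<in>N. (\<lambda>i. v i + w i) \<in> N) \<and> (\<forall>p\<in>polys n. \<forall>v\<in>N. (\<lambda>i. p * v i) \<in> N) \<and>
    (\<forall>e. \<forall>v\<in>N. (\<lambda>i. hcomp (e - t i) (v i)) \<in> N)"

lemma gsubmodD:
  assumes "gsubmod n r t N"
  shows "N \<subseteq> free_mod n r" "(\<lambda>_. 0) \<in> N"
    "v \<in> N \<Longrightarrow> w \<in> N \<Longrightarrow> (\<lambda>i. v i + w i) \<in> N"
    "p \<in> polys n \<Longrightarrow> v \<in> N \<Longrightarrow> (\<lambda>i. p * v i) \<in> N"
    "v \<in> N \<Longrightarrow> (\<lambda>i. hcomp (e - t i) (v i)) \<in> N"
  using assms by (auto simp: gsubmod_def)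

lemma gsubmod_cker:
  assumes g: "graded_map n r t s t' g"
  shows "gsubmod n s t' (cker n r s g)"
  unfolding gsubmod_def
proof (intro conjI ballI allI)
  show "cker n r s g \<subseteq> free_mod n s" "(\<lambda>_. 0) \<in> cker n r s g"
    by (auto simp: cker_def free_mod_def)
  fix v assume v: "v \<in> cker n r s g"
  have v0: "(\<Sum>i<s. v i * g i l) = 0" if "l < r" for l
    using v that by (auto simp: cker_def cmap_def fun_eq_iff split: if_splits)
  {
    fix w assume w: "w \<in> cker n r s g"
    have w0: "(\<Sum>i<s. w i * g i l) = 0" if "l < r" for l
    using w that by (auto simp: cker_def cmap_def fun_eq_iff split: if_splits)
    show "(\<lambda>i. v i + w i) \<in> cker n r s g"
      using v w v0 w0 by (auto simp: cker_def cmap_def free_mod_def distrib_right sum.distrib polys_add fun_eq_iff)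
  }
  {
    fix p :: "'a mpoly" assume p: "p \<in> polys n"
    show "(\<lambda>i. p * v i) \<in> cker n r s g"
      using v v0 p by (auto simp: cker_def cmap_def free_mod_def mult.assoc polys_mult fun_eq_iff simp flip: sum_distrib_left)
  }
  fix e
  show "(\<lambda>i. hcomp (e - t' i) (v i)) \<in> cker n r s g"
    using v by (auto simp: cker_def cmap_hcomp[OF g] free_mod_def hcomp_polys)
qed

text \<open>The span of a finite set. For infinite G the sums are 0 by convention and only the zero
  vector remains, hence the finiteness assumptions below.\<close>

definition gen :: "nat \<Rightarrow> (nat \<Rightarrow> 'k::field mpoly) set \<Rightarrow> (nat \<Rightarrow> 'k mpoly) set"
  where "gen n G = {\<lambda>i. \<Sum>v\<in>G. c v * v i | c. \<forall>v. c v \<in> polys n}"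

lemma gen_0: "(\<lambda>_. 0) \<in> gen n G"
  unfolding gen_def by (intro CollectI exI[of _ "\<lambda>_. 0"]) simp

lemma gen_add:
  assumes "v \<in> gen n G" "w \<in> gen n G"
  shows "(\<lambda>i. v i + w i) \<in> gen n G"
proof -
  from assms obtain c d where "v = (\<lambda>i. \<Sum>x\<in>G. c x * x i)" "\<forall>x. c x \<in> polys n"
    "w = (\<lambda>i. \<Sum>x\<in>G. d x * x i)" "\<forall>x. d x \<in> polys n"
    unfolding gen_def by blast
  then show ?thesis
    unfolding gen_def
    by (intro CollectI exI[of _ "\<lambda>x. c x + d x"]) (simp add: distrib_right sum.distrib polys_add)
qed

lemma gen_mult:
  assumes "v \<in> gen n G" "p \<in> polys n"
  shows "(\<lambda>i. p * v i) \<in> gen n G"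
proof -
  from assms obtain c where "v = (\<lambda>i. \<Sum>x\<in>G. c x * x i)" "\<forall>x. c x \<in> polys n"
    unfolding gen_def by blast
  with assms(2) show ?thesis
    unfolding gen_def
    by (intro CollectI exI[of _ "\<lambda>x. p * c x"]) (simp add: sum_distrib_left mult.assoc polys_mult)
qed

lemma gen_sum:
  assumes "\<And>a. a \<in> A \<Longrightarrow> f a \<in> gen n G"
  shows "(\<lambda>i. \<Sum>a\<in>A. f a i) \<in> gen n G"
  using assms by (induction A rule: infinite_finite_induct) (simp_all add: gen_0 gen_add)

lemma gen_mono:
  assumes "finite H" "G \<subseteq> H"
  shows "gen n G \<subseteq> gen n H"
proof
  fix v assume "v \<in> gen n G"
  then obtain c where c: "v = (\<lambda>i. \<Sum>x\<in>G. c x * x i)" "\<forall>x. c x \<in> polys n"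
    unfolding gen_def by blast
  have "(\<Sum>x\<in>G. c x * x i) = (\<Sum>x\<in>H. (if x \<in> G then c x else 0) * x i)" for i
    using assms by (intro sum.mono_neutral_cong_left) auto
  with c show "v \<in> gen n H"
    unfolding gen_def by (intro CollectI exI[of _ "\<lambda>x. if x \<in> G then c x else 0"]) simp
qed

lemma gen_base:
  assumes "finite G" "x \<in> G"
  shows "x \<in> gen n G"
proof -
  have "(\<Sum>v\<in>G. (if v = x then 1 else 0) * v i) = x i" for i
  proof -
    have "(\<Sum>v\<in>G. (if v = x then 1 else 0) * v i) = (\<Sum>v\<in>G. if v = x then x i else 0)"
      by (rule sum.cong) auto
    then show ?thesis
      using assms by simp
  qed
  then show ?thesis
    unfolding gen_def
    by (intro CollectI exI[of _ "\<lambda>v. if v = x then 1 else 0"]) (auto simp: polys_def fun_eq_iff)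
qed

lemma gen_subset:
  assumes N: "gsubmod n r t N" and G: "G \<subseteq> N"
  shows "gen n G \<subseteq> N"
proof
  fix v assume "v \<in> gen n G"
  then obtain c where c: "v = (\<lambda>i. \<Sum>x\<in>G. c x * x i)" "\<forall>x. c x \<in> polys n"
    unfolding gen_def by blast
  have "(\<lambda>i. \<Sum>x\<in>A. c x * x i) \<in> N" if "A \<subseteq> G" for A
    using that
  proof (induction A rule: infinite_finite_induct)
    case (insert x A)
    then have "(\<lambda>i. c x * x i) \<in> N" "(\<lambda>i. \<Sum>x\<in>A. c x * x i) \<in> N"
      using G c(2) by (auto intro: gsubmodD(4)[OF N])
    then have "(\<lambda>i. c x * x i + (\<Sum>x\<in>A. c x * x i)) \<in> N"
      by (rule gsubmodD(3)[OF N])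
    with insert show ?case
      by simp
  qed (simp_all add: gsubmodD(2)[OF N])
  with c show "v \<in> N"
    by blast
qed

text \<open>Gaussian elimination over the set D of positions where entries may be nonzero: vectors
  vanishing at one position are covered by induction, and a single vector not vanishing there clears
  that position in all others. Scalars appear as the constants \<open>single 0 c\<close>.\<close>

lemma finite_dimensional_gen:
  fixes W :: "(nat \<Rightarrow> 'k::field mpoly) set"
  assumes "finite D"
    and "\<And>v w c. v \<in> W \<Longrightarrow> w \<in> W \<Longrightarrow> (\<lambda>i. v i + single 0 c * w i) \<in> W"
    and "\<And>w i u. w \<in> W \<Longrightarrow> lookup (w i) u \<noteq> 0 \<Longrightarrow> (i, u) \<in> D"
  shows "\<exists>S. finite S \<and> S \<subseteq> W \<and> W \<subseteq> gen n S"
  using assms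
proof (induction D arbitrary: W rule: finite_induct)
  case empty
  have "w = (\<lambda>_. 0)" if "w \<in> W" for w
    using empty(2)[OF that] by (auto simp: fun_eq_iff poly_mapping_eq_iff)
  then show ?case
    using gen_0 by (intro exI[of _ "{}"]) auto
next
  case (insert d D)
  obtain i u where d: "d = (i, u)"
    by force
  define W' where "W' = {w \<in> W. lookup (w i) u = 0}"
  have "\<exists>S. finite S \<and> S \<subseteq> W' \<and> W' \<subseteq> gen n S"
  proof (rule insert.IH)
    show "(\<lambda>i. v i + single 0 c * w i) \<in> W'" if "v \<in> W'" "w \<in> W'" for v w c
      using that insert.prems(1) by (auto simp: W'_def lookup_add lookup_single_mult)
    show "(i', u') \<in> D" if "w \<in> W'" "lookup (w i') u' \<noteq> 0" for w i' u'
      using that insert.prems(2)[of w i' u'] by (auto simp: W'_def d)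
  qed
  then obtain S where S: "finite S" "S \<subseteq> W'" "W' \<subseteq> gen n S"
    by blast
  show ?case
  proof (cases "W \<subseteq> W'")
    case True
    with S have "S \<subseteq> W" "W \<subseteq> gen n S"
      by (auto simp: W'_def)
    with S(1) show ?thesis
      by (intro exI[of _ S]) simp
  next
    case False
    then obtain w0 where w0: "w0 \<in> W" "lookup (w0 i) u \<noteq> 0"
      by (auto simp: W'_def)
    have "W \<subseteq> gen n (insert w0 S)"
    proof
      fix w assume w: "w \<in> W"
      define c where "c = lookup (w i) u / lookup (w0 i) u"
      have "(\<lambda>i. w i + single 0 (- c) * w0 i) \<in> W'"
        using w0 w insert.prems(1) by (simp add: W'_def lookup_add lookup_single_mult c_def)
      then have "(\<lambda>i. w i + single 0 (- c) * w0 i) \<in> gen n (insert w0 S)"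
        using S gen_mono[of "insert w0 S" S n] by blast
      moreover have "(\<lambda>i. single 0 c * w0 i) \<in> gen n (insert w0 S)"
        using S by (intro gen_mult gen_base polys_single) auto
      ultimately have "(\<lambda>i. (w i + single 0 (- c) * w0 i) + single 0 c * w0 i) \<in> gen n (insert w0 S)"
        by (rule gen_add)
      then show "w \<in> gen n (insert w0 S)"
        by (simp add: single_uminus)
    qed
    moreover have "insert w0 S \<subseteq> W"
      using w0 S by (auto simp: W'_def)
    ultimately show ?thesis
      using S(1) by blast
  qed
qed

lemma finite_mon_degree: "finite {u. keys u \<subseteq> {1..n} \<and> mon_degree u = d}"
proof -
  have "{u. keys u \<subseteq> {1..n} \<and> mon_degree u = d} \<subseteq>
    (\<lambda>f. Abs_poly_mapping f) ` {f. \<forall>i. (i \<in> {1..n} \<longrightarrow> f i \<in> {..d}) \<and> (i \<notin> {1..n} \<longrightarrow> f i = 0)}"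
  proof
    fix u assume u: "u \<in> {u. keys u \<subseteq> {1..n} \<and> mon_degree u = d}"
    have "lookup u i \<le> d" if "i \<in> {1..n}" for i
    proof -
      have "lookup u i \<le> (\<Sum>i\<in>{1..n}. lookup u i)"
        using that by (intro member_le_sum) auto
      with u show ?thesis
        using mon_degree_superset[of "{1..n}" u] by simp
    qed
    moreover have "lookup u i = 0" if "i \<notin> {1..n}" for i
      using u that by (auto simp: in_keys_iff)
    ultimately show "u \<in> (\<lambda>f. Abs_poly_mapping f) ` {f. \<forall>i. (i \<in> {1..n} \<longrightarrow> f i \<in> {..d}) \<and> (i \<notin> {1..n} \<longrightarrow> f i = 0)}"
      by (intro image_eqI[of _ _ "lookup u"]) (auto simp: Poly_Mapping.lookup_inverse)
  qed
  moreover have "finite {f. \<forall>i. (i \<in> {1..n} \<longrightarrow> f i \<in> {..d}) \<and> (i \<notin> {1..n} \<longrightarrow> f i = (0::nat))}"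
    by (rule finite_set_of_finite_funs) auto
  ultimately show ?thesis
    by (rule finite_surj[rotated])
qed

lemma finite_graded_piece_gen:
  assumes N: "gsubmod n r t N"
  shows "\<exists>S. finite S \<and> S \<subseteq> {v \<in> N. fhom r t b v} \<and> {v \<in> N. fhom r t b v} \<subseteq> gen n S"
proof (rule finite_dimensional_gen)
  show "finite (SIGMA i:{..<r}. {u. keys u \<subseteq> {1..n} \<and> mon_degree u = nat (b - t i)})"
    by (intro finite_SigmaI finite_mon_degree) simp
  show "(\<lambda>i. v i + single 0 c * w i) \<in> {v \<in> N. fhom r t b v}"
    if v: "v \<in> {v \<in> N. fhom r t b v}" and w: "w \<in> {v \<in> N. fhom r t b v}" for v w c
  proof -
    have "single 0 c \<in> polys n"
      by (rule polys_single) simp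
    then have "(\<lambda>i. v i + single 0 c * w i) \<in> N"
      using v w by (auto intro: gsubmodD(3,4)[OF N])
    moreover have "homogeneous (b - t i) (v i + single 0 c * w i)" if "i < r" for i
    proof (rule homogeneous_add)
      show "homogeneous (b - t i) (single 0 c * w i)"
        by (rule homogeneous_mult'[of 0 _ "b - t i"]) (use w that in \<open>auto simp: fhom_def homogeneous_def\<close>)
    qed (use v that in \<open>auto simp: fhom_def\<close>)
    ultimately show ?thesis
      by (simp add: fhom_def)
  qed
  show "(i, u) \<in> (SIGMA i:{..<r}. {u. keys u \<subseteq> {1..n} \<and> mon_degree u = nat (b - t i)})"
    if w: "w \<in> {v \<in> N. fhom r t b v}" and u: "lookup (w i) u \<noteq> 0" for w i u
  proof -
    have wf: "w \<in> free_mod n r"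
      using w N by (auto simp: gsubmod_def)
    have u': "u \<in> keys (w i)"
      using u by (simp add: in_keys_iff)
    have i: "i < r"
      using wf u by (cases "i < r") (auto simp: free_mod_def)
    then have "keys u \<subseteq> {1..n}" "int (mon_degree u) = b - t i"
      using wf w u' by (auto simp: free_mod_def polys_def fhom_def homogeneous_def)
    with i show ?thesis
      by auto
  qed
qed

lemma homogeneous_decomposition:
  assumes "v \<in> free_mod n r"
  obtains E where "finite E" "v = (\<lambda>i. \<Sum>e\<in>E. hcomp (e - t i) (v i))"
proof
  define E where "E = (\<Union>i<r. (\<lambda>u. int (mon_degree u) + t i) ` keys (v i))"
  show fin: "finite E"
    by (simp add: E_def)
  show "v = (\<lambda>i. \<Sum>e\<in>E. hcomp (e - t i) (v i))"
  proof
    fix i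
    show "v i = (\<Sum>e\<in>E. hcomp (e - t i) (v i))"
    proof (rule poly_mapping_eqI)
      fix u
      have "(\<Sum>e\<in>E. lookup (hcomp (e - t i) (v i)) u) =
          (\<Sum>e\<in>E. if e = int (mon_degree u) + t i then lookup (v i) u else 0)"
        by (rule sum.cong) (auto simp: lookup_hcomp)
      also have "\<dots> = (if int (mon_degree u) + t i \<in> E then lookup (v i) u else 0)"
        using fin by simp
      also have "\<dots> = lookup (v i) u"
      proof (cases "u \<in> keys (v i)")
        case True
        then have "i < r"
          using assms by (cases "i < r") (auto simp: free_mod_def)
        with True have "int (mon_degree u) + t i \<in> E"
          by (auto simp: E_def)
        then show ?thesis
          by simp
      qed (simp add: in_keys_iff)
      finally show "lookup (v i) u = lookup (\<Sum>e\<in>E. hcomp (e - t i) (v i)) u"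
        by (simp add: lookup_sum)
    qed
  qed
qed

text \<open>Vanishing of H_0 in degree b writes an element of degree b as a sum of variables times
  elements of N of degree \<open>b - 1\<close>.\<close>

lemma koszul_acyclic_0_gen:
  assumes ac: "koszul_acyclic n r t 0 b N" and N: "N \<subseteq> free_mod n r"
    and G: "\<And>v. v \<in> N \<Longrightarrow> fhom r t (b - 1) v \<Longrightarrow> v \<in> gen n G"
    and w: "w \<in> N" "fhom r t b w" and zero: "(\<lambda>_. 0) \<in> N"
  shows "w \<in> gen n G"
proof -
  define c where "c \<sigma> = (if \<sigma> = {} then w else (\<lambda>_. 0))" for \<sigma> :: "nat set"
  have c: "kchain n r t 0 b c"
    using w N by (auto simp: kchain_iff c_def free_mod_def fhom_def)
  moreover have "range c \<subseteq> N"
    using w zero by (auto simp: c_def)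
  ultimately obtain e where e: "kchain n r t (Suc 0) b e" "range e \<subseteq> N" "kdiff n e = c"
    using ac kdiff_zero_chain[OF c] unfolding koszul_acyclic_def by blast
  have "w = (\<lambda>l. \<Sum>j\<in>{1..n}. (ksign j {} * var j) * e {j} l)"
    using fun_cong[OF e(3), of "{}"] by (simp add: c_def kdiff_def kbd_def fun_eq_iff)
  moreover have "(\<lambda>l. \<Sum>j\<in>{1..n}. (ksign j {} * var j) * e {j} l) \<in> gen n G"
  proof (intro gen_sum gen_mult G polys_mult polys_ksign polys_var)
    show "e {j} \<in> N" "fhom r t (b - 1) (e {j})" for j
      using e by (auto simp: kchain_iff)
  qed
  ultimately show ?thesis
    by simp
qed

text \<open>Graded pieces are finite-dimensional and vanish in low degrees, so those up to B need
  finitely many generators. Above B, vanishing of H_0 generates each piece from the preceding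
  one.\<close>

lemma finitely_generated:
  assumes N: "gsubmod n r t N" and ac: "\<And>b. b > B \<Longrightarrow> koszul_acyclic n r t 0 b N"
  obtains G where "finite G" "G \<subseteq> N" "\<And>v. v \<in> G \<Longrightarrow> \<exists>e. fhom r t e v" "gen n G = N"
proof -
  \<comment> \<open>Below all twists the graded pieces are 0; inserting B keeps the minimum defined
    when r = 0.\<close>
  define lo where "lo = Min (insert B (t ` {..<r}))"
  have "\<forall>b. \<exists>S. finite S \<and> S \<subseteq> {v \<in> N. fhom r t b v} \<and> {v \<in> N. fhom r t b v} \<subseteq> gen n S"
    using finite_graded_piece_gen[OF N] by simp
  from choice[OF this] obtain S where
    "\<forall>b. finite (S b) \<and> S b \<subseteq> {v \<in> N. fhom r t b v} \<and> {v \<in> N. fhom r t b v} \<subseteq> gen n (S b)"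
    by (rule exE)
  then have S: "finite (S b)" "S b \<subseteq> {v \<in> N. fhom r t b v}" "{v \<in> N. fhom r t b v} \<subseteq> gen n (S b)" for b
    by simp_all
  define G where "G = (\<Union>b\<in>{lo..B}. S b)"
  have G: "finite G" "G \<subseteq> N" "\<And>v. v \<in> G \<Longrightarrow> \<exists>e. fhom r t e v"
  proof -
    show "finite G"
      by (simp add: G_def S(1))
    have *: "v \<in> N \<and> (\<exists>e. fhom r t e v)" if "v \<in> G" for v
    proof -
      from that obtain b where "v \<in> S b"
        by (auto simp: G_def)
      then show ?thesis
        using S(2)[of b] by blast
    qed
    then show "G \<subseteq> N" "\<And>v. v \<in> G \<Longrightarrow> \<exists>e. fhom r t e v"
      by blast+
  qed
  have NF: "N \<subseteq> free_mod n r" "(\<lambda>_. 0) \<in> N"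
    using N by (auto simp: gsubmod_def)
  have low: "v \<in> gen n G" if "v \<in> N" "fhom r t b v" "b \<le> B" for v b
  proof (cases "b < lo")
    case True
    have "v i = 0" for i
    proof (cases "i < r")
      case i: True
      then have "lo \<le> t i"
        unfolding lo_def by (intro Min_le) auto
      with True that(2) i have "keys (v i) = {}"
        by (fastforce simp: fhom_def homogeneous_def)
      then show ?thesis
        by (simp add: keys_eq_empty)
    next
      case False
      then show ?thesis
        using that NF by (auto simp: free_mod_def)
    qed
    then have "v = (\<lambda>_. 0)"
      by (rule ext)
    then show ?thesis
      using gen_0 by simp
  next
    case False
    then have "S b \<subseteq> G"
      using that unfolding G_def by (intro UN_upper) simp
    then show ?thesis
      using that S(3)[of b] gen_mono[OF G(1), of "S b" n] by blast
  qed
  have hom: "v \<in> gen n G" if "v \<in> N" "fhom r t b v" for v b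
  proof (cases "b \<le> B")
    case False
    then have "B \<le> b" by simp
    then have "\<forall>v. v \<in> N \<longrightarrow> fhom r t b v \<longrightarrow> v \<in> gen n G"
    proof (induction b rule: int_ge_induct)
      case base
      then show ?case
        using low by blast
    next
      case (step b)
      then show ?case
        using koszul_acyclic_0_gen[OF ac[of "b + 1"] NF(1) _ _ _ NF(2)] by simp
    qed
    with that show ?thesis
      by blast
  qed (use low that in blast)
  have "v \<in> gen n G" if v: "v \<in> N" for v
  proof -
    obtain E where E: "finite E" "v = (\<lambda>i. \<Sum>e\<in>E. hcomp (e - t i) (v i))"
      using homogeneous_decomposition[of v n r t] NF v by blast
    have "(\<lambda>i. \<Sum>e\<in>E. hcomp (e - t i) (v i)) \<in> gen n G"
    proof (rule gen_sum)
      fix e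
      show "(\<lambda>i. hcomp (e - t i) (v i)) \<in> gen n G"
        using N v by (intro hom[of _ e]) (auto simp: gsubmod_def fhom_def)
    qed
    with E(2) show ?thesis
      by simp
  qed
  then have "gen n G = N"
    using gen_subset[OF N G(2)] by blast
  with G show ?thesis
    using that by blast
qed

section \<open>Minimal resolutions and Betti numbers\<close>

declare One_nat_def [simp del]

lemma gen_closed:
  assumes "\<And>x. x \<in> G \<Longrightarrow> x \<in> gen n H"
  shows "gen n G \<subseteq> gen n H"
proof
  fix v assume "v \<in> gen n G"
  then obtain c where c: "v = (\<lambda>i. \<Sum>x\<in>G. c x * x i)" "\<forall>x. c x \<in> polys n"
    unfolding gen_def by blast
  then show "v \<in> gen n H"
    using assms by (auto intro!: gen_sum gen_mult)
qed

definition minimal_cover ::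
    "nat \<Rightarrow> nat \<Rightarrow> (nat \<Rightarrow> int) \<Rightarrow> (nat \<Rightarrow> 'k::field mpoly) set \<Rightarrow>
      nat \<Rightarrow> (nat \<Rightarrow> int) \<Rightarrow> (nat \<Rightarrow> nat \<Rightarrow> 'k mpoly) \<Rightarrow> bool"
  where "minimal_cover n r t N s t' g \<longleftrightarrow> graded_map n r t s t' g \<and> cmap r s g ` free_mod n s = N \<and>
    (\<forall>v\<in>cker n r s g. \<forall>i. lookup (v i) 0 = 0)"

text \<open>A homogeneous generating set of least cardinality works: a relation with a nonzero
  constant term would express one generator through the others.\<close>

lemma minimal_cover_exists:
  assumes N: "gsubmod n r t N" and ac: "\<And>b. b > B \<Longrightarrow> koszul_acyclic n r t 0 b N"
  obtains s t' g where "minimal_cover n r t N s t' g"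
proof -
  define Q where "Q G \<longleftrightarrow> finite G \<and> G \<subseteq> N \<and> (\<forall>v\<in>G. \<exists>e. fhom r t e v) \<and> gen n G = N" for G
  obtain G0 where "Q G0"
    using finitely_generated[OF N ac] unfolding Q_def by metis
  then obtain G where G: "Q G" and least: "\<And>H. Q H \<Longrightarrow> card G \<le> card H"
    using ex_has_least_nat[of Q G0 card] by metis
  have NF: "N \<subseteq> free_mod n r"
    by (rule gsubmodD(1)[OF N])
  define s where "s = card G"
  obtain f where f: "bij_betw f {..<s} G"
    using ex_bij_betw_nat_finite[of G] G unfolding Q_def s_def atLeast0LessThan by blast
  have fG: "f i \<in> G" if "i < s" for i
    using f that by (auto simp: bij_betw_def)
  have f0: "f i l = 0" if "i < s" "l \<ge> r" for i l
    using fG[OF that(1)] that(2) NF G by (auto simp: Q_def free_mod_def)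
  define t' where "t' i = (SOME e. fhom r t e (f i))" for i
  have t': "fhom r t (t' i) (f i)" if "i < s" for i
  proof -
    have "\<exists>e. fhom r t e (f i)"
      using fG[OF that] G by (simp add: Q_def)
    then show ?thesis
      unfolding t'_def by (rule someI_ex)
  qed
  have gm: "graded_map n r t s t' f"
    unfolding graded_map_def
  proof (intro allI impI conjI)
    fix i l assume il: "i < s" "l < r"
    then have "f i \<in> free_mod n r"
      using fG G NF by (auto simp: Q_def)
    with il t'[of i] show "f i l \<in> polys n" "homogeneous (t' i - t l) (f i l)"
      by (auto simp: free_mod_def fhom_def)
  qed
  have cm: "cmap r s f v = (\<lambda>l. \<Sum>i<s. v i * f i l)" for v
    by (auto simp: cmap_def fun_eq_iff f0)
  have im: "cmap r s f ` free_mod n s = gen n G"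
  proof (intro equalityI subsetI)
    fix w assume "w \<in> cmap r s f ` free_mod n s"
    then obtain v where v: "v \<in> free_mod n s" "w = cmap r s f v"
      by (rule imageE)
    have "(\<lambda>l. \<Sum>i<s. v i * f i l) \<in> gen n G"
      using v fG G by (intro gen_sum gen_mult gen_base) (auto simp: Q_def free_mod_def)
    then show "w \<in> gen n G"
      by (simp add: v cm)
  next
    fix w assume "w \<in> gen n G"
    then obtain c where c: "w = (\<lambda>l. \<Sum>x\<in>G. c x * x l)" "\<forall>x. c x \<in> polys n"
      unfolding gen_def by blast
    have "(\<Sum>x\<in>G. c x * x l) = (\<Sum>i<s. (if i < s then c (f i) else 0) * f i l)" for l
      using sum.reindex_bij_betw[OF f, of "\<lambda>x. c x * x l"] by simp
    then have "w = cmap r s f (\<lambda>i. if i < s then c (f i) else 0)"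
      by (simp add: cm c)
    moreover have "(\<lambda>i. if i < s then c (f i) else 0) \<in> free_mod n s"
      using c by (simp add: free_mod_def)
    ultimately show "w \<in> cmap r s f ` free_mod n s"
      by (rule image_eqI)
  qed
  have "lookup (v l) 0 = 0" if v: "v \<in> cker n r s f" for v l
  proof (rule ccontr)
    assume c0: "lookup (v l) 0 \<noteq> 0"
    have l: "l < s"
      using v c0 by (cases "l < s") (auto simp: cker_def free_mod_def)
    define a where "a = lookup (v l) 0"
    \<comment> \<open>The part of total degree \<open>t' l\<close> is again a relation, and its l-th
      coefficient has degree 0, so it is the invertible scalar a.\<close>
    define v' where "v' i = hcomp (t' l - t' i) (v i)" for i
    have v': "v' \<in> cker n r s f"
      unfolding v'_def by (rule gsubmodD(5)[OF gsubmod_cker[OF gm] v])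
    have v'l: "v' l = single 0 a"
      by (rule poly_mapping_eqI) (auto simp: v'_def lookup_hcomp a_def lookup_single when_def)
    have "f l k = (\<Sum>i\<in>{..<s} - {l}. (single 0 (- 1 / a) * v' i) * f i k)" for k
    proof -
      have "0 = (\<Sum>i<s. v' i * f i k)"
        using v' by (auto simp: cker_def cm fun_eq_iff)
      also have "\<dots> = single 0 a * f l k + (\<Sum>i\<in>{..<s} - {l}. v' i * f i k)"
        using l by (subst sum.remove[of _ l]) (auto simp: v'l)
      finally have "single 0 (- 1 / a) * (single 0 a * f l k + (\<Sum>i\<in>{..<s} - {l}. v' i * f i k)) = 0"
        by simp
      moreover have "single 0 (- 1 / a) * (single 0 a * f l k) = - f l k"
        using c0 by (simp add: mult_single a_def single_uminus flip: mult.assoc)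
      ultimately show ?thesis
        by (simp add: distrib_left sum_distrib_left mult.assoc)
    qed
    then have "f l = (\<lambda>k. \<Sum>i\<in>{..<s} - {l}. (single 0 (- 1 / a) * v' i) * f i k)"
      by (rule ext)
    also have "\<dots> \<in> gen n (G - {f l})"
    proof (intro gen_sum gen_mult gen_base polys_mult polys_single)
      show "f i \<in> G - {f l}" if "i \<in> {..<s} - {l}" for i
        using that f l by (auto simp: bij_betw_def inj_on_def)
      show "v' i \<in> polys n" if "i \<in> {..<s} - {l}" for i
        using v' that by (auto simp: cker_def free_mod_def)
    qed (use G in \<open>auto simp: Q_def\<close>)
    finally have fl: "f l \<in> gen n (G - {f l})" .
    have "gen n G \<subseteq> gen n (G - {f l})"
    proof (rule gen_closed)
      show "x \<in> gen n (G - {f l})" if "x \<in> G" for x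
        using fl that G by (cases "x = f l") (auto simp: Q_def intro!: gen_base)
    qed
    then have "Q (G - {f l})"
      using G gen_subset[OF N, of "G - {f l}"] by (auto simp: Q_def)
    then have "card G \<le> card (G - {f l})"
      by (rule least)
    moreover have "card (G - {f l}) < card G"
      using G fG[OF l] by (intro psubset_card_mono) (auto simp: Q_def)
    ultimately show False
      by simp
  qed
  with gm im G have "minimal_cover n r t N s t' f"
    by (simp add: minimal_cover_def Q_def)
  then show ?thesis
    by (rule that)
qed

text \<open>The bound grows linearly in i so that it survives passing to syzygies: H_i of the kernel
  is controlled by H_(i+1) of N, which raises the constant by one.\<close>

definition regular_bound :: "nat \<Rightarrow> nat \<Rightarrow> (nat \<Rightarrow> int) \<Rightarrow> (nat \<Rightarrow> 'k::field mpoly) set \<Rightarrow> bool"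
  where "regular_bound n r t N \<longleftrightarrow> gsubmod n r t N \<and>
    (\<exists>B. \<forall>i b. b > B + int i \<longrightarrow> koszul_acyclic n r t i b N)"

lemma regular_bound_cover:
  assumes "regular_bound n r t N"
  obtains s t' g where "minimal_cover n r t N s t' g" "regular_bound n s t' (cker n r s g)"
proof -
  obtain B where B: "\<And>i b. b > B + int i \<Longrightarrow> koszul_acyclic n r t i b N"
    using assms unfolding regular_bound_def by metis
  have "koszul_acyclic n r t 0 b N" if "b > B" for b
    using B[of 0 b] that by simp
  then obtain s t' g where g: "minimal_cover n r t N s t' g"
    using minimal_cover_exists[of n r t N B] assms unfolding regular_bound_def by metis
  have "koszul_acyclic n s t' i b (cker n r s g)" if "b > (B + 1) + int i" for i b
    using koszul_acyclic_image_iff_kernel[of n r t s t' g i b] B[of "Suc i" b] g that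
    by (simp add: minimal_cover_def)
  then have "regular_bound n s t' (cker n r s g)"
    using gsubmod_cker[of n r t s t' g] g unfolding regular_bound_def minimal_cover_def by blast
  with g show ?thesis
    by (rule that)
qed

definition as_submodule :: "nat \<Rightarrow> 'k::field mpoly set \<Rightarrow> (nat \<Rightarrow> 'k mpoly) set"
  where "as_submodule n I = {v \<in> free_mod n 1. v 0 \<in> I}"

text \<open>Covers are chosen successively. A stage holds rank and twists of the target, followed by
  a cover of the current syzygy module; \<open>Q\<close> demands that the next stage covers the
  kernel of this one.\<close>

lemma minimal_resolution_exists:
  fixes I :: "'k::field mpoly set"
  assumes I: "I \<subseteq> polys n" and reg: "regular_bound n 1 (\<lambda>_. 0) (as_submodule n I)"
  obtains F where "minimal_graded_free_resolution n I F"
proof -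
  define P :: "nat \<Rightarrow> (nat \<times> (nat \<Rightarrow> int)) \<times> nat \<times> (nat \<Rightarrow> int) \<times> (nat \<Rightarrow> nat \<Rightarrow> 'k mpoly) \<Rightarrow> bool"
    where "P k x = (case x of ((r, t), s, t', g) \<Rightarrow>
      minimal_cover n r t (cmap r s g ` free_mod n s) s t' g \<and> regular_bound n s t' (cker n r s g) \<and>
      (k = 0 \<longrightarrow> r = 1 \<and> t = (\<lambda>_. 0) \<and> cmap r s g ` free_mod n s = as_submodule n I))" for k x
  define Q :: "nat \<Rightarrow> (nat \<times> (nat \<Rightarrow> int)) \<times> nat \<times> (nat \<Rightarrow> int) \<times> (nat \<Rightarrow> nat \<Rightarrow> 'k mpoly) \<Rightarrow>
      (nat \<times> (nat \<Rightarrow> int)) \<times> nat \<times> (nat \<Rightarrow> int) \<times> (nat \<Rightarrow> nat \<Rightarrow> 'k mpoly) \<Rightarrow> bool"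
    where "Q k x y = (case x of ((r, t), s, t', g) \<Rightarrow> case y of ((r2, t2), s2, t2', g2) \<Rightarrow>
      r2 = s \<and> t2 = t' \<and> cmap r2 s2 g2 ` free_mod n s2 = cker n r s g)" for k x y
  have "\<exists>f. \<forall>k. P k (f k) \<and> Q k (f k) (f (Suc k))"
  proof (rule dependent_nat_choice)
    obtain s t' g where "minimal_cover n 1 (\<lambda>_. 0) (as_submodule n I) s t' g"
      "regular_bound n s t' (cker n 1 s g)"
      using regular_bound_cover[OF reg] by blast
    then show "\<exists>x. P 0 x"
      by (intro exI[of _ "((1, \<lambda>_. 0), s, t', g)"]) (auto simp: P_def minimal_cover_def)
  next
    fix x k assume x: "P k x"
    obtain r t s t' g where x_eq: "x = ((r, t), s, t', g)"
      by (metis prod.collapse)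
    then have "regular_bound n s t' (cker n r s g)"
      using x by (simp add: P_def)
    then obtain s2 t2' g2 where "minimal_cover n s t' (cker n r s g) s2 t2' g2"
      "regular_bound n s2 t2' (cker n s s2 g2)"
      using regular_bound_cover by blast
    then show "\<exists>y. P (Suc k) y \<and> Q k x y"
      by (intro exI[of _ "((s, t'), s2, t2', g2)"]) (auto simp: P_def Q_def x_eq minimal_cover_def)
  qed
  then obtain f where f: "\<And>k. P k (f k)" "\<And>k. Q k (f k) (f (Suc k))"
    by blast
  \<comment> \<open>\<open>S k\<close> and \<open>T' k\<close> describe the k-th free module,
    \<open>R k\<close> and \<open>T k\<close> its target, which for k = 0 is the polynomial ring
    itself.\<close>
  define R T S T' g where "R k = fst (fst (f k))" and "T k = snd (fst (f k))" and
    "S k = fst (snd (f k))" and "T' k = fst (snd (snd (f k)))" and "g k = snd (snd (snd (f k)))" for k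
  have f_eq: "f k = ((R k, T k), S k, T' k, g k)" for k
    by (simp add: R_def T_def S_def T'_def g_def)
  have cov: "graded_map n (R k) (T k) (S k) (T' k) (g k)"
      "\<forall>v\<in>cker n (R k) (S k) (g k). \<forall>i. lookup (v i) 0 = 0" for k
    using f(1)[of k] by (simp_all add: P_def f_eq minimal_cover_def)
  have zero: "R 0 = 1" "T 0 = (\<lambda>_. 0)" "cmap 1 (S 0) (g 0) ` free_mod n (S 0) = as_submodule n I"
    using f(1)[of 0] by (auto simp: P_def f_eq)
  have suc: "R (Suc k) = S k" "T (Suc k) = T' k"
      "cmap (S k) (S (Suc k)) (g (Suc k)) ` free_mod n (S (Suc k)) = cker n (R k) (S k) (g k)" for k
    using f(2)[of k] by (auto simp: Q_def f_eq)
  define F :: "'k free_complex" where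
    "F = \<lparr>rk = S, twist = T', aug = \<lambda>i. g 0 i 0, dmat = \<lambda>k. g (Suc k)\<rparr>"
  have rk_F: "rk F = S"
    by (simp add: F_def)
  have diff_F: "diff_map F k = cmap (S k) (S (Suc k)) (g (Suc k))" for k
    by (simp add: F_def diff_map_def cmap_def fun_eq_iff)
  have aug_F: "cmap 1 (S 0) (g 0) v = (\<lambda>l. if l = 0 then aug_map F v else 0)" for v
    by (simp add: F_def aug_map_def cmap_def fun_eq_iff)
  have "graded_complex n F"
    unfolding graded_complex_def
    using cov(1)[of 0] cov(1)[of "Suc _"] by (auto simp: F_def graded_map_def suc zero)
  moreover have "aug_map F ` free_mod n (rk F 0) = I"
  proof -
    have "aug_map F v = cmap 1 (S 0) (g 0) v 0" for v
      by (simp add: aug_F)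
    then have "aug_map F ` free_mod n (rk F 0) = (\<lambda>w. w 0) ` as_submodule n I"
      unfolding zero(3)[symmetric] by (simp add: F_def image_image)
    also have "\<dots> = I"
    proof (intro equalityI subsetI)
      fix p assume p: "p \<in> I"
      then have "(\<lambda>l. if l = 0 then p else 0) \<in> as_submodule n I"
        using I by (auto simp: as_submodule_def free_mod_def)
      then show "p \<in> (\<lambda>w. w 0) ` as_submodule n I"
        by (rule rev_image_eqI) simp
    qed (auto simp: as_submodule_def)
    finally show ?thesis .
  qed
  moreover have "{v \<in> free_mod n (rk F 0). aug_map F v = 0} = diff_map F 0 ` free_mod n (rk F 1)"
  proof -
    have "cker n 1 (S 0) (g 0) = {v \<in> free_mod n (rk F 0). aug_map F v = 0}"
      by (auto simp: cker_def aug_F F_def fun_eq_iff)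
    then show ?thesis
      using suc(3)[of 0] zero(1) by (simp add: diff_F rk_F One_nat_def)
  qed
  moreover have "{v \<in> free_mod n (rk F (Suc k)). diff_map F k v = (\<lambda>_. 0)} =
      diff_map F (Suc k) ` free_mod n (rk F (Suc (Suc k)))" for k
    using suc(3)[of "Suc k"] by (simp add: diff_F suc(1) cker_def rk_F)
  moreover have "dmat F k i l \<in> irrelevant_ideal n" if "i < rk F (Suc k)" "l < rk F k" for k i l
  proof -
    have i: "i < S (Suc k)" and l: "l < S k"
      using that by (simp_all add: F_def)
    \<comment> \<open>The image of the i-th basis vector is a row of the matrix. It lies in the
      preceding kernel, whose elements have no constant terms.\<close>
    define e :: "nat \<Rightarrow> 'k mpoly" where "e m = (if m = i then 1 else 0)" for m
    have "e \<in> free_mod n (S (Suc k))"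
      using i by (auto simp: e_def free_mod_def polys_def)
    then have "cmap (S k) (S (Suc k)) (g (Suc k)) e \<in> cker n (R k) (S k) (g k)"
      unfolding suc(3)[symmetric] by (rule imageI)
    then have "lookup (cmap (S k) (S (Suc k)) (g (Suc k)) e l) 0 = 0"
      using cov(2)[of k] by blast
    moreover have "(\<Sum>m<S (Suc k). e m * g (Suc k) m l) = (\<Sum>m<S (Suc k). if m = i then g (Suc k) i l else 0)"
      by (rule sum.cong) (auto simp: e_def)
    then have "cmap (S k) (S (Suc k)) (g (Suc k)) e l = g (Suc k) i l"
      using i l by (simp add: cmap_def)
    moreover have "g (Suc k) i l \<in> polys n"
      using cov(1)[of "Suc k"] i l by (simp add: graded_map_def suc)
    ultimately show ?thesis
      using i by (simp add: irrelevant_ideal_iff F_def)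
  qed
  ultimately have "minimal_graded_free_resolution n I F"
    by (simp add: minimal_graded_free_resolution_def graded_free_resolution_def)
  then show ?thesis
    by (rule that)
qed

text \<open>Placing the polynomial ring at position 0 makes the augmentation one more differential,
  and moves \<open>rk F a\<close> to position \<open>Suc a\<close>.\<close>

lemma koszul_acyclic_iff_resolution:
  fixes I :: "'k::field mpoly set"
  assumes I: "I \<subseteq> polys n" and F: "minimal_graded_free_resolution n I F"
  shows "koszul_acyclic n 1 (\<lambda>_. 0) a b (as_submodule n I) \<longleftrightarrow> (\<forall>l<rk F a. twist F a l \<noteq> b)"
proof -
  define rr where "rr k = (case k of 0 \<Rightarrow> 1 | Suc a \<Rightarrow> rk F a)" for k
  define tt where "tt k = (case k of 0 \<Rightarrow> \<lambda>_. 0 | Suc a \<Rightarrow> twist F a)" for k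
  define gg where "gg k = (case k of 0 \<Rightarrow> \<lambda>i _. aug F i | Suc a \<Rightarrow> dmat F a)" for k
  have gc: "graded_complex n F" and
    surj: "aug_map F ` free_mod n (rk F 0) = I" and
    ex0: "{v \<in> free_mod n (rk F 0). aug_map F v = 0} = diff_map F 0 ` free_mod n (rk F 1)" and
    ex: "\<And>a. {v \<in> free_mod n (rk F (Suc a)). diff_map F a v = (\<lambda>_. 0)} =
         diff_map F (Suc a) ` free_mod n (rk F (Suc (Suc a)))" and
    min: "\<And>a i l. i < rk F (Suc a) \<Longrightarrow> l < rk F a \<Longrightarrow> dmat F a i l \<in> irrelevant_ideal n"
    using F by (auto simp: minimal_graded_free_resolution_def graded_free_resolution_def)
  have diff_F: "cmap (rk F k) (rk F (Suc k)) (dmat F k) = diff_map F k" for k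
    by (simp add: diff_map_def cmap_def fun_eq_iff)
  have aug_F: "cmap 1 (rk F 0) (\<lambda>i _. aug F i) v = (\<lambda>l. if l = 0 then aug_map F v else 0)" for v
    by (simp add: aug_map_def cmap_def fun_eq_iff)
  have im: "cmap (rr 0) (rr (Suc 0)) (gg 0) ` free_mod n (rr (Suc 0)) = as_submodule n I"
  proof (intro equalityI subsetI)
    fix w assume "w \<in> cmap (rr 0) (rr (Suc 0)) (gg 0) ` free_mod n (rr (Suc 0))"
    then obtain v where v: "v \<in> free_mod n (rk F 0)" "w = (\<lambda>l. if l = 0 then aug_map F v else 0)"
      by (auto simp: rr_def gg_def aug_F)
    then have "aug_map F v \<in> I"
      using surj by blast
    with v I show "w \<in> as_submodule n I"
      by (auto simp: as_submodule_def free_mod_def)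
  next
    fix w assume w: "w \<in> as_submodule n I"
    then obtain v where v: "v \<in> free_mod n (rk F 0)" "w 0 = aug_map F v"
      using surj by (auto simp: as_submodule_def)
    have "w = cmap 1 (rk F 0) (\<lambda>i _. aug F i) v"
      using w v(2) by (auto simp: aug_F fun_eq_iff as_submodule_def free_mod_def)
    with v(1) show "w \<in> cmap (rr 0) (rr (Suc 0)) (gg 0) ` free_mod n (rr (Suc 0))"
      by (auto simp: rr_def gg_def)
  qed
  have "koszul_acyclic n (rr 0) (tt 0) a b (cmap (rr 0) (rr (Suc 0)) (gg 0) ` free_mod n (rr (Suc 0))) \<longleftrightarrow>
    (\<forall>l<rr (Suc (0 + a)). tt (Suc (0 + a)) l \<noteq> b)"
  proof (rule koszul_acyclic_iff_twists)
    show "graded_map n (rr k) (tt k) (rr (Suc k)) (tt (Suc k)) (gg k)" for k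
      using gc by (cases k) (auto simp: graded_map_def graded_complex_def rr_def tt_def gg_def)
    show "cker n (rr k) (rr (Suc k)) (gg k) =
        cmap (rr (Suc k)) (rr (Suc (Suc k))) (gg (Suc k)) ` free_mod n (rr (Suc (Suc k)))" for k
    proof (cases k)
      case 0
      have "cker n 1 (rk F 0) (\<lambda>i _. aug F i) = {v \<in> free_mod n (rk F 0). aug_map F v = 0}"
        by (auto simp: cker_def aug_F fun_eq_iff)
      with 0 ex0 show ?thesis
        by (simp add: rr_def gg_def diff_F One_nat_def)
    next
      case (Suc m)
      with ex[of m] show ?thesis
        by (simp add: rr_def gg_def diff_F cker_def)
    qed
    show "lookup (gg (Suc k) i l) 0 = 0" if "i < rr (Suc (Suc k))" "l < rr (Suc k)" for k i l
      using min[of i k l] that by (simp add: rr_def gg_def irrelevant_ideal_iff)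
  qed
  then show ?thesis
    unfolding im by (simp add: rr_def tt_def)
qed

text \<open>Existence makes the chosen resolution minimal, and the Koszul criterion on the right
  does not mention the resolution, so the choice is immaterial.\<close>

lemma graded_betti_nonzero_iff:
  fixes I :: "'k::field mpoly set"
  assumes I: "I \<subseteq> polys n" and reg: "regular_bound n 1 (\<lambda>_. 0) (as_submodule n I)"
  shows "graded_betti n I a b \<noteq> 0 \<longleftrightarrow> \<not> koszul_acyclic n 1 (\<lambda>_. 0) a b (as_submodule n I)"
proof -
  define F where "F = (SOME F. minimal_graded_free_resolution n I F)"
  have "\<exists>F. minimal_graded_free_resolution n I F"
    using minimal_resolution_exists[OF I reg] by blast
  then have F: "minimal_graded_free_resolution n I F"
    unfolding F_def by (rule someI_ex)
  have "graded_betti n I a b = card {i. i < rk F a \<and> twist F a i = b}"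
    unfolding graded_betti_def F_def Let_def by (rule refl)
  then show ?thesis
    unfolding koszul_acyclic_iff_resolution[OF I F] by auto
qed

section \<open>Koszul homology of edge ideals\<close>

text \<open>For a graph, \<open>edgy E (keys u)\<close> says that the monomial u lies in the edge
  ideal; the remaining vertex sets are the cliques of the complement.\<close>

definition edgy :: "nat set set \<Rightarrow> nat set \<Rightarrow> bool"
  where "edgy E S \<longleftrightarrow> (\<exists>p\<in>S. \<exists>q\<in>S. {p, q} \<in> E)"

definition graph_on :: "nat \<Rightarrow> nat set set \<Rightarrow> bool"
  where "graph_on n E \<longleftrightarrow> (\<forall>p q. {p, q} \<in> E \<longrightarrow> p \<noteq> q \<and> p \<in> {1..n} \<and> q \<in> {1..n})"

lemma edgy_mono: "edgy E S \<Longrightarrow> S \<subseteq> T \<Longrightarrow> edgy E T"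
  unfolding edgy_def by blast

lemma edgy_mon_degree:
  assumes E: "graph_on n E" and u: "edgy E (keys u)"
  shows "mon_degree u \<ge> 2"
proof -
  obtain p q where pq: "p \<in> keys u" "q \<in> keys u" "p \<noteq> q"
    using u E unfolding edgy_def graph_on_def by metis
  then have "lookup u p \<ge> 1" "lookup u q \<ge> 1"
    by (auto simp: in_keys_iff One_nat_def Suc_le_eq)
  moreover have "(\<Sum>i\<in>{p, q}. lookup u i) \<le> mon_degree u"
    unfolding mon_degree_def using pq by (intro sum_mono2) auto
  ultimately show ?thesis
    using pq by simp
qed

lemma edge_ideal_iff:
  fixes x :: "'k::field mpoly"
  assumes E: "graph_on n E"
  shows "x \<in> edge_ideal n E \<longleftrightarrow> x \<in> polys n \<and> (\<forall>u\<in>keys x. edgy E (keys u))"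
proof -
  define U where "U = {single p (1::nat) + single q 1 | p q. {p, q} \<in> E}"
  have eq: "{var p * var q | p q. {p, q} \<in> E} = (\<lambda>u. single u (1::'k)) ` U"
  proof -
    have "var p * var q = single (single p 1 + single q 1) (1::'k)" for p q
      by (simp add: var_def mult_single)
    then show ?thesis
      unfolding U_def by (auto simp: image_def)
  qed
  have U: "keys u \<subseteq> {1..n}" if "u \<in> U" for u
    using that E by (auto simp: U_def keys_add_nat graph_on_def)
  have "(\<exists>u\<in>U. \<exists>w'. w = u + w') \<longleftrightarrow> edgy E (keys w)" for w
  proof
    assume "\<exists>u\<in>U. \<exists>w'. w = u + w'"
    then obtain p q w' where "w = (single p 1 + single q 1) + w'" "{p, q} \<in> E"
      by (auto simp: U_def)
    then have "p \<in> keys w" "q \<in> keys w"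
      by (simp_all add: keys_add_nat)
    with \<open>{p, q} \<in> E\<close> show "edgy E (keys w)"
      unfolding edgy_def by blast
  next
    assume "edgy E (keys w)"
    then obtain p q where pq: "p \<in> keys w" "q \<in> keys w" "{p, q} \<in> E"
      unfolding edgy_def by blast
    \<comment> \<open>Distinctness matters: the two truncated subtractions are then undone even
      where multiplicities are one.\<close>
    then have "p \<noteq> q"
      using E unfolding graph_on_def by blast
    then have "w - single p 1 - single q 1 + single q 1 + single p 1 = w"
      using pq by (intro poly_mapping_eqI)
        (auto simp: lookup_add lookup_minus lookup_single when_def in_keys_iff One_nat_def)
    then have "w = (single p 1 + single q 1) + (w - single p 1 - single q 1)"
      by (simp add: ac_simps)
    moreover have "single p 1 + single q 1 \<in> U"
      using pq by (auto simp: U_def)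
    ultimately show "\<exists>u\<in>U. \<exists>w'. w = u + w'"
      by (intro bexI[of _ "single p 1 + single q 1"] exI)
  qed
  moreover have "x \<in> ideal_gen n ((\<lambda>u. single u 1) ` U) \<longleftrightarrow>
      x \<in> polys n \<and> (\<forall>w\<in>keys x. \<exists>u\<in>U. \<exists>w'. w = u + w')"
    by (rule ideal_gen_monomials) (rule U)
  ultimately show ?thesis
    unfolding edge_ideal_def eq by simp
qed

lemma gsubmod_edge_ideal:
  fixes E :: "nat set set"
  assumes E: "graph_on n E"
  shows "gsubmod n 1 (\<lambda>_. 0) (as_submodule n (edge_ideal n E :: 'k::field mpoly set))"
  unfolding gsubmod_def
proof (intro conjI ballI allI)
  let ?N = "as_submodule n (edge_ideal n E :: 'k mpoly set)"
  have N: "v \<in> ?N \<longleftrightarrow> v \<in> free_mod n 1 \<and> (\<forall>u\<in>keys (v 0). edgy E (keys u))" for v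
    by (auto simp: as_submodule_def edge_ideal_iff[OF E] free_mod_def)
  show "?N \<subseteq> free_mod n 1" "(\<lambda>_. 0) \<in> ?N"
    by (auto simp: N free_mod_def)
  fix v assume v: "v \<in> ?N"
  show "(\<lambda>i. v i + w i) \<in> ?N" if w: "w \<in> ?N" for w
  proof -
    have "edgy E (keys u)" if "u \<in> keys (v 0 + w 0)" for u
      using keys_add[of "v 0" "w 0"] that v w by (auto simp: N)
    then show ?thesis
      using v w by (auto simp: N free_mod_def polys_add)
  qed
  show "(\<lambda>i. p * v i) \<in> ?N" if p: "p \<in> polys n" for p
  proof -
    have "edgy E (keys u)" if u: "u \<in> keys (p * v 0)" for u
    proof -
      obtain a b where "u = a + b" "b \<in> keys (v 0)"
        using keys_mult[of p "v 0"] u by blast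
      with v show ?thesis
        using edgy_mono[of E "keys b" "keys u"] by (auto simp: N keys_add_nat)
    qed
    then show ?thesis
      using v p by (auto simp: N free_mod_def polys_mult)
  qed
  show "(\<lambda>i. hcomp (e - 0) (v i)) \<in> ?N" for e
    using v by (auto simp: N free_mod_def hcomp_polys keys_hcomp)
qed

lemma edge_koszul_acyclicI:
  fixes E :: "nat set set"
  assumes E: "graph_on n E"
    and fill: "\<And>m \<phi> :: nat set \<Rightarrow> 'k::field. \<lbrakk>keys m \<subseteq> {1..n}; int (mon_degree m) = b;
        \<And>\<sigma>. \<phi> \<sigma> \<noteq> 0 \<Longrightarrow> \<sigma> \<subseteq> keys m \<and> card \<sigma> = i \<and> edgy E (keys (m - ind \<sigma>));
        \<And>\<tau>. \<tau> \<subseteq> keys m \<Longrightarrow> kbd (keys m) (\<lambda>_. 1) \<phi> \<tau> = 0\<rbrakk> \<Longrightarrow>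
      \<exists>\<psi>. (\<forall>\<sigma>. \<psi> \<sigma> \<noteq> 0 \<longrightarrow> \<sigma> \<subseteq> keys m \<and> card \<sigma> = Suc i \<and> edgy E (keys (m - ind \<sigma>))) \<and>
        (\<forall>\<tau>. \<tau> \<subseteq> keys m \<longrightarrow> kbd (keys m) (\<lambda>_. 1) \<psi> \<tau> = \<phi> \<tau>)"
  shows "koszul_acyclic n 1 (\<lambda>_. 0) i b (as_submodule n (edge_ideal n E :: 'k mpoly set))"
  unfolding koszul_acyclic_def
proof (intro allI impI, elim conjE)
  let ?N = "as_submodule n (edge_ideal n E :: 'k mpoly set)"
  fix c assume c: "kchain n 1 (\<lambda>_. 0) i b c" "range c \<subseteq> ?N" "kdiff n c = (\<lambda>_ _. 0)"
  have c0: "c \<sigma> 0 \<in> edge_ideal n E" for \<sigma>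
    using c(2) by (auto simp: as_submodule_def)
  obtain e where e: "scalar_chain n (Suc i) b e" "\<And>\<sigma> u. u \<in> keys (e \<sigma>) \<Longrightarrow> edgy E (keys u)"
    "\<And>\<tau>. kbd {1..n} var e \<tau> = c \<tau> 0"
  proof (rule fill_by_multidegrees[of n i b "\<lambda>\<sigma>. c \<sigma> 0" "\<lambda>u. edgy E (keys u)" "\<lambda>u. edgy E (keys u)"])
    show "scalar_chain n i b (\<lambda>\<sigma>. c \<sigma> 0)"
      using c(1) by (simp add: kchain_def)
    show "edgy E (keys u)" if "u \<in> keys (c \<sigma> 0)" for \<sigma> u
      using c0[of \<sigma>] that by (simp add: edge_ideal_iff[OF E])
    show "kbd {1..n} var (\<lambda>\<sigma>. c \<sigma> 0) \<tau> = 0" for \<tau>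
      using fun_cong[OF fun_cong[OF c(3), of \<tau>], of 0] by (simp add: kdiff_def)
  qed (rule fill, assumption+, rule that)
  have "kchain n 1 (\<lambda>_. 0) (Suc i) b (\<lambda>\<sigma> l. if l = 0 then e \<sigma> else 0)"
    using e(1) by (simp add: kchain_def)
  moreover have "range (\<lambda>\<sigma> l. if l = 0 then e \<sigma> else 0) \<subseteq> ?N"
    using e(1,2) by (auto simp: as_submodule_def free_mod_def edge_ideal_iff[OF E] scalar_chain_def)
  moreover have "kdiff n (\<lambda>\<sigma> l. if l = 0 then e \<sigma> else 0) = c"
  proof (intro ext)
    fix \<tau> l
    show "kdiff n (\<lambda>\<sigma> l. if l = 0 then e \<sigma> else 0) \<tau> l = c \<tau> l"
      using c(1) e(3) by (cases "l = 0") (simp_all add: kdiff_def kchain_def One_nat_def)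
  qed
  ultimately show "\<exists>e. kchain n 1 (\<lambda>_. 0) (Suc i) b e \<and> range e \<subseteq> ?N \<and> kdiff n e = c"
    by (intro exI conjI)
qed

text \<open>The ideal starts in degree 2, whereas coefficients would have degree
  \<open>b - i < 2\<close>; there are no nonzero chains.\<close>

lemma edge_koszul_acyclic_low:
  fixes E :: "nat set set"
  assumes E: "graph_on n E" and b: "b < int i + 2"
  shows "koszul_acyclic n 1 (\<lambda>_. 0) i b (as_submodule n (edge_ideal n E :: 'k::field mpoly set))"
proof (rule edge_koszul_acyclicI[OF E])
  fix m and \<phi> :: "nat set \<Rightarrow> 'k"
  assume m: "int (mon_degree m) = b"
    and \<phi>: "\<And>\<sigma>. \<phi> \<sigma> \<noteq> 0 \<Longrightarrow> \<sigma> \<subseteq> keys m \<and> card \<sigma> = i \<and> edgy E (keys (m - ind \<sigma>))"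
  have "\<phi> \<sigma> = 0" for \<sigma>
  proof (rule ccontr)
    assume "\<phi> \<sigma> \<noteq> 0"
    then have \<sigma>: "\<sigma> \<subseteq> keys m" "card \<sigma> = i" "edgy E (keys (m - ind \<sigma>))"
      using \<phi> by auto
    then have fin: "finite \<sigma>"
      using finite_subset[of \<sigma> "keys m"] by simp
    have "mon_degree (m - ind \<sigma> + ind \<sigma>) = mon_degree (m - ind \<sigma>) + i"
      using fin \<sigma>(2) by (simp add: mon_degree_add)
    then have "mon_degree m = mon_degree (m - ind \<sigma>) + i"
      using diff_ind_add[OF fin \<sigma>(1)] by simp
    then show False
      using edgy_mon_degree[OF E \<sigma>(3)] m b by simp
  qed
  then show "\<exists>\<psi>. (\<forall>\<sigma>. \<psi> \<sigma> \<noteq> 0 \<longrightarrow> \<sigma> \<subseteq> keys m \<and> card \<sigma> = Suc i \<and> edgy E (keys (m - ind \<sigma>))) \<and>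
        (\<forall>\<tau>. \<tau> \<subseteq> keys m \<longrightarrow> kbd (keys m) (\<lambda>_. 1) \<psi> \<tau> = \<phi> \<tau>)"
    by (intro exI[of _ "\<lambda>_. 0"]) simp
qed

section \<open>Vanishing of Koszul homology through cones\<close>

lemma kcone_support:
  assumes \<phi>: "\<And>\<sigma>. \<phi> \<sigma> \<noteq> 0 \<Longrightarrow> \<sigma> \<subseteq> W \<and> card \<sigma> = i" and v: "v \<in> W" and W: "finite W"
    and \<sigma>: "kcone v \<phi> \<sigma> \<noteq> 0"
  shows "v \<in> \<sigma>" "\<phi> (\<sigma> - {v}) \<noteq> 0" "\<sigma> \<subseteq> W" "card \<sigma> = Suc i"
proof -
  from \<sigma> show *: "v \<in> \<sigma>" "\<phi> (\<sigma> - {v}) \<noteq> 0"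
    by (auto simp: kcone_def split: if_splits)
  with \<phi>[of "\<sigma> - {v}"] v show "\<sigma> \<subseteq> W"
    by auto
  then have "finite \<sigma>"
    using W finite_subset by auto
  then show "card \<sigma> = Suc i"
    using * \<phi>[of "\<sigma> - {v}"] card_Suc_Diff1[of \<sigma> v] by simp
qed

lemma kcone_fill:
  assumes "finite W" "v \<in> W" and cyc: "\<And>\<tau>. \<tau> \<subseteq> W \<Longrightarrow> kbd W (\<lambda>_. 1) \<phi> \<tau> = 0" and "\<tau> \<subseteq> W"
  shows "kbd W (\<lambda>_. 1) (kcone v \<phi>) \<tau> = \<phi> \<tau>"
proof -
  have "kbd W (\<lambda>_. 1) \<phi> (\<tau> - {v}) = 0"
    using assms(4) by (intro cyc) auto
  then have "kcone v (kbd W (\<lambda>_. 1) \<phi>) \<tau> = 0"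
    by (simp add: kcone_def)
  then show ?thesis
    using kcone_homotopy[OF assms(1,2), of \<phi> \<tau>] by simp
qed

text \<open>Coning with a variable of multiplicity at least two does not change supports, so only
  squarefree multidegrees \<open>W\<close> remain.\<close>

lemma edge_koszul_acyclic_squarefreeI:
  fixes E :: "nat set set"
  assumes E: "graph_on n E"
    and fill: "\<And>W \<phi> :: nat set \<Rightarrow> 'k::field. \<lbrakk>W \<subseteq> {1..n}; int (card W) = b;
        \<And>\<sigma>. \<phi> \<sigma> \<noteq> 0 \<Longrightarrow> \<sigma> \<subseteq> W \<and> card \<sigma> = i \<and> edgy E (W - \<sigma>);
        \<And>\<tau>. \<tau> \<subseteq> W \<Longrightarrow> kbd W (\<lambda>_. 1) \<phi> \<tau> = 0\<rbrakk> \<Longrightarrow>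
      \<exists>\<psi>. (\<forall>\<sigma>. \<psi> \<sigma> \<noteq> 0 \<longrightarrow> \<sigma> \<subseteq> W \<and> card \<sigma> = Suc i \<and> edgy E (W - \<sigma>)) \<and>
        (\<forall>\<tau>. \<tau> \<subseteq> W \<longrightarrow> kbd W (\<lambda>_. 1) \<psi> \<tau> = \<phi> \<tau>)"
  shows "koszul_acyclic n 1 (\<lambda>_. 0) i b (as_submodule n (edge_ideal n E :: 'k mpoly set))"
proof (rule edge_koszul_acyclicI[OF E])
  fix m and \<phi> :: "nat set \<Rightarrow> 'k"
  assume m: "keys m \<subseteq> {1..n}" "int (mon_degree m) = b"
    and \<phi>: "\<And>\<sigma>. \<phi> \<sigma> \<noteq> 0 \<Longrightarrow> \<sigma> \<subseteq> keys m \<and> card \<sigma> = i \<and> edgy E (keys (m - ind \<sigma>))"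
    and cyc: "\<And>\<tau>. \<tau> \<subseteq> keys m \<Longrightarrow> kbd (keys m) (\<lambda>_. 1) \<phi> \<tau> = 0"
  have fin: "finite \<sigma>" if "\<sigma> \<subseteq> keys m" for \<sigma>
    using that by (rule finite_subset) simp
  have keys_diff: "keys (m - ind \<sigma>) = {k \<in> keys m. k \<in> \<sigma> \<longrightarrow> lookup m k \<ge> 2}" if "\<sigma> \<subseteq> keys m" for \<sigma>
    using fin[OF that] by (auto simp: in_keys_iff lookup_minus lookup_ind split: if_splits)
  show "\<exists>\<psi>. (\<forall>\<sigma>. \<psi> \<sigma> \<noteq> 0 \<longrightarrow> \<sigma> \<subseteq> keys m \<and> card \<sigma> = Suc i \<and> edgy E (keys (m - ind \<sigma>))) \<and>
        (\<forall>\<tau>. \<tau> \<subseteq> keys m \<longrightarrow> kbd (keys m) (\<lambda>_. 1) \<psi> \<tau> = \<phi> \<tau>)"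
  proof (cases "\<exists>v\<in>keys m. lookup m v \<ge> 2")
    case True
    then obtain v where v: "v \<in> keys m" "lookup m v \<ge> 2"
      by blast
    have "\<sigma> \<subseteq> keys m \<and> card \<sigma> = Suc i \<and> edgy E (keys (m - ind \<sigma>))" if "kcone v \<phi> \<sigma> \<noteq> 0" for \<sigma>
    proof -
      have \<sigma>: "v \<in> \<sigma>" "\<phi> (\<sigma> - {v}) \<noteq> 0" "\<sigma> \<subseteq> keys m" "card \<sigma> = Suc i"
        using kcone_support[OF _ v(1) finite_keys that, of i] \<phi> by auto
      have "keys (m - ind (\<sigma> - {v})) = keys (m - ind \<sigma>)"
        using \<sigma>(3) v by (subst (1 2) keys_diff) auto
      with \<phi>[OF \<sigma>(2)] \<sigma> show ?thesis
        by simp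
    qed
    moreover have "kbd (keys m) (\<lambda>_. 1) (kcone v \<phi>) \<tau> = \<phi> \<tau>" if "\<tau> \<subseteq> keys m" for \<tau>
      using kcone_fill[OF finite_keys v(1) cyc that] .
    ultimately show ?thesis
      by (intro exI[of _ "kcone v \<phi>"]) simp
  next
    case False
    then have keys_diff': "keys (m - ind \<sigma>) = keys m - \<sigma>" if "\<sigma> \<subseteq> keys m" for \<sigma>
      using keys_diff[OF that] by auto
    have "lookup m k = 1" if "k \<in> keys m" for k
    proof -
      have "lookup m k \<noteq> 0" "\<not> 2 \<le> lookup m k"
        using False that by (auto simp: in_keys_iff)
      then show ?thesis
        by linarith
    qed
    then have "mon_degree m = card (keys m)"
      by (simp add: mon_degree_def)
    moreover have "\<sigma> \<subseteq> keys m \<and> card \<sigma> = i \<and> edgy E (keys m - \<sigma>)" if "\<phi> \<sigma> \<noteq> 0" for \<sigma>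
      using \<phi>[OF that] keys_diff'[of \<sigma>] by auto
    ultimately have "\<exists>\<psi>. (\<forall>\<sigma>. \<psi> \<sigma> \<noteq> 0 \<longrightarrow> \<sigma> \<subseteq> keys m \<and> card \<sigma> = Suc i \<and> edgy E (keys m - \<sigma>)) \<and>
        (\<forall>\<tau>. \<tau> \<subseteq> keys m \<longrightarrow> kbd (keys m) (\<lambda>_. 1) \<psi> \<tau> = \<phi> \<tau>)"
      using m cyc by (intro fill[of "keys m" \<phi>]) simp_all
    moreover have "\<sigma> \<subseteq> keys m \<and> card \<sigma> = Suc i \<and> edgy E (keys m - \<sigma>) \<longleftrightarrow>
        \<sigma> \<subseteq> keys m \<and> card \<sigma> = Suc i \<and> edgy E (keys (m - ind \<sigma>))" for \<sigma>
      using keys_diff'[of \<sigma>] by auto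
    ultimately show ?thesis
      by simp
  qed
qed

text \<open>A cone with any apex is supported on faces whose complement has
  \<open>b - i - 1 \<ge> 3\<close> vertices and hence contains an edge. Topologically, the clique
  complex has dimension at most one.\<close>

lemma edge_koszul_acyclic_no_triple:
  fixes E :: "nat set set"
  assumes E: "graph_on n E" and triple: "\<And>S. S \<subseteq> {1..n} \<Longrightarrow> card S = 3 \<Longrightarrow> edgy E S"
    and b: "b \<ge> int i + 4"
  shows "koszul_acyclic n 1 (\<lambda>_. 0) i b (as_submodule n (edge_ideal n E :: 'k::field mpoly set))"
proof (rule edge_koszul_acyclic_squarefreeI[OF E])
  fix W and \<phi> :: "nat set \<Rightarrow> 'k"
  assume W: "W \<subseteq> {1..n}" "int (card W) = b"
    and \<phi>: "\<And>\<sigma>. \<phi> \<sigma> \<noteq> 0 \<Longrightarrow> \<sigma> \<subseteq> W \<and> card \<sigma> = i \<and> edgy E (W - \<sigma>)"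
    and cyc: "\<And>\<tau>. \<tau> \<subseteq> W \<Longrightarrow> kbd W (\<lambda>_. 1) \<phi> \<tau> = 0"
  have fin: "finite W"
    using W(1) by (rule finite_subset) simp
  have "W \<noteq> {}"
    using W(2) b by auto
  then obtain v where v: "v \<in> W"
    by blast
  have "\<sigma> \<subseteq> W \<and> card \<sigma> = Suc i \<and> edgy E (W - \<sigma>)" if "kcone v \<phi> \<sigma> \<noteq> 0" for \<sigma>
  proof -
    have \<sigma>: "\<sigma> \<subseteq> W" "card \<sigma> = Suc i"
      using kcone_support[OF _ v(1) fin that, of i] \<phi> by auto
    then have "card (W - \<sigma>) \<ge> 3"
      using W(2) b fin by (simp add: card_Diff_subset finite_subset)
    then obtain S where S: "S \<subseteq> W - \<sigma>" "card S = 3"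
      by (metis obtain_subset_with_card_n)
    then have "edgy E S"
      using W(1) by (intro triple) auto
    with S \<sigma> show ?thesis
      using edgy_mono by blast
  qed
  moreover have "kbd W (\<lambda>_. 1) (kcone v \<phi>) \<tau> = \<phi> \<tau>" if "\<tau> \<subseteq> W" for \<tau>
    using kcone_fill[OF fin v cyc that] .
  ultimately show "\<exists>\<psi>. (\<forall>\<sigma>. \<psi> \<sigma> \<noteq> 0 \<longrightarrow> \<sigma> \<subseteq> W \<and> card \<sigma> = Suc i \<and> edgy E (W - \<sigma>)) \<and>
      (\<forall>\<tau>. \<tau> \<subseteq> W \<longrightarrow> kbd W (\<lambda>_. 1) \<psi> \<tau> = \<phi> \<tau>)"
    by (intro exI[of _ "kcone v \<phi>"]) simp
qed

text \<open>Nonadjacency is an equivalence relation, so the clique complex of the complement is a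
  disjoint union of simplices. Its reduced cohomology lives in degree 0, which is
  \<open>b - i = 2\<close>.\<close>

lemma edge_koszul_acyclic_multipartite:
  fixes E :: "nat set set"
  assumes E: "graph_on n E"
    and trans: "\<And>p q r. \<lbrakk>p \<in> {1..n}; q \<in> {1..n}; r \<in> {1..n}; {p, q} \<notin> E; {q, r} \<notin> E\<rbrakk> \<Longrightarrow> {p, r} \<notin> E"
    and b: "b \<ge> int i + 3"
  shows "koszul_acyclic n 1 (\<lambda>_. 0) i b (as_submodule n (edge_ideal n E :: 'k::field mpoly set))"
proof (rule edge_koszul_acyclic_squarefreeI[OF E])
  fix W and \<phi> :: "nat set \<Rightarrow> 'k"
  assume W: "W \<subseteq> {1..n}" "int (card W) = b"
    and \<phi>: "\<And>\<sigma>. \<phi> \<sigma> \<noteq> 0 \<Longrightarrow> \<sigma> \<subseteq> W \<and> card \<sigma> = i \<and> edgy E (W - \<sigma>)"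
    and cyc: "\<And>\<tau>. \<tau> \<subseteq> W \<Longrightarrow> kbd W (\<lambda>_. 1) \<phi> \<tau> = 0"
  have fin: "finite W"
    using W(1) by (rule finite_subset) simp
  have "W \<noteq> {}"
    using W(2) b by auto
  then obtain v where v: "v \<in> W"
    by blast
  define \<psi>0 where "\<psi>0 = kcone v \<phi>"
  have \<psi>0: "\<sigma> \<subseteq> W \<and> card \<sigma> = Suc i" if "\<psi>0 \<sigma> \<noteq> 0" for \<sigma>
    using kcone_support[OF _ v(1) fin, of \<phi> i \<sigma>] \<phi> that by (auto simp: \<psi>0_def)
  have d\<psi>0: "kbd W (\<lambda>_. 1) \<psi>0 \<tau> = \<phi> \<tau>" if "\<tau> \<subseteq> W" for \<tau>
    unfolding \<psi>0_def using kcone_fill[OF fin v cyc that] .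
  \<comment> \<open>The filling \<open>\<psi>0\<close> is corrected on the faces whose complement lies in one class by coning each
    class with its least element.\<close>
  define A where "A S = {w \<in> W. \<forall>p\<in>S. {w, p} \<notin> E}" for S
  \<comment> \<open>A nonempty set without edges determines its class, so its nonempty subsets get
    the same apex.\<close>
  have A_cong: "A T = A S" if S: "S \<subseteq> W" "\<not> edgy E S" and T: "T \<subseteq> S" "T \<noteq> {}" for S T
  proof -
    obtain t where t: "t \<in> T"
      using T by blast
    have "{w, p} \<notin> E" if w: "w \<in> A T" and p: "p \<in> S" for w p
    proof (rule trans)
      have "w \<in> W" "t \<in> W" "p \<in> W"
        using w t p S T by (auto simp: A_def)
      then show "w \<in> {1..n}" "t \<in> {1..n}" "p \<in> {1..n}"
        using W(1) by blast+
      show "{w, t} \<notin> E" "{t, p} \<notin> E"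
        using w t p S T by (auto simp: A_def edgy_def)
    qed
    then show ?thesis
      using T by (auto simp: A_def)
  qed
  \<comment> \<open>The face W is left out, as its empty complement determines no class.\<close>
  define \<eta> where "\<eta> \<sigma> = (if \<sigma> \<subset> W \<and> \<not> edgy E (W - \<sigma>) then kcone (Min (A (W - \<sigma>))) \<psi>0 \<sigma> else 0)" for \<sigma>
  have apex: "Min (A S) \<in> A S" if "S \<subseteq> W" "S \<noteq> {}" "\<not> edgy E S" for S
  proof (rule Min_in)
    show "finite (A S)"
      using fin by (simp add: A_def)
    show "A S \<noteq> {}"
      using that by (auto simp: A_def edgy_def)
  qed
  have \<eta>: "\<sigma> \<subseteq> W \<and> card \<sigma> = Suc (Suc i)" if "\<eta> \<sigma> \<noteq> 0" for \<sigma>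
  proof -
    from that have *: "\<sigma> \<subset> W" "\<not> edgy E (W - \<sigma>)" "kcone (Min (A (W - \<sigma>))) \<psi>0 \<sigma> \<noteq> 0"
      by (auto simp: \<eta>_def split: if_splits)
    then have "Min (A (W - \<sigma>)) \<in> W"
      using apex[of "W - \<sigma>"] by (auto simp: A_def)
    from kcone_support[OF \<psi>0 this fin *(3)] show ?thesis
      by simp
  qed
  define \<psi> where "\<psi> \<sigma> = \<psi>0 \<sigma> - kbd W (\<lambda>_. 1) \<eta> \<sigma>" for \<sigma>
  have supp: "\<sigma> \<subseteq> W \<and> card \<sigma> = Suc i" if "\<psi> \<sigma> \<noteq> 0" for \<sigma>
  proof (cases "\<psi>0 \<sigma> = 0")
    case True
    with that have "(\<Sum>j\<in>W - \<sigma>. ksign j \<sigma> * 1 * \<eta> (insert j \<sigma>)) \<noteq> 0"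
      by (simp add: \<psi>_def kbd_def)
    then obtain j where j: "j \<in> W - \<sigma>" "ksign j \<sigma> * 1 * \<eta> (insert j \<sigma>) \<noteq> 0"
      by (rule sum.not_neutral_contains_not_neutral)
    then have *: "insert j \<sigma> \<subseteq> W" "card (insert j \<sigma>) = Suc (Suc i)"
      using \<eta>[of "insert j \<sigma>"] by auto
    moreover have "finite \<sigma>"
      using *(1) fin finite_subset[of \<sigma> W] by auto
    ultimately show ?thesis
      using j by simp
  qed (use \<psi>0 in blast)
  have "edgy E (W - \<tau>)" if nz: "\<psi> \<tau> \<noteq> 0" for \<tau>
  proof (rule ccontr)
    assume ne: "\<not> edgy E (W - \<tau>)"
    have \<tau>: "\<tau> \<subseteq> W" "card \<tau> = Suc i"
      using supp[OF nz] by auto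
    \<comment> \<open>With two vertices in the complement, one removal still leaves a vertex that
      identifies the class.\<close>
    then have card2: "card (W - \<tau>) \<ge> 2"
      using W(2) b fin by (simp add: card_Diff_subset finite_subset)
    then have ne0: "W - \<tau> \<noteq> {}"
      by (metis card.empty not_numeral_le_zero)
    define a where "a = Min (A (W - \<tau>))"
    have a: "a \<in> W" "\<And>p. p \<in> W - \<tau> \<Longrightarrow> {a, p} \<notin> E"
      using apex[OF _ ne0 ne] by (auto simp: a_def A_def)
    have "kbd W (\<lambda>_. 1) \<eta> \<tau> = kbd W (\<lambda>_. 1) (kcone a \<psi>0) \<tau>"
    proof (rule kbd_cong)
      fix j assume j: "j \<in> W - \<tau>"
      have eq: "W - insert j \<tau> = (W - \<tau>) - {j}"
        by auto
      have "card ((W - \<tau>) - {j}) \<noteq> 0"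
        using j card2 fin by (simp add: card_Diff_singleton)
      then have "(W - \<tau>) - {j} \<noteq> {}"
        by (metis card.empty)
      then have "A (W - insert j \<tau>) = A (W - \<tau>)"
        unfolding eq by (intro A_cong[OF _ ne]) auto
      moreover have "insert j \<tau> \<subset> W"
        using \<open>(W - \<tau>) - {j} \<noteq> {}\<close> \<tau> j by auto
      moreover have "\<not> edgy E (W - insert j \<tau>)"
        using ne edgy_mono[of E "W - insert j \<tau>" "W - \<tau>"] by auto
      ultimately show "\<eta> (insert j \<tau>) = kcone a \<psi>0 (insert j \<tau>)"
        by (simp add: \<eta>_def a_def)
    qed
    also have "\<dots> = \<psi>0 \<tau> - kcone a (kbd W (\<lambda>_. 1) \<psi>0) \<tau>"
      using kcone_homotopy[OF fin a(1), of \<psi>0 \<tau>] by (simp add: eq_diff_eq)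
    \<comment> \<open>The cone only sees \<open>\<phi>\<close> at \<open>\<tau> - {a}\<close>. The
      complement there is enlarged by a vertex of the same class, still has no edge, and so
      \<open>\<phi>\<close> vanishes.\<close>
    also have "kcone a (kbd W (\<lambda>_. 1) \<psi>0) \<tau> = 0"
    proof (cases "a \<in> \<tau>")
      case True
      have "{a, a} \<notin> E"
        using E unfolding graph_on_def by blast
      have "W - (\<tau> - {a}) = insert a (W - \<tau>)"
        using True a(1) by auto
      moreover have "\<not> edgy E (insert a (W - \<tau>))"
        using ne a(2) \<open>{a, a} \<notin> E\<close> by (auto simp: edgy_def insert_commute)
      ultimately have "\<phi> (\<tau> - {a}) = 0"
        using \<phi>[of "\<tau> - {a}"] by auto
      then show ?thesis
        using d\<psi>0[of "\<tau> - {a}"] \<tau> by (auto simp: kcone_def)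
    qed (simp add: kcone_def)
    finally show False
      using nz by (simp add: \<psi>_def)
  qed
  moreover have "kbd W (\<lambda>_. 1) \<psi> \<tau> = \<phi> \<tau>" if "\<tau> \<subseteq> W" for \<tau>
  proof -
    have "kbd W (\<lambda>_. 1) \<psi> \<tau> = kbd W (\<lambda>_. 1) \<psi>0 \<tau> - kbd W (\<lambda>_. 1) (kbd W (\<lambda>_. 1) \<eta>) \<tau>"
      unfolding \<psi>_def by (rule kbd_diff)
    then show ?thesis
      using d\<psi>0[OF that] kbd_kbd[OF fin, of "\<lambda>_. 1" \<eta> \<tau>] by simp
  qed
  ultimately show "\<exists>\<psi>. (\<forall>\<sigma>. \<psi> \<sigma> \<noteq> 0 \<longrightarrow> \<sigma> \<subseteq> W \<and> card \<sigma> = Suc i \<and> edgy E (W - \<sigma>)) \<and>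
      (\<forall>\<tau>. \<tau> \<subseteq> W \<longrightarrow> kbd W (\<lambda>_. 1) \<psi> \<tau> = \<phi> \<tau>)"
    using supp by (intro exI[of _ \<psi>]) simp
qed

text \<open>Passing to complements turns the boundary into a coboundary: up to sign, the value at
  the pair {x, y} is the difference of the vertex function
  \<open>ksign v W * \<eta> (W - {v})\<close>.\<close>

lemma kbd_codim_two:
  fixes \<eta> :: "nat set \<Rightarrow> 'a::comm_ring_1"
  assumes x: "x \<in> W" and y: "y \<in> W" and less: "y < x"
  shows "kbd W (\<lambda>_. 1) \<eta> (W - {x, y}) =
    ksign x W * ksign y W * (ksign x W * \<eta> (W - {x}) - ksign y W * \<eta> (W - {y}))"
proof -
  define \<rho> where "\<rho> = W - {x, y}"
  have \<rho>: "W = insert x (insert y \<rho>)" "x \<notin> \<rho>" "y \<notin> \<rho>" "x \<noteq> y"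
    using x y less by (auto simp: \<rho>_def)
  have sx: "ksign x W = (- ksign x \<rho> :: 'a)" and sy: "ksign y W = (ksign y \<rho> :: 'a)"
    using \<rho> less by (simp_all add: ksign_insert)
  have W: "W - \<rho> = {x, y}" "insert x \<rho> = W - {y}" "insert y \<rho> = W - {x}"
    using \<rho> by auto
  have "kbd W (\<lambda>_. 1) \<eta> \<rho> = ksign x \<rho> * \<eta> (W - {y}) + ksign y \<rho> * \<eta> (W - {x})"
    unfolding kbd_def W(1) using \<rho>(4) W by simp
  moreover have "ksign x \<rho> * (ksign y \<rho> * (ksign x \<rho> * a)) = ksign y \<rho> * a" for a :: 'a
    by (simp add: mult.left_commute[of "ksign y \<rho>"])
  ultimately show ?thesis
    unfolding \<rho>_def[symmetric] sx sy by (simp add: algebra_simps)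
qed

lemma kbd_codim_two_eq_0_iff:
  fixes \<eta> :: "nat set \<Rightarrow> 'a::field"
  assumes "x \<in> W" "y \<in> W" "x \<noteq> y"
  shows "kbd W (\<lambda>_. 1) \<eta> (W - {x, y}) = 0 \<longleftrightarrow>
    ksign x W * \<eta> (W - {x}) = ksign y W * \<eta> (W - {y})"
proof -
  have ks: "ksign z W \<noteq> (0 :: 'a)" for z
    by (simp add: ksign_def)
  show ?thesis
  proof (cases "y < x")
    case True
    then show ?thesis
      using kbd_codim_two[OF assms(1,2), of \<eta>] ks by simp
  next
    case False
    then have "x < y"
      using assms(3) by simp
    then show ?thesis
      using kbd_codim_two[OF assms(2,1), of \<eta>] ks by (auto simp: insert_commute)
  qed
qed

lemma keys_ksign_mult: "keys (ksign j \<tau> * p) \<subseteq> keys p" for p :: "'k::field mpoly"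
  by (auto simp: in_keys_iff lookup_ksign_mult)

text \<open>The boundary of the face of the missing edge \<open>{p 0, p (L - 1)}\<close> is a cycle in the edge ideal.
  A filling inside the ideal would differ from that face by a boundary, that is by the difference
  function of a function on the vertices; being constant along the path, it vanishes.\<close>

lemma edge_not_koszul_acyclic_cycle:
  fixes E :: "nat set set"
  assumes E: "graph_on n E" and triple: "\<And>S. S \<subseteq> {1..n} \<Longrightarrow> card S = 3 \<Longrightarrow> edgy E S"
    and inj: "inj_on p {..<L}" and range: "p ` {..<L} \<subseteq> {1..n}" and L: "L \<ge> 4"
    and path: "\<And>k. Suc k < L \<Longrightarrow> {p k, p (Suc k)} \<notin> E" and closing: "{p 0, p (L - 1)} \<notin> E"
  shows "\<not> koszul_acyclic n 1 (\<lambda>_. 0) (L - 3) (int L) (as_submodule n (edge_ideal n E :: 'k::field mpoly set))"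
proof
  let ?N = "as_submodule n (edge_ideal n E :: 'k mpoly set)"
  assume ac: "koszul_acyclic n 1 (\<lambda>_. 0) (L - 3) (int L) ?N"
  define W where "W = p ` {..<L}"
  have finW: "finite W" and cardW: "card W = L"
    using inj by (simp_all add: W_def card_image)
  define x y where "x = p 0" and "y = p (L - 1)"
  have xy: "x \<in> W" "y \<in> W" "x \<noteq> y"
    using L inj_on_eq_iff[OF inj, of 0 "L - 1"] by (auto simp: x_def y_def W_def)
  define m where "m = ind W"
  have keys_m: "keys m = W"
    using finW by (simp add: m_def)
  have m: "keys m \<subseteq> {1..n}"
    using range by (simp add: keys_m W_def)
  have m_diff: "m - ind (W - {a, b}) = ind {a, b}" if "a \<in> W" "b \<in> W" for a b
    using that finW by (intro poly_mapping_eqI) (auto simp: m_def lookup_minus lookup_ind)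
  \<comment> \<open>The face standing for the closing nonedge. It has L - 2 elements, so its
    boundary has homological degree L - 3.\<close>
  define \<sigma>0 where "\<sigma>0 = W - {x, y}"
  have card_\<sigma>0: "card \<sigma>0 = Suc (L - 3)"
    using xy finW cardW L by (simp add: \<sigma>0_def card_Diff_subset)
  define c0 where "c0 \<sigma> = (if \<sigma> = \<sigma>0 then single (ind {x, y}) 1 else 0 :: 'k mpoly)" for \<sigma>
  have c0: "scalar_chain n (Suc (L - 3)) (int L) c0"
    using card_\<sigma>0 range xy L
    by (auto simp: scalar_chain_def c0_def \<sigma>0_def W_def homogeneous_def polys_def)
  define c where "c = kbd {1..n} var c0"
  have c: "scalar_chain n (L - 3) (int L) c"
    unfolding c_def by (rule scalar_chain_kbd[OF c0])
  \<comment> \<open>Each monomial of the boundary is a product of three distinct variables, x, y and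
    a further vertex, so \<open>triple\<close> provides an edge.\<close>
  have c_edgy: "edgy E (keys u)" if u: "u \<in> keys (c \<tau>)" for u \<tau>
  proof -
    have "\<exists>j\<in>{1..n} - \<tau>. u \<in> keys (ksign j \<tau> * var j * c0 (insert j \<tau>))"
      using u keys_sum_subset[of "\<lambda>j. ksign j \<tau> * var j * c0 (insert j \<tau>)" "{1..n} - \<tau>"]
      unfolding c_def kbd_def by blast
    then obtain j where j: "j \<in> {1..n} - \<tau>" "u \<in> keys (var j * c0 (insert j \<tau>))"
      using keys_ksign_mult unfolding mult.assoc by blast
    then have "insert j \<tau> = \<sigma>0"
      by (auto simp: c0_def split: if_splits)
    with j have u_eq: "u = single j 1 + ind {x, y}" and "j \<in> \<sigma>0"
      by (auto simp: c0_def var_def mult_single)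
    then have "keys u = {j, x, y}" "j \<in> W" "j \<noteq> x" "j \<noteq> y"
      by (auto simp: keys_add_nat \<sigma>0_def)
    with xy range show ?thesis
      by (intro triple) (auto simp: W_def)
  qed
  define c' where "c' \<sigma> l = (if l = 0 then c \<sigma> else 0)" for \<sigma> and l :: nat
  have "kchain n 1 (\<lambda>_. 0) (L - 3) (int L) c'"
    using c by (simp add: kchain_def c'_def)
  moreover have "range c' \<subseteq> ?N"
    using c c_edgy
    by (auto simp: as_submodule_def free_mod_def edge_ideal_iff[OF E] scalar_chain_def c'_def)
  moreover have "kdiff n c' = (\<lambda>_ _. 0)"
  proof (intro ext)
    fix \<tau> l
    show "kdiff n c' \<tau> l = 0"
      by (cases "l = 0") (simp_all add: kdiff_def c'_def c_def kbd_kbd)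
  qed
  ultimately obtain e where e: "kchain n 1 (\<lambda>_. 0) (Suc (L - 3)) (int L) e" "range e \<subseteq> ?N" "kdiff n e = c'"
    using ac unfolding koszul_acyclic_def by blast
  have e_zero: "lookup (e \<sigma> 0) u = 0" if "\<not> edgy E (keys u)" for \<sigma> u
  proof -
    have "e \<sigma> 0 \<in> edge_ideal n E"
      using e(2) by (auto simp: as_submodule_def)
    with that show ?thesis
      by (auto simp: edge_ideal_iff[OF E] in_keys_iff)
  qed
  \<comment> \<open>The multidegree m part of the cycle \<open>e - c0\<close>; over the full simplex
    it is filled by a cone, which supplies the vertex function \<open>\<theta>\<close>.\<close>
  define \<chi> where "\<chi> = (\<lambda>\<sigma>. lookup (e \<sigma> 0 - c0 \<sigma>) (m - ind \<sigma>))"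
  have \<chi>: "kbd W (\<lambda>_. 1) \<chi> \<tau> = 0" if "\<tau> \<subseteq> W" for \<tau>
  proof -
    have "kbd {1..n} var (\<lambda>\<sigma>. e \<sigma> 0 - c0 \<sigma>) \<tau> = 0"
      using fun_cong[OF fun_cong[OF e(3), of \<tau>], of 0] by (simp add: kbd_diff kdiff_def c'_def c_def)
    then show ?thesis
      using kbd_multidegree[OF m, of \<tau> "\<lambda>\<sigma>. e \<sigma> 0 - c0 \<sigma>"] that by (simp add: keys_m \<chi>_def)
  qed
  define \<eta> where "\<eta> = kcone x \<chi>"
  have \<eta>: "kbd W (\<lambda>_. 1) \<eta> \<tau> = \<chi> \<tau>" if "\<tau> \<subseteq> W" for \<tau>
    unfolding \<eta>_def using kcone_fill[OF finW xy(1) \<chi> that] .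
  define \<theta> where "\<theta> v = ksign v W * \<eta> (W - {v})" for v
  have diff: "\<chi> (W - {a, b}) = 0 \<longleftrightarrow> \<theta> a = \<theta> b" if "a \<in> W" "b \<in> W" "a \<noteq> b" for a b
    using kbd_codim_two_eq_0_iff[OF that, of \<eta>] \<eta>[of "W - {a, b}"] by (auto simp: \<theta>_def)
  have nonedge: "\<not> edgy E (keys (ind {a, b}))" if "{a, b} \<notin> E" for a b
  proof -
    have "{v, v} \<notin> E" for v
      using E unfolding graph_on_def by blast
    from that this[of a] this[of b] show ?thesis
      by (auto simp: edgy_def insert_commute)
  qed
  have "\<theta> (p k) = \<theta> (p 0)" if "k < L" for k
    using that
  proof (induction k)
    case (Suc k)
    have pk: "p k \<in> W" "p (Suc k) \<in> W" "p k \<noteq> p (Suc k)"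
      using Suc.prems inj_on_eq_iff[OF inj, of k "Suc k"] by (auto simp: W_def)
    have "{p k, p (Suc k)} \<noteq> {x, y}"
    proof
      assume "{p k, p (Suc k)} = {x, y}"
      then have "p k = p 0 \<and> p (Suc k) = p (L - 1) \<or> p k = p (L - 1) \<and> p (Suc k) = p 0"
        by (auto simp: doubleton_eq_iff x_def y_def)
      then have "k = 0 \<and> Suc k = L - 1 \<or> k = L - 1 \<and> Suc k = 0"
        using Suc.prems L inj_on_eq_iff[OF inj] by auto
      then show False
        using L by auto
    qed
    then have "W - {p k, p (Suc k)} \<noteq> \<sigma>0"
      using pk xy unfolding \<sigma>0_def by blast
    \<comment> \<open>\<open>e\<close> has no monomial supported on a nonedge and \<open>c0\<close>
      lives on \<open>\<sigma>0\<close> alone, so \<open>\<theta>\<close> agrees at consecutive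
      vertices.\<close>
    then have "\<chi> (W - {p k, p (Suc k)}) = 0"
      using e_zero[OF nonedge[OF path[OF Suc.prems]]] pk
      by (simp add: \<chi>_def m_diff c0_def lookup_minus)
    then show ?case
      using diff[OF pk] Suc by simp
  qed simp
  from this[of "L - 1"] have "\<theta> x = \<theta> y"
    using L by (simp add: x_def y_def)
  then have "\<chi> \<sigma>0 = 0"
    using diff[OF xy] by (simp add: \<sigma>0_def)
  \<comment> \<open>The closing pair is a nonedge too, so \<open>e\<close> contributes nothing and
    only \<open>c0\<close> remains.\<close>
  moreover have "\<chi> \<sigma>0 = - 1"
    using e_zero[OF nonedge[of x y]] closing xy
    by (simp add: \<chi>_def \<sigma>0_def[symmetric] m_diff[OF xy(1,2), folded \<sigma>0_def] lookup_minus c0_def x_def y_def)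
  ultimately show False
    by simp
qed

text \<open>An edge monomial has degree 2, while a chain bounding it would need coefficients of
  degree 1, where the ideal is 0.\<close>

lemma edge_not_koszul_acyclic_0:
  fixes E :: "nat set set"
  assumes E: "graph_on n E" and pq: "{p, q} \<in> E"
  shows "\<not> koszul_acyclic n 1 (\<lambda>_. 0) 0 2 (as_submodule n (edge_ideal n E :: 'k::field mpoly set))"
proof
  let ?N = "as_submodule n (edge_ideal n E :: 'k mpoly set)"
  assume ac: "koszul_acyclic n 1 (\<lambda>_. 0) 0 2 ?N"
  have pq': "p \<noteq> q" "p \<in> {1..n}" "q \<in> {1..n}"
    using E pq unfolding graph_on_def by blast+
  define w where "w = (single (ind {p, q}) 1 :: 'k mpoly)"
  define c where "c \<sigma> l = (if \<sigma> = {} \<and> l = 0 then w else 0)" for \<sigma> :: "nat set" and l :: nat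
  have "keys w = {ind {p, q}}"
    by (simp add: w_def)
  then have w: "w \<in> edge_ideal n E" "homogeneous 2 w" "w \<in> polys n"
    using pq pq' by (auto simp: edge_ideal_iff[OF E] edgy_def homogeneous_def polys_def)
  have ch: "kchain n 1 (\<lambda>_. 0) 0 2 c"
    using w by (auto simp: kchain_def scalar_chain_def c_def One_nat_def)
  moreover have "range c \<subseteq> ?N"
    using w by (auto simp: as_submodule_def free_mod_def c_def edge_ideal_iff[OF E] One_nat_def split: if_splits)
  ultimately obtain e where e: "kchain n 1 (\<lambda>_. 0) (Suc 0) 2 e" "range e \<subseteq> ?N" "kdiff n e = c"
    using ac kdiff_zero_chain[OF ch] unfolding koszul_acyclic_def by blast
  have "e \<sigma> 0 = 0" for \<sigma>
  proof -
    have "e \<sigma> 0 \<in> edge_ideal n E"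
      using e(2) by (auto simp: as_submodule_def)
    moreover have "homogeneous 1 (e \<sigma> 0)"
      using e(1) by (simp add: kchain_def scalar_chain_def One_nat_def)
    ultimately have "keys (e \<sigma> 0) = {}"
      using edgy_mon_degree[OF E] by (fastforce simp: edge_ideal_iff[OF E] homogeneous_def)
    then show ?thesis
      by (simp add: keys_eq_empty)
  qed
  then have "kdiff n e {} 0 = 0"
    by (simp add: kdiff_def)
  then have "w = 0"
    by (simp add: e(3) c_def)
  then show False
    using \<open>keys w = {ind {p, q}}\<close> by simp
qed

section \<open>From Koszul homology to regularity\<close>

lemma regular_bound_edge_ideal:
  fixes E :: "nat set set"
  assumes E: "graph_on n E"
    and ac: "\<And>i b. b \<ge> int i + 4 \<Longrightarrow>
      koszul_acyclic n 1 (\<lambda>_. 0) i b (as_submodule n (edge_ideal n E :: 'k::field mpoly set))"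
  shows "regular_bound n 1 (\<lambda>_. 0) (as_submodule n (edge_ideal n E :: 'k mpoly set))"
  unfolding regular_bound_def using gsubmod_edge_ideal[OF E] ac by (auto intro!: exI[of _ 3])

text \<open>Generation in degree 2 and the assumed vanishing confine the differences
  \<open>b - a\<close> to the interval from 2 to r. This makes their set finite, as
  \<open>Max\<close> requires, and \<open>nac\<close> puts r into it.\<close>

lemma regularity_edge_ideal:
  fixes E :: "nat set set" and r :: int
  assumes E: "graph_on n E" and r: "r = 2 \<or> r = 3"
    and ac: "\<And>i b. b > int i + r \<Longrightarrow>
      koszul_acyclic n 1 (\<lambda>_. 0) i b (as_submodule n (edge_ideal n E :: 'k::field mpoly set))"
    and nac: "\<not> koszul_acyclic n 1 (\<lambda>_. 0) i0 (int i0 + r) (as_submodule n (edge_ideal n E :: 'k mpoly set))"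
  shows "regularity n (edge_ideal n E :: 'k mpoly set) = r"
proof -
  let ?I = "edge_ideal n E :: 'k mpoly set"
  have I: "?I \<subseteq> polys n"
    by (auto simp: edge_ideal_iff[OF E])
  have betti: "graded_betti n ?I a b \<noteq> 0 \<longleftrightarrow> \<not> koszul_acyclic n 1 (\<lambda>_. 0) a b (as_submodule n ?I)" for a b
    using ac r by (intro graded_betti_nonzero_iff[OF I] regular_bound_edge_ideal[OF E]) auto
  define D where "D = {b - int a | a b. graded_betti n ?I a b \<noteq> 0}"
  have "2 \<le> z \<and> z \<le> r" if "z \<in> D" for z
  proof -
    have "\<exists>a b. z = b - int a \<and> graded_betti n ?I a b \<noteq> 0"
      using that unfolding D_def by simp
    then obtain a b where z: "z = b - int a" and "graded_betti n ?I a b \<noteq> 0"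
      by blast
    then have "\<not> b < int a + 2" "\<not> b > int a + r"
      unfolding betti using edge_koszul_acyclic_low[OF E, of b a] ac[of a b] by blast+
    then show ?thesis
      by (simp add: z)
  qed
  moreover from this have "finite D"
    by (intro finite_subset[of D "{2..r}"]) auto
  moreover have "r \<in> D"
    unfolding D_def using nac betti[of i0 "int i0 + r"] by force
  ultimately show ?thesis
    unfolding regularity_def D_def[symmetric] by (intro Max_eqI) auto
qed

section \<open>Circulant graphs\<close>

abbreviation (input) circulant_omit :: "nat \<Rightarrow> nat \<Rightarrow> nat set set"
  where "circulant_omit n j \<equiv> circulant_edges n ({1..n div 2} - {j})"

lemma graph_on_circulant: "graph_on n (circulant_edges n S)"
  by (auto simp: graph_on_def circulant_edges_def doubleton_eq_iff)

lemma circulant_omit_nonedge_iff: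
  assumes pq: "p \<in> {1..n}" "q \<in> {1..n}" and j: "1 \<le> j" "j \<le> n div 2"
  shows "{p, q} \<notin> circulant_omit n j \<longleftrightarrow>
    p = q \<or> \<bar>int p - int q\<bar> = int j \<or> \<bar>int p - int q\<bar> = int n - int j"
proof -
  define \<delta> where "\<delta> = nat \<bar>int p - int q\<bar>"
  have sym: "nat \<bar>int q - int p\<bar> = \<delta>"
    unfolding \<delta>_def by linarith
  have "{p, q} \<in> circulant_omit n j \<longleftrightarrow> p \<noteq> q \<and>
      (\<delta> \<in> {1..n div 2} - {j} \<or> n - \<delta> \<in> {1..n div 2} - {j})"
    using pq sym unfolding circulant_edges_def by (auto simp: doubleton_eq_iff \<delta>_def)
  also have "\<dots> \<longleftrightarrow> p \<noteq> q \<and> \<delta> \<noteq> j \<and> n - \<delta> \<noteq> j"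
  proof (cases "p = q")
    case False
    then have "1 \<le> \<delta>" "\<delta> < n"
      using pq by (auto simp: \<delta>_def)
    \<comment> \<open>One of the two differences is always in range. If one equals j, the other can
      be in range only for n = 2 j, where both equal j.\<close>
    then have "\<delta> \<in> {1..n div 2} \<or> n - \<delta> \<in> {1..n div 2}"
      "\<delta> = j \<Longrightarrow> n - \<delta> \<in> {1..n div 2} \<Longrightarrow> n - \<delta> = j"
      "n - \<delta> = j \<Longrightarrow> \<delta> \<in> {1..n div 2} \<Longrightarrow> \<delta> = j"
      using j by auto
    then show ?thesis
      by auto
  qed simp
  also have "\<dots> \<longleftrightarrow> \<not> (p = q \<or> \<bar>int p - int q\<bar> = int j \<or> \<bar>int p - int q\<bar> = int n - int j)"
  proof -
    have "\<delta> \<le> n" "int \<delta> = \<bar>int p - int q\<bar>"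
      using pq by (auto simp: \<delta>_def)
    then have "\<delta> = j \<longleftrightarrow> \<bar>int p - int q\<bar> = int j" "n - \<delta> = j \<longleftrightarrow> \<bar>int p - int q\<bar> = int n - int j"
      by linarith+
    then show ?thesis
      by simp
  qed
  finally show ?thesis
    by blast
qed

text \<open>For these n the differences j and n - j are exactly the positive multiples of j below n,
  so nonadjacency is congruence modulo j and in particular transitive.\<close>

lemma circulant_omit_nonedge_iff_dvd:
  assumes pq: "p \<in> {1..n}" "q \<in> {1..n}" and j: "1 \<le> j" and n: "n = 2 * j \<or> n = 3 * j"
  shows "{p, q} \<notin> circulant_omit n j \<longleftrightarrow> int j dvd int p - int q"
proof -
  have "{p, q} \<notin> circulant_omit n j \<longleftrightarrow>
      p = q \<or> \<bar>int p - int q\<bar> = int j \<or> \<bar>int p - int q\<bar> = int n - int j"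
    using n by (intro circulant_omit_nonedge_iff pq j) auto
  also have "\<dots> \<longleftrightarrow> int j dvd int p - int q"
  proof
    assume "p = q \<or> \<bar>int p - int q\<bar> = int j \<or> \<bar>int p - int q\<bar> = int n - int j"
    then have "\<bar>int p - int q\<bar> = int j * 0 \<or> \<bar>int p - int q\<bar> = int j * 1 \<or> \<bar>int p - int q\<bar> = int j * 2"
      using n by auto
    then have "int j dvd \<bar>int p - int q\<bar>"
      by (metis dvd_triv_left)
    then show "int j dvd int p - int q"
      by simp
  next
    assume "int j dvd int p - int q"
    then have "int j dvd \<bar>int p - int q\<bar>"
      by simp
    then obtain k where k: "\<bar>int p - int q\<bar> = int j * k"
      by (rule dvdE)
    have "int j * k < int j * 3" "0 \<le> int j * k"
      using k[symmetric] pq n by auto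
    then have "k < 3" "0 \<le> k"
      using j by (simp_all add: zero_le_mult_iff)
    then have "k = 0 \<or> k = 1 \<or> k = 2"
      by linarith
    moreover have "k \<noteq> 2" if "n = 2 * j"
      using k pq that by auto
    ultimately show "p = q \<or> \<bar>int p - int q\<bar> = int j \<or> \<bar>int p - int q\<bar> = int n - int j"
      using k n by auto
  qed
  finally show ?thesis .
qed

lemma circulant_omit_nonedge_cong:
  assumes "p \<in> {1..n}" "q \<in> {1..n}" and j: "1 \<le> j" "j \<le> n div 2"
    and "{p, q} \<notin> circulant_omit n j" "p \<noteq> q"
  obtains s where "s = 1 \<or> s = - 1" "int n dvd int p - int q - s * int j"
proof -
  have "\<bar>int p - int q\<bar> = int j \<or> \<bar>int p - int q\<bar> = int n - int j"
    using circulant_omit_nonedge_iff[OF assms(1-4)] assms(5,6) by blast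
  then have "int p - int q = 1 * int j \<or> int p - int q = - 1 * int j \<or>
      int p - int q = - 1 * int j + int n \<or> int p - int q = 1 * int j - int n"
    by linarith
  then show ?thesis
    using that[of 1] that[of "- 1"] by (elim disjE) simp_all
qed

text \<open>Going once around three mutually nonadjacent vertices gives a sum of three signs times j
  that is 0 modulo n. That sum is 1 or 3 up to sign, so n divides 3 j, and 0 < 3 j < 2 n leaves n =
  3 j.\<close>

lemma circulant_omit_triple_edgy:
  assumes j: "1 \<le> j" "j \<le> n div 2" and n: "n \<noteq> 3 * j"
    and S: "S \<subseteq> {1..n}" "card S = 3"
  shows "edgy (circulant_omit n j) S"
proof (rule ccontr)
  assume ne: "\<not> edgy (circulant_omit n j) S"
  obtain a b c where abc: "S = {a, b, c}" "a \<noteq> b" "b \<noteq> c" "c \<noteq> a"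
    using S(2) by (metis card_3_iff)
  have ad: "{a, b} \<notin> circulant_omit n j" "{b, c} \<notin> circulant_omit n j" "{c, a} \<notin> circulant_omit n j"
    using ne unfolding edgy_def abc(1) by blast+
  have mem: "a \<in> {1..n}" "b \<in> {1..n}" "c \<in> {1..n}"
    using S(1) abc(1) by auto
  obtain s1 where s1: "s1 = 1 \<or> s1 = - 1" "int n dvd int a - int b - s1 * int j"
    by (rule circulant_omit_nonedge_cong[OF mem(1,2) j ad(1) abc(2)])
  obtain s2 where s2: "s2 = 1 \<or> s2 = - 1" "int n dvd int b - int c - s2 * int j"
    by (rule circulant_omit_nonedge_cong[OF mem(2,3) j ad(2) abc(3)])
  obtain s3 where s3: "s3 = 1 \<or> s3 = - 1" "int n dvd int c - int a - s3 * int j"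
    by (rule circulant_omit_nonedge_cong[OF mem(3,1) j ad(3) abc(4)])
  have "int n dvd (int a - int b - s1 * int j) + (int b - int c - s2 * int j) + (int c - int a - s3 * int j)"
    using s1 s2 s3 by (intro dvd_add)
  also have "\<dots> = - ((s1 + s2 + s3) * int j)"
    by (simp add: algebra_simps)
  finally have "int n dvd (s1 + s2 + s3) * int j"
    by simp
  moreover have "s1 + s2 + s3 \<in> {- 3, - 1, 1, 3}"
    using s1 s2 s3 by auto
  ultimately have "int n dvd int j \<or> int n dvd 3 * int j"
    by auto
  then have "n dvd j \<or> n dvd 3 * j"
    by (metis int_dvd_int_iff of_nat_mult of_nat_numeral)
  then obtain k where k: "3 * j = n * k"
    by (metis dvdE dvd_mult)
  have "n * k < n * 2" "0 < n * k"
    using j k[symmetric] by auto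
  then have "k = 1"
    by auto
  with k n show False
    by simp
qed

text \<open>The multiples of j modulo n, shifted by one into the vertex range, form a cycle of
  length n / d in the complement. Length 1 contradicts j \<le> n / 2, length 2 forces n = 2 j, and
  length 3 means n = 3 d.\<close>

lemma circulant_omit_cycle:
  assumes j: "1 \<le> j" "j \<le> n div 2" and d: "d = gcd j n" and n: "n \<noteq> 2 * j" "n \<noteq> 3 * d"
  obtains p L where "L \<ge> 4" "inj_on p {..<L}" "p ` {..<L} \<subseteq> {1..n}"
    "\<And>k. Suc k < L \<Longrightarrow> {p k, p (Suc k)} \<notin> circulant_omit n j" "{p 0, p (L - 1)} \<notin> circulant_omit n j"
proof -
  define L where "L = n div d"
  define p where "p k = (k * j) mod n + 1" for k
  have n0: "n > 0"
    using j by auto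
  have d0: "d > 0" and dj: "d dvd j" and dn: "d dvd n"
    using j by (auto simp: d)
  have nL: "n = L * d"
    using dn by (simp add: L_def)
  have "d \<le> j"
    using dj j by (intro dvd_imp_le) auto
  have L: "L \<ge> 4"
  proof (rule ccontr)
    assume "\<not> L \<ge> 4"
    then consider "L = 0" | "L = 1" | "L = 2" | "L = 3"
      by linarith
    then show False
      using nL n n0 j \<open>d \<le> j\<close> by cases auto
  qed
  have rng: "p k \<in> {1..n}" for k
    using mod_less_divisor[OF n0, of "k * j"] by (simp add: p_def)
  have inj: "inj_on p {..<L}"
  proof (rule inj_onI)
    fix k l assume kl: "k \<in> {..<L}" "l \<in> {..<L}" "p k = p l"
    then have "(k * j) mod n = (l * j) mod n"
      by (simp add: p_def)
    then have "int (k * j) mod int n = int (l * j) mod int n"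
      by (metis zmod_int)
    then have "int n dvd int (k * j) - int (l * j)"
      by (simp only: mod_eq_dvd_iff)
    moreover have "int (k * j) - int (l * j) = int d * ((int k - int l) * int (j div d))"
    proof -
      have "int j = int d * int (j div d)"
        using dj by (metis dvd_mult_div_cancel of_nat_mult)
      then have "(int k - int l) * int j = (int k - int l) * (int d * int (j div d))"
        by (rule arg_cong)
      also have "\<dots> = int d * ((int k - int l) * int (j div d))"
        by (rule mult.left_commute)
      finally show ?thesis
        by (simp add: left_diff_distrib)
    qed
    moreover have "int n = int d * int L"
      using nL by (metis mult.commute of_nat_mult)
    ultimately have "int d * int L dvd int d * ((int k - int l) * int (j div d))"
      by (simp only:)
    then have "int L dvd (int k - int l) * int (j div d)"
      using d0 by (simp only: dvd_mult_cancel_left of_nat_eq_0_iff) simp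
    moreover have "coprime (int L) (int (j div d))"
      using div_gcd_coprime[of j n] j unfolding L_def d by (simp add: coprime_commute)
    ultimately have "int L dvd int k - int l"
      by (simp add: coprime_dvd_mult_left_iff)
    moreover have "\<bar>int k - int l\<bar> < int L"
      using kl by auto
    ultimately show "k = l"
      using dvd_imp_le_int[of "int k - int l" "int L"] by force
  qed
  have ne: "{p k, p l} \<notin> circulant_omit n j" if "(k * j + j) mod n = (l * j) mod n" for k l
  proof -
    define x where "x = (k * j) mod n"
    have x: "x < n"
      using n0 by (simp add: x_def)
    have "(l * j) mod n = (x + j) mod n"
      unfolding x_def that[symmetric] by (simp add: mod_add_left_eq)
    also have "\<dots> = (if x + j < n then x + j else x + j - n)"
      using x j by (auto simp: mod_if)
    finally have "p k = x + 1" "p l = (if x + j < n then x + j else x + j - n) + 1"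
      by (simp_all add: p_def x_def)
    then show ?thesis
      using x j by (subst circulant_omit_nonedge_iff[OF rng rng j]) auto
  qed
  show ?thesis
  proof (rule that[OF L inj])
    show "p ` {..<L} \<subseteq> {1..n}"
      using rng by auto
    show "{p k, p (Suc k)} \<notin> circulant_omit n j" for k
      by (rule ne) (simp add: add.commute)
    have "((L - 1) * j + j) = L * j"
      using L by (simp add: algebra_simps)
    also have "\<dots> = n * (j div d)"
      using nL dj by (metis dvd_div_mult_self mult.assoc mult.commute)
    finally have "((L - 1) * j + j) mod n = (0 * j) mod n"
      by simp
    from ne[OF this] show "{p 0, p (L - 1)} \<notin> circulant_omit n j"
      by (simp add: insert_commute)
  qed
qed

theorem theorem3p3:
  fixes n j d :: nat and I :: "'k::field mpoly set"
  assumes "n \<ge> 1" and "1 \<le> j" and "j \<le> n div 2"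
    and "I = edge_ideal n (circulant_edges n ({1..n div 2} - {j}))"
    and "I \<noteq> {0}"
    and "d = gcd j n"
  shows "regularity n I = (if n = 2 * j \<or> n = 3 * d then 2 else 3)"
proof -
  define E where "E = circulant_omit n j"
  have E: "graph_on n E"
    unfolding E_def by (rule graph_on_circulant)
  have I: "I = edge_ideal n E"
    using assms(4) by (simp add: E_def)
  show ?thesis
  proof (cases "n = 2 * j \<or> n = 3 * d")
    case True
    \<comment> \<open>If n = 3 d, then j is a multiple of d with 0 < j \<le> n / 2 < 2 d, so j =
      d.\<close>
    have nj: "n = 2 * j \<or> n = 3 * j"
    proof (cases "n = 2 * j")
      case False
      with True have n: "n = 3 * d"
        by simp
      obtain k where k: "j = d * k"
        using assms(6) by (metis dvdE gcd_dvd1)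
      have "d * k < d * 2" "0 < d * k"
        using assms(2,3) k[symmetric] n by auto
      then have "k = 1"
        by auto
      with k n show ?thesis
        by simp
    qed simp
    have nonedge: "{p, q} \<notin> E \<longleftrightarrow> int j dvd int p - int q" if "p \<in> {1..n}" "q \<in> {1..n}" for p q
      unfolding E_def using circulant_omit_nonedge_iff_dvd[OF that assms(2) nj] .
    have ac: "koszul_acyclic n 1 (\<lambda>_. 0) i b (as_submodule n (edge_ideal n E :: 'k mpoly set))"
      if "b > int i + 2" for i b
    proof (rule edge_koszul_acyclic_multipartite[OF E])
      show "{p, r} \<notin> E" if "p \<in> {1..n}" "q \<in> {1..n}" "r \<in> {1..n}" "{p, q} \<notin> E" "{q, r} \<notin> E" for p q r
        using that dvd_add[of "int j" "int p - int q" "int q - int r"] by (simp add: nonedge)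
    qed (use that in simp)
    \<comment> \<open>The graph is edgeless for n = 2 and n = 3 with j = 1; the ideal is then zero,
      which is excluded.\<close>
    have "\<exists>p q. {p, q} \<in> E"
    proof (rule ccontr)
      assume "\<nexists>p q. {p, q} \<in> E"
      then have "I = {x \<in> polys n. keys x = {}}"
        unfolding I by (auto simp: edge_ideal_iff[OF E] edgy_def)
      with assms(5) show False
        by (auto simp: keys_eq_empty)
    qed
    then obtain p q where "{p, q} \<in> E"
      by blast
    then have "regularity n (edge_ideal n E :: 'k mpoly set) = 2"
      using edge_not_koszul_acyclic_0[OF E, of p q, where 'k = 'k] ac
      by (intro regularity_edge_ideal[OF E, where ?i0.0 = 0]) simp_all
    with True show ?thesis
      by (simp add: I)
  next
    case False
    have "n \<noteq> 3 * j"
    proof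
      assume "n = 3 * j"
      then have "d = j"
        using assms(6) by simp
      with False \<open>n = 3 * j\<close> show False
        by simp
    qed
    then have triple: "edgy E S" if "S \<subseteq> {1..n}" "card S = 3" for S
      unfolding E_def using circulant_omit_triple_edgy[OF assms(2,3) _ that] by simp
    have ne: "n \<noteq> 2 * j" "n \<noteq> 3 * d"
      using False by auto
    obtain p L where pL: "L \<ge> 4" "inj_on p {..<L}" "p ` {..<L} \<subseteq> {1..n}"
      "\<And>k. Suc k < L \<Longrightarrow> {p k, p (Suc k)} \<notin> E" "{p 0, p (L - 1)} \<notin> E"
      by (rule circulant_omit_cycle[OF assms(2,3,6) ne, folded E_def], rule that)
    have "\<not> koszul_acyclic n 1 (\<lambda>_. 0) (L - 3) (int L) (as_submodule n (edge_ideal n E :: 'k mpoly set))"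
      by (rule edge_not_koszul_acyclic_cycle[OF E triple pL(2,3,1,4,5)])
    \<comment> \<open>Since L is at least 4 the subtraction is not truncated, and the cycle sits at
      \<open>b - i = 3\<close>.\<close>
    moreover have "int (L - 3) + 3 = int L"
      using pL(1) by simp
    ultimately have "\<not> koszul_acyclic n 1 (\<lambda>_. 0) (L - 3) (int (L - 3) + 3) (as_submodule n (edge_ideal n E :: 'k mpoly set))"
      by (simp only: not_False_eq_True)
    moreover have "koszul_acyclic n 1 (\<lambda>_. 0) i b (as_submodule n (edge_ideal n E :: 'k mpoly set))"
      if "b > int i + 3" for i b
      using that by (intro edge_koszul_acyclic_no_triple[OF E triple]) linarith+
    ultimately have "regularity n (edge_ideal n E :: 'k mpoly set) = 3"
      by (intro regularity_edge_ideal[OF E, where ?i0.0 = "L - 3"]) blast+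
    with False show ?thesis
      by (simp add: I)
  qed
qed

end
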